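(* Every $n$-vertex instance $(G,L)$ of $\textsc{LHom}(C_5)$ in which $G$ has diameter at most $5$ can be solved in time $\mathcal{O}\left(\exp\left((n\log n)^{\frac{4}{5}}\right)\right)$.
   Context: All graphs are finite and simple. $C_5$ is the cycle on $5$ vertices. For a fixed graph $H$, in the list homomorphism problem $\textsc{LHom}(H)$ the input is a graph $G$ together with lists $L: V(G)\to 2^{V(H)}$, and the question is whether there is a mapping $\varphi: V(G)\to V(H)$ with $\varphi(v)\in L(v)$ for all $v\in V(G)$ and $\varphi(u)\varphi(v)\in E(H)$ for every edge $uv\in E(G)$. *)

theory Defs
  imports "Graph_Theory.Graph_Theory" "HOL-Library.Landau_Symbols"
begin

text \<open>
  Finite simple graphs are the symmetric loop-free finite digraphs of \<^locale>\<open>pair_graph\<close>: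
  an edge \<open>uv\<close> is the pair of arcs \<open>(u, v)\<close>, \<open>(v, u)\<close>.
\<close>

definition cycle_graph :: "nat \<Rightarrow> nat pair_pre_digraph" where
  "cycle_graph k = \<lparr> pverts = {..<k},
     parcs = {(i, j). i < k \<and> j < k \<and> (j = (i + 1) mod k \<or> i = (j + 1) mod k)} \<rparr>"

lemma pair_graph_cycle_graph:
  assumes "k \<ge> 3"
  shows "pair_graph (cycle_graph k)"
proof
  show "finite (parcs (cycle_graph k))"
    by (rule finite_subset[of _ "{..<k} \<times> {..<k}"]) (auto simp: cycle_graph_def)
  have ne: "(i + 1) mod k \<noteq> i" if "i < k" for i
    using that assms by (cases "i + 1 = k") auto
  show "fst e \<noteq> snd e" if "e \<in> parcs (cycle_graph k)" for e
    using that ne ne[symmetric] by (auto simp: cycle_graph_def)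
qed (auto simp: cycle_graph_def symmetric_def sym_def)

text \<open>
  The distance is the infimum of the lengths of all walks, hence \<open>\<infinity>\<close> between different
  components, so a graph of finite diameter is connected.
\<close>

definition graph_dist :: "'a pair_pre_digraph \<Rightarrow> 'a \<Rightarrow> 'a \<Rightarrow> ereal" where
  "graph_dist G = wf_digraph.\<mu> (with_proj G) (\<lambda>_. 1)"

definition diameter :: "'a pair_pre_digraph \<Rightarrow> ereal" where
  "diameter G = (SUP u\<in>pverts G. SUP v\<in>pverts G. graph_dist G u v)"

definition lhom_instance ::
  "'b pair_pre_digraph \<Rightarrow> 'a pair_pre_digraph \<Rightarrow> ('a \<Rightarrow> 'b set) \<Rightarrow> bool" where
  "lhom_instance H G L \<longleftrightarrow> pair_graph G \<and> (\<forall>v\<in>pverts G. L v \<subseteq> pverts H)"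

definition list_hom ::
  "'b pair_pre_digraph \<Rightarrow> 'a pair_pre_digraph \<Rightarrow> ('a \<Rightarrow> 'b set) \<Rightarrow> ('a \<Rightarrow> 'b) \<Rightarrow> bool" where
  "list_hom H G L \<phi> \<longleftrightarrow>
     (\<forall>v\<in>pverts G. \<phi> v \<in> L v) \<and> (\<forall>(u, v)\<in>parcs G. (\<phi> u, \<phi> v) \<in> parcs H)"

text \<open>
  Running time is measured on a random access machine with unit cost per operation, whose
  arithmetic is restricted to addition and truncated subtraction (no multiplication, so that
  one step lengthens numbers by at most one bit). Memory cells are indexed by and hold natural
  numbers; \<open>Load a\<close> reads the cell whose address is the value of \<open>a\<close>, and \<open>Store a b\<close>
  writes the value of \<open>b\<close> to the cell whose address is the value of \<open>a\<close>. Conditions hold iff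
  they evaluate to a nonzero number. Every expression node, every store and every test counts
  as one step.
\<close>

type_synonym mem = "nat \<Rightarrow> nat"

datatype expr = Const nat | Load expr | Add expr expr | Sub expr expr

fun eval_expr :: "expr \<Rightarrow> mem \<Rightarrow> nat" where
  "eval_expr (Const c) m = c"
| "eval_expr (Load a) m = m (eval_expr a m)"
| "eval_expr (Add a b) m = eval_expr a m + eval_expr b m"
| "eval_expr (Sub a b) m = eval_expr a m - eval_expr b m"

fun expr_cost :: "expr \<Rightarrow> nat" where
  "expr_cost (Const c) = 1"
| "expr_cost (Load a) = expr_cost a + 1"
| "expr_cost (Add a b) = expr_cost a + expr_cost b + 1"
| "expr_cost (Sub a b) = expr_cost a + expr_cost b + 1"

datatype prog = Skip | Store expr expr | Seq prog prog | If expr prog prog | While expr prog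

inductive exec :: "prog \<Rightarrow> mem \<Rightarrow> nat \<Rightarrow> mem \<Rightarrow> bool" where
  Skip: "exec Skip m 1 m"
| Store: "exec (Store a b) m (expr_cost a + expr_cost b + 1) (m(eval_expr a m := eval_expr b m))"
| Seq: "exec p m t m' \<Longrightarrow> exec q m' t' m'' \<Longrightarrow> exec (Seq p q) m (t + t') m''"
| IfTrue: "eval_expr a m \<noteq> 0 \<Longrightarrow> exec p m t m' \<Longrightarrow> exec (If a p q) m (expr_cost a + 1 + t) m'"
| IfFalse: "eval_expr a m = 0 \<Longrightarrow> exec q m t m' \<Longrightarrow> exec (If a p q) m (expr_cost a + 1 + t) m'"
| WhileFalse: "eval_expr a m = 0 \<Longrightarrow> exec (While a p) m (expr_cost a + 1) m"
| WhileTrue: "eval_expr a m \<noteq> 0 \<Longrightarrow> exec p m t m' \<Longrightarrow> exec (While a p) m' t' m'' \<Longrightarrow>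
    exec (While a p) m (expr_cost a + 1 + t + t') m''"

inductive_cases exec_SkipE: "exec Skip m t m'"
  and exec_StoreE: "exec (Store a b) m t m'"
  and exec_SeqE: "exec (Seq p q) m t m'"
  and exec_IfE: "exec (If a p q) m t m'"
  and exec_WhileE: "exec (While a p) m t m'"

lemma exec_deterministic:
  "exec p m t m' \<Longrightarrow> exec p m u m'' \<Longrightarrow> u = t \<and> m'' = m'"
proof (induction arbitrary: u m'' rule: exec.induct)
  case Skip
  then show ?case by (auto elim: exec_SkipE)
next
  case Store
  then show ?case by (auto elim: exec_StoreE)
next
  case (Seq p m t m1 q t' m2)
  from Seq.prems show ?case
  proof (rule exec_SeqE)
    fix v m' v'
    assume u: "u = v + v'" and p: "exec p m v m'" and q: "exec q m' v' m''"
    from Seq.IH(1)[OF p] have "v = t" "m' = m1" by simp_all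
    with Seq.IH(2) q u show ?thesis by blast
  qed
next
  case IfTrue
  from IfTrue.prems show ?case by (rule exec_IfE) (use IfTrue.hyps(1) IfTrue.IH in \<open>fastforce+\<close>)
next
  case IfFalse
  from IfFalse.prems show ?case by (rule exec_IfE) (use IfFalse.hyps(1) IfFalse.IH in \<open>fastforce+\<close>)
next
  case WhileFalse
  from WhileFalse.prems show ?case by (rule exec_WhileE) (use WhileFalse.hyps in auto)
next
  case (WhileTrue a m p t m1 t' m2)
  from WhileTrue.prems show ?case
  proof (rule exec_WhileE)
    fix v m' v'
    assume u: "u = Suc (expr_cost a + v + v')"
      and p: "exec p m v m'" and q: "exec (While a p) m' v' m''"
    from WhileTrue.IH(1)[OF p] have "v = t" "m' = m1" by simp_all
    with WhileTrue.IH(2) q u show ?thesis by simp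
  qed (use WhileTrue.hyps(1) in simp)
qed

text \<open>
  Input format for target graphs on \<open>{..<k}\<close> and input graphs on \<open>{..<n}\<close>: cell \<open>0\<close> holds
  \<open>n\<close>, followed by the \<open>n * n\<close> bits of the adjacency matrix (row by row) and the \<open>n * k\<close> bits
  saying whether \<open>c \<in> L v\<close> (ordered by \<open>v\<close>, then \<open>c\<close>). All other cells are \<open>0\<close>.
\<close>

definition lhom_input ::
  "nat pair_pre_digraph \<Rightarrow> nat pair_pre_digraph \<Rightarrow> (nat \<Rightarrow> nat set) \<Rightarrow> mem" where
  "lhom_input H G L i = (let n = card (pverts G); k = card (pverts H) in
     if i = 0 then n
     else if i \<le> n * n then of_bool (((i - 1) div n, (i - 1) mod n) \<in> parcs G)
     else if i \<le> n * n + n * k then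
       of_bool ((i - n * n - 1) mod k \<in> L ((i - n * n - 1) div k))
     else 0)"

text \<open>The answer is left in cell \<open>0\<close>.\<close>

definition solves_lhom_within ::
  "prog \<Rightarrow> nat pair_pre_digraph \<Rightarrow> nat pair_pre_digraph \<Rightarrow> (nat \<Rightarrow> nat set) \<Rightarrow> nat \<Rightarrow> bool" where
  "solves_lhom_within p H G L b \<longleftrightarrow>
     (\<exists>t m. exec p (lhom_input H G L) t m \<and> t \<le> b \<and> m 0 = of_bool (\<exists>\<phi>. list_hom H G L \<phi>))"

end

theory Submission
  imports Defs "HOL-Real_Asymp.Real_Asymp"
begin

text \<open>
  Write \<open>tri e = {e, e + 2, e - 2}\<close> for the colours reachable by walks of length two from \<open>e\<close>, and
  call a list good if it has at most two elements or equals some \<open>tri e\<close>. On arc consistent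
  instances with good lists the median with respect to the orders \<open>e - 2 < e < e + 2\<close> is a
  polymorphism, so such an instance is solved greedily: fix one colour after the other, restore arc
  consistency, and undo the choice only if some list becomes empty.

  A few guesses reach such an instance. Let \<open>d\<close> be about \<open>n\<close> to the power \<open>1/4\<close> and fix a solution
  \<open>\<phi>\<close>. As long as fixing some \<open>\<phi> v\<close> shrinks the lists of at least \<open>d\<close> neighbours of \<open>v\<close>, guess it; this
  happens at most \<open>5 n / d\<close> times. Afterwards every pair \<open>(v, c)\<close> that would shrink \<open>d\<close> neighbouring
  lists is known not to belong to \<open>\<phi>\<close> and is deleted. Now every vertex with at least two colours has
  fewer than \<open>2 d\<close> such neighbours, since a list compatible with two different colours of a neighbour
  has at most one element. A vertex whose list is not good has distance at least three from every
  vertex with at most one colour; hence, as the diameter is at most 5, guessing \<open>\<phi>\<close> on the ball of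
  radius three around one such vertex brings all other ones within distance two of a fixed vertex,
  which makes their lists good.

  So \<open>O(d\<^sup>3)\<close> guesses suffice. A random access machine tries all of them, in time
  \<open>exp (O(n\<close> to the power \<open>3/4\<close> times \<open>log n))\<close>, which leaves so much room that all polynomial
  overheads, including constant powers of the number of guesses, are negligible.
\<close>

section \<open>List homomorphisms to the five-cycle\<close>

definition adj5 :: "nat \<Rightarrow> nat \<Rightarrow> bool" where
  "adj5 c c' \<longleftrightarrow> (c, c') \<in> parcs (cycle_graph 5)"

definition tri :: "nat \<Rightarrow> nat set" where
  "tri e = {e, (e + 2) mod 5, (e + 3) mod 5}"

definition good :: "nat set \<Rightarrow> bool" where
  "good A \<longleftrightarrow> (\<exists>a b. A \<subseteq> {a, b}) \<or> (\<exists>e<5. A = tri e)"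

lemma less_5_cases: "(c::nat) < 5 \<longleftrightarrow> c = 0 \<or> c = 1 \<or> c = 2 \<or> c = 3 \<or> c = 4"
  by auto

lemma adj5_iff:
  "adj5 c c' \<longleftrightarrow> c < 5 \<and> (c' = (c + 1) mod 5 \<or> c' = (c + 4) mod 5)"
proof (cases "c < 5 \<and> c' < 5")
  case True
  then show ?thesis
    unfolding less_5_cases adj5_def cycle_graph_def by (elim conjE disjE; simp)
next
  case False
  then show ?thesis unfolding adj5_def cycle_graph_def by auto
qed

lemma adj5_sym: "adj5 c c' \<Longrightarrow> adj5 c' c"
  unfolding adj5_def cycle_graph_def by auto

lemma adj5_less: "adj5 c c' \<Longrightarrow> c < 5" "adj5 c c' \<Longrightarrow> c' < 5"
  unfolding adj5_iff by auto

lemma adj5_dist2: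
  assumes "adj5 e c" "adj5 c c'"
  shows "c' \<in> tri e"
  using adj5_less(1)[OF assms(1), unfolded less_5_cases] assms
  by (elim disjE) (auto simp: adj5_iff tri_def)

text \<open>The five-cycle contains no four-cycle. Hence a list compatible with two colours of a
  neighbour is decided.\<close>

lemma adj5_unique:
  assumes "adj5 c1 a" "adj5 c2 a" "adj5 c1 b" "adj5 c2 b" "c1 \<noteq> c2"
  shows "a = b"
  using adj5_less(1)[OF assms(1), unfolded less_5_cases] adj5_less(1)[OF assms(2), unfolded less_5_cases]
    assms
  by (elim disjE) (auto simp: adj5_iff)

text \<open>A proper subset of the three-element set \<open>tri e\<close> has at most two elements,
  so goodness survives every deletion of colours.\<close>

lemma good_subset:
  assumes "good B" "A \<subseteq> B"
  shows "good A"
proof (cases "A = B")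
  case False
  show ?thesis
  proof (cases "\<exists>a b. B \<subseteq> {a, b}")
    case True
    with assms show ?thesis unfolding good_def by blast
  next
    case 2: False
    with assms(1) obtain e where "B = tri e" unfolding good_def by blast
    with False assms(2) have "A \<subseteq> tri e" "\<exists>x\<in>tri e. x \<notin> A" by auto
    then have "A \<subseteq> {e, (e + 2) mod 5} \<or> A \<subseteq> {e, (e + 3) mod 5} \<or> A \<subseteq> {(e + 2) mod 5, (e + 3) mod 5}"
      unfolding tri_def by auto
    then show ?thesis unfolding good_def by blast
  qed
qed (use assms in simp)

lemma good_empty: "good {}"
  unfolding good_def by blast

text \<open>Used when the colours at both ends of an edge are moved to the centres of their lists:
  the edge stays satisfied.\<close>

lemma adj5_tri_tri:
  assumes "c < 5" "e < 5" "\<forall>a\<in>tri c. \<exists>x\<in>tri e. adj5 a x"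
  shows "adj5 c e"
proof -
  have "\<forall>c\<in>{0,1,2,3,4}. \<forall>e\<in>{0,1,2,3,4}. (\<forall>a\<in>tri c. \<exists>x\<in>tri e. adj5 a x) \<longrightarrow> adj5 c e"
    by (simp add: adj5_iff tri_def)
  moreover have "c \<in> {0,1,2,3,4}" "e \<in> {0,1,2,3,4}" using assms(1,2) by auto
  ultimately show ?thesis using assms by blast
qed

text \<open>If \<open>A'\<close> missed both neighbours \<open>c + 1\<close> and
  \<open>c + 4\<close> of \<open>c\<close>, then \<open>y\<close> and \<open>z\<close> would be
  \<open>c + 3\<close> and \<open>c + 2\<close>. Together with \<open>x\<close> the list
  \<open>A\<close> would contain three consecutive colours, which no good list does.\<close>

lemma tri_gap_support:
  assumes c: "c < 5" and "good A" "A' \<subseteq> A"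
    and 1: "adj5 c x" "x \<in> A" and 2: "adj5 ((c + 2) mod 5) y" "y \<in> A'"
    and 3: "adj5 ((c + 3) mod 5) z" "z \<in> A'"
  shows "\<exists>w\<in>A'. adj5 c w"
proof (rule ccontr)
  assume no: "\<not> ?thesis"
  have y: "y = (c + 3) mod 5"
    using c[unfolded less_5_cases] no 2 by (elim disjE) (auto simp: adj5_iff)
  have z: "z = (c + 2) mod 5"
    using c[unfolded less_5_cases] no 3 by (elim disjE) (auto simp: adj5_iff)
  have "x \<noteq> y" "x \<noteq> z" "y \<noteq> z"
    using c[unfolded less_5_cases] 1(1) y z by ((elim disjE, auto simp: adj5_iff)+)
  moreover have sub: "{x, y, z} \<subseteq> A" using assms by auto
  ultimately have "\<not> A \<subseteq> {a, b}" for a b by auto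
  then obtain e where e: "e < 5" "A = tri e"
    using \<open>good A\<close> unfolding good_def by blast
  show False using c[unfolded less_5_cases] e(1)[unfolded less_5_cases] sub e(2) 1(1) y z
    by (elim disjE) (auto simp: adj5_iff tri_def)
qed

text \<open>The colour \<open>a\<close> is an end of \<open>tri c\<close>. One of its neighbours is
  adjacent to \<open>c\<close>; the other is the opposite end, whose only neighbour besides
  \<open>a\<close> lies outside \<open>tri c\<close>.\<close>

lemma tri_retract:
  assumes "c < 5" "a \<in> tri c" "a \<noteq> c" "adj5 a b" "adj5 b w" "w \<in> tri c" "w \<noteq> a"
  shows "adj5 c b"
proof -
  have "\<forall>c\<in>{0,1,2,3,4}. \<forall>a\<in>tri c. \<forall>b\<in>{0,1,2,3,4}. \<forall>w\<in>tri c.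
      a \<noteq> c \<and> adj5 a b \<and> adj5 b w \<and> w \<noteq> a \<longrightarrow> adj5 c b"
    by (simp add: adj5_iff tri_def)
  moreover have "c \<in> {0,1,2,3,4}" "b \<in> {0,1,2,3,4}"
    using assms(1) adj5_less(2)[OF assms(4)] by auto
  ultimately show ?thesis using assms by blast
qed

section \<open>Arc consistency and its closure operator\<close>

locale lgraph =
  fixes n :: nat and E :: "nat \<Rightarrow> nat \<Rightarrow> bool"
  assumes E_sym: "E v y \<Longrightarrow> E y v" and E_less: "E v y \<Longrightarrow> v < n"
begin

definition ac :: "(nat \<Rightarrow> nat set) \<Rightarrow> bool" where
  "ac L \<longleftrightarrow> (\<forall>v y. E v y \<longrightarrow> (\<forall>c\<in>L v. \<exists>c'\<in>L y. adj5 c c'))"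

definition sol :: "(nat \<Rightarrow> nat set) \<Rightarrow> (nat \<Rightarrow> nat) \<Rightarrow> bool" where
  "sol L \<phi> \<longleftrightarrow> (\<forall>v<n. \<phi> v \<in> L v) \<and> (\<forall>v y. E v y \<longrightarrow> adj5 (\<phi> v) (\<phi> y))"

text \<open>Arc consistent assignments are closed under pointwise unions, so this supremum is arc
  consistent itself. It is what remains after deleting unsupported colours exhaustively.\<close>

definition gac :: "(nat \<Rightarrow> nat set) \<Rightarrow> nat \<Rightarrow> nat set" where
  "gac M = Sup {K. ac K \<and> K \<le> M}"

lemma E_less': "E v y \<Longrightarrow> y < n"
  using E_sym E_less by blast

lemma acD: "ac L \<Longrightarrow> E v y \<Longrightarrow> c \<in> L v \<Longrightarrow> \<exists>c'\<in>L y. adj5 c c'"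
  unfolding ac_def by blast

lemma gac_le: "gac M \<le> M"
  unfolding gac_def by (rule Sup_least) auto

lemma gac_greatest: "ac K \<Longrightarrow> K \<le> M \<Longrightarrow> K \<le> gac M"
  unfolding gac_def by (rule Sup_upper) auto

lemma ac_gac: "ac (gac M)"
  unfolding ac_def
proof (intro allI impI ballI)
  fix v y c
  assume "E v y" "c \<in> gac M v"
  then obtain K where K: "ac K" "K \<le> M" "c \<in> K v" unfolding gac_def by auto
  with \<open>E v y\<close> obtain c' where "c' \<in> K y" "adj5 c c'" using acD by blast
  with gac_greatest[OF K(1,2)] show "\<exists>c'\<in>gac M y. adj5 c c'" by (auto simp: le_fun_def)
qed

lemma gac_mono: "M \<le> M' \<Longrightarrow> gac M \<le> gac M'"
  by (meson ac_gac gac_greatest gac_le order_trans)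

text \<open>The singletons \<open>{\<phi> v}\<close> form an arc consistent assignment below
  \<open>M\<close>, so the closure keeps every colour used by a solution.\<close>

lemma sol_gac:
  assumes "sol M \<phi>"
  shows "sol (gac M) \<phi>"
proof -
  let ?K = "\<lambda>v. if v < n then {\<phi> v} else {}"
  have "ac ?K" using assms E_less E_less' unfolding ac_def sol_def by auto
  moreover have "?K \<le> M" using assms unfolding sol_def le_fun_def by auto
  ultimately have "?K \<le> gac M" by (rule gac_greatest)
  then show ?thesis using assms unfolding sol_def le_fun_def by (auto split: if_splits)
qed

text \<open>In the orders \<open>c - 2 < c < c + 2\<close> the maximality of \<open>gac\<close>
  leaves no gaps in the lists of \<open>L'\<close>, so each colour of \<open>\<phi>\<close> can be
  moved to the nearest remaining one. Gaps are excluded by \<open>tri_gap_support\<close>; adjacency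
  of moved colours follows from \<open>tri_retract\<close> and \<open>adj5_tri_tri\<close>.\<close>

lemma sol_gac_restriction:
  assumes L: "ac L" "\<And>v. good (L v)" and \<phi>: "sol L \<phi>"
    and ne: "\<And>v. v < n \<Longrightarrow> L' v \<noteq> {}"
    and L'_def: "L' = gac (L(v0 := L v0 \<inter> {c0}))"
  shows "\<exists>\<psi>. sol L' \<psi>"
proof -
  have acL': "ac L'" unfolding L'_def by (rule ac_gac)
  have L'_le: "L' \<le> L(v0 := L v0 \<inter> {c0})" unfolding L'_def by (rule gac_le)
  then have sub: "L' v \<subseteq> L v" for v
    unfolding le_fun_def by (auto split: if_splits)
  \<comment> \<open>If exactly the two ends of \<open>tri c\<close> survived, the centre
    \<open>c\<close> could be put back without destroying arc consistency, against the maximality of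
    \<open>gac\<close>.\<close>
  have gap: False if c: "c < 5" and Lx: "L x = tri c" and L'x: "L' x = {(c+2) mod 5, (c+3) mod 5}" for c x
  proof -
    have ne2: "(c+2) mod 5 \<noteq> (c+3) mod 5" "c \<noteq> (c+2) mod 5" "c \<noteq> (c+3) mod 5"
      using c unfolding less_5_cases by auto
    let ?K = "L'(x := insert c (L' x))"
    have x: "x \<noteq> v0"
    proof
      assume "x = v0"
      then have "L' x \<subseteq> {c0}" using L'_le[THEN le_funD, of v0] by auto
      then show False using L'x ne2 by auto
    qed
    have supp: "\<exists>w\<in>L' y. adj5 c w" if xy: "E x y" for y
    proof -
      obtain a where "adj5 c a" "a \<in> L y" using acD[OF L(1) xy, of c] Lx by (auto simp: tri_def)
      moreover obtain b where "adj5 ((c+2) mod 5) b" "b \<in> L' y" using acD[OF acL' xy] L'x by blast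
      moreover obtain b' where "adj5 ((c+3) mod 5) b'" "b' \<in> L' y" using acD[OF acL' xy] L'x by blast
      ultimately show ?thesis using tri_gap_support[OF c L(2) sub] by blast
    qed
    have "ac ?K"
      unfolding ac_def
    proof (intro allI impI ballI)
      fix v y a
      assume "E v y" "a \<in> ?K v"
      then have "\<exists>w\<in>L' y. adj5 a w"
        using supp acD[OF acL' \<open>E v y\<close>] by (auto split: if_splits)
      then show "\<exists>w\<in>?K y. adj5 a w" by auto
    qed
    moreover have "?K \<le> L(v0 := L v0 \<inter> {c0})"
      using L'_le x Lx by (force simp: le_fun_def tri_def split: if_splits)
    ultimately have "?K \<le> L'" unfolding L'_def by (rule gac_greatest)
    then have "c \<in> L' x" unfolding le_fun_def by (auto split: if_splits)
    then show False using L'x ne2 by auto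
  qed
  \<comment> \<open>The new solution is \<open>\<phi>\<close> clamped to \<open>L'\<close>; \<open>C x c\<close> is the case in which \<open>\<phi> x\<close> moves to the centre \<open>c\<close>.\<close>
  define C where "C x c \<longleftrightarrow> c < 5 \<and> L x = tri c \<and> c \<in> L' x \<and> \<phi> x \<in> tri c \<and> \<phi> x \<noteq> c \<and> \<phi> x \<notin> L' x" for x c
  \<comment> \<open>If \<open>\<phi> x\<close> is lost, a list of two colours leaves only one, and a
    list \<open>tri e\<close> keeps its centre or, by \<open>gap\<close>, at most one end.\<close>
  have "\<exists>p. \<phi> x \<in> L' x \<and> p = \<phi> x \<or> L' x = {p} \<or> C x p" if x: "x < n" for x
  proof (cases "\<phi> x \<in> L' x")
    case False
    have \<phi>x: "\<phi> x \<in> L x" using \<phi> x unfolding sol_def by auto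
    show ?thesis
    proof (cases "\<exists>a b. L x \<subseteq> {a, b}")
      case True
      then obtain a b where "L x \<subseteq> {a, b}" by blast
      then have "L' x \<subseteq> {a} \<or> L' x \<subseteq> {b}" using \<phi>x False sub[of x] by blast
      then have "\<exists>p. L' x \<subseteq> {p}" by blast
      then show ?thesis using ne[OF x] by blast
    next
      case 3: False
      then obtain e where e: "e < 5" "L x = tri e" using L(2)[of x] unfolding good_def by blast
      show ?thesis
      proof (cases "e \<in> L' x")
        case True
        then have "C x e" unfolding C_def using False e \<phi>x by auto
        then show ?thesis by blast
      next
        case 4: False
        then have "L' x \<subseteq> {(e+2) mod 5, (e+3) mod 5}" using sub[of x] e unfolding tri_def by auto
        then have "L' x \<subseteq> {(e+2) mod 5} \<or> L' x \<subseteq> {(e+3) mod 5}" using gap[OF e] by auto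
        then have "\<exists>p. L' x \<subseteq> {p}" by blast
        then show ?thesis using ne[OF x] by blast
      qed
    qed
  qed blast
  then obtain \<psi> where cases: "\<And>x. x < n \<Longrightarrow>
      \<phi> x \<in> L' x \<and> \<psi> x = \<phi> x \<or> L' x = {\<psi> x} \<or> C x (\<psi> x)" by metis
  have in': "\<psi> x \<in> L' x" if "x < n" for x using cases[OF that] unfolding C_def by auto
  \<comment> \<open>The unmoved colour \<open>\<phi> y\<close> has a support in \<open>L' x\<close>.
    This support differs from \<open>\<phi> x\<close>, which was lost, so \<open>tri_retract\<close>
    applies.\<close>
  have retr: "adj5 c (\<phi> y)" if xy: "E x y" and c: "c < 5" "L x = tri c" "\<phi> x \<in> tri c" "\<phi> x \<noteq> c" "\<phi> x \<notin> L' x"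
      and y: "\<phi> y \<in> L' y" for x y c
  proof -
    obtain w where w: "w \<in> L' x" "adj5 (\<phi> y) w" using acD[OF acL' E_sym[OF xy] y] by blast
    have "w \<in> tri c" using w(1) sub[of x] c by auto
    moreover have "adj5 (\<phi> x) (\<phi> y)" using \<phi> xy unfolding sol_def by auto
    moreover have "w \<noteq> \<phi> x" using w c by auto
    ultimately show ?thesis using tri_retract[OF c(1,3,4) _ w(2)] by blast
  qed
  have "adj5 (\<psi> x) (\<psi> y)" if xy: "E x y" for x y
  proof -
    have x: "x < n" and y: "y < n" using xy E_less E_less' by auto
    have b: "adj5 (\<psi> x) (\<psi> y)" if "E x y" "L' x = {\<psi> x}" "y < n" for x y
      using acD[OF acL' E_sym[OF that(1)] in'[OF that(3)]] that(2) adj5_sym by auto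
    consider (s) "L' x = {\<psi> x} \<or> L' y = {\<psi> y}"
      | (aa) "\<psi> x = \<phi> x" "\<psi> y = \<phi> y"
      | (ca) "C x (\<psi> x)" "\<phi> y \<in> L' y" "\<psi> y = \<phi> y"
      | (ac) "C y (\<psi> y)" "\<phi> x \<in> L' x" "\<psi> x = \<phi> x"
      | (cc) "C x (\<psi> x)" "C y (\<psi> y)"
      using cases[OF x] cases[OF y] by blast
    then show ?thesis
    proof cases
      case s
      then show ?thesis using b[OF xy _ y] b[OF E_sym[OF xy] _ x] adj5_sym by blast
    next
      case aa
      then show ?thesis using \<phi> xy unfolding sol_def by auto
    next
      case ca
      then show ?thesis using retr[OF xy] unfolding C_def by auto
    next
      case ac
      then show ?thesis using retr[OF E_sym[OF xy]] adj5_sym unfolding C_def by auto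
    next
      case cc
      then show ?thesis using adj5_tri_tri[of \<open>\<psi> x\<close> \<open>\<psi> y\<close>] acD[OF L(1) xy] unfolding C_def by auto
    qed
  qed
  then show ?thesis using in' unfolding sol_def by blast
qed

section \<open>Choosing the vertices whose colours are guessed\<close>

definition progress :: "(nat \<Rightarrow> nat set) \<Rightarrow> nat \<Rightarrow> nat \<Rightarrow> nat" where
  "progress L v c = card {y. E v y \<and> \<not> L y \<subseteq> Collect (adj5 c)}"

definition restr :: "(nat \<Rightarrow> nat) \<Rightarrow> nat set \<Rightarrow> (nat \<Rightarrow> nat set) \<Rightarrow> nat \<Rightarrow> nat set" where
  "restr \<phi> S L v = (if v \<in> S then L v \<inter> {\<phi> v} else L v)"

definition prune :: "nat \<Rightarrow> (nat \<Rightarrow> nat set) \<Rightarrow> nat \<Rightarrow> nat set" where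
  "prune d L v = {c \<in> L v. progress L v c < d}"

lemma finite_neighbours: "finite {y. E v y \<and> P y}"
  by (rule finite_subset[of _ "{..<n}"]) (auto simp: E_less')

lemma progress_antimono: "L' \<le> L \<Longrightarrow> progress L' v c \<le> progress L v c"
  unfolding progress_def by (rule card_mono[OF finite_neighbours]) (auto simp: le_fun_def)

lemma restr_le: "restr \<phi> S L \<le> L"
  by (auto simp: restr_def le_fun_def)

lemma restr_subset: "restr \<phi> S L v \<subseteq> L v"
  by (auto simp: restr_def)

lemma prune_le: "prune d L \<le> L"
  by (auto simp: prune_def le_fun_def)

lemma sol_restr: "sol L \<phi> \<Longrightarrow> S \<subseteq> {..<n} \<Longrightarrow> sol (restr \<phi> S L) \<phi>"
  unfolding sol_def restr_def by auto

lemma gac_subset: "gac M v \<subseteq> M v"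
  using gac_le[of M] by (simp add: le_fun_def)

lemma fixed_neighbour: "ac K \<Longrightarrow> K z \<subseteq> {e} \<Longrightarrow> E z y \<Longrightarrow> K y \<subseteq> Collect (adj5 e)"
  using acD[OF _ E_sym] adj5_sym by blast

text \<open>A fixed colour \<open>e\<close> confines lists at distance one to its two neighbours and
  lists at distance two to \<open>tri e\<close>.\<close>

lemma near_fixed_good:
  assumes K: "ac K" "K z \<subseteq> {e}" and x: "x = z \<or> E z x \<or> (\<exists>y. E z y \<and> E y x)"
  shows "good (K x)"
proof -
  have nb: "Collect (adj5 e) \<subseteq> {(e + 1) mod 5, (e + 4) mod 5}" by (auto simp: adj5_iff)
  consider "x = z" | "E z x" | y where "E z y" "E y x" using x by blast
  then show ?thesis
  proof cases
    case 1
    then show ?thesis using K(2) unfolding good_def by blast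
  next
    case 2
    then show ?thesis using fixed_neighbour[OF K 2] nb unfolding good_def by blast
  next
    case 3
    have *: "c \<in> tri e \<and> e < 5" if c: "c \<in> K x" for c
    proof -
      obtain c' where "c' \<in> K y" "adj5 c c'" using acD[OF K(1) E_sym[OF 3(2)] c] by blast
      moreover from this have "adj5 e c'" using fixed_neighbour[OF K 3(1)] by blast
      ultimately show ?thesis using adj5_dist2 adj5_sym adj5_less by blast
    qed
    \<comment> \<open>Only an element of the list supplies the bound \<open>e < 5\<close> that
      \<open>good\<close> demands, so the empty list is a case of its own.\<close>
    show ?thesis
    proof (cases "K x = {}")
      case False
      then have "good (tri e)" using * unfolding good_def by blast
      then show ?thesis using good_subset[of "tri e" "K x"] * by blast
    qed (simp add: good_empty)
  qed
qed

text \<open>A potential argument: each guess is charged \<open>d\<close> and removes at least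
  \<open>d\<close> of the at most \<open>5 * n\<close> list entries. A largest set within this
  budget leaves no vertex at which guessing would still remove that many.\<close>

lemma ex_progress_free_restriction:
  assumes \<phi>: "sol L \<phi>" and L: "\<And>v. L v \<subseteq> {..<5}" and d: "d \<ge> 1"
  shows "\<exists>S\<subseteq>{..<n}. card S * d \<le> 5 * n \<and> (\<forall>v<n. progress (gac (restr \<phi> S L)) v (\<phi> v) < d)"
proof -
  let ?K = "\<lambda>S. gac (restr \<phi> S L)"
  define total where "total K = (\<Sum>v<n. card (K v))" for K :: "nat \<Rightarrow> nat set"
  define P where "P S \<longleftrightarrow> S \<subseteq> {..<n} \<and> card S * d + total (?K S) \<le> 5 * n" for S
  have K5: "?K S v \<subseteq> {..<5}" for S v
    using gac_subset restr_subset L by blast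
  then have "total (?K {}) \<le> (\<Sum>v<n. 5)"
    unfolding total_def using card_mono[OF finite_lessThan K5] by (intro sum_mono) simp
  then have P0: "P {}" unfolding P_def by simp
  have fin: "finite {S. P S}"
    by (rule finite_subset[of _ "Pow {..<n}"]) (auto simp: P_def)
  then have "Max (card ` {S. P S}) \<in> card ` {S. P S}" using P0 by (intro Max_in) auto
  then obtain S where S: "P S" and S_max: "card S = Max (card ` {S. P S})" by auto
  have max: "card S' \<le> card S" if "P S'" for S'
    unfolding S_max using fin that by (intro Max_ge) auto
  have "progress (?K S) v (\<phi> v) < d" if v: "v < n" for v
  proof (rule ccontr)
    assume ge: "\<not> ?thesis"
    define Y where "Y = {y. E v y \<and> \<not> ?K S y \<subseteq> Collect (adj5 (\<phi> v))}"
    have finY: "finite Y" "Y \<subseteq> {..<n}" unfolding Y_def using finite_neighbours E_less' by auto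
    have Yd: "d \<le> card Y" using ge unfolding progress_def Y_def by simp
    \<comment> \<open>A guessed vertex makes no progress: propagation has already confined the
      neighbouring lists to the neighbours of its colour.\<close>
    have vS: "v \<notin> S"
    proof
      assume "v \<in> S"
      then have "?K S v \<subseteq> {\<phi> v}" using gac_subset[of "restr \<phi> S L" v] by (auto simp: restr_def)
      then have "Y = {}" unfolding Y_def using fixed_neighbour[OF ac_gac] by blast
      then show False using Yd d by simp
    qed
    have le: "?K (insert v S) \<le> ?K S"
      by (rule gac_mono) (auto simp: restr_def le_fun_def)
    have "?K (insert v S) v \<subseteq> {\<phi> v}"
      using gac_subset[of "restr \<phi> (insert v S) L" v] by (auto simp: restr_def)
    then have nb: "?K (insert v S) y \<subseteq> Collect (adj5 (\<phi> v))" if "E v y" for y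
      using fixed_neighbour[OF ac_gac _ that] by blast
    \<comment> \<open>Every vertex of \<open>Y\<close> loses a colour, which pays for the charge of
      \<open>v\<close>.\<close>
    have "card (?K (insert v S) y) + of_bool (y \<in> Y) \<le> card (?K S y)" for y
    proof -
      have fin: "finite (?K S y)" using K5 finite_subset by blast
      have sub: "?K (insert v S) y \<subseteq> ?K S y" using le by (simp add: le_fun_def)
      show ?thesis
      proof (cases "y \<in> Y")
        case True
        then have "?K (insert v S) y \<subset> ?K S y" using sub nb[of y] unfolding Y_def by blast
        from psubset_card_mono[OF fin this] show ?thesis using True by simp
      qed (use card_mono[OF fin sub] in simp)
    qed
    then have "(\<Sum>y<n. card (?K (insert v S) y) + of_bool (y \<in> Y)) \<le> total (?K S)"
      unfolding total_def by (rule sum_mono)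
    moreover have "(\<Sum>y<n. of_bool (y \<in> Y)) = card Y"
      using finY by (simp add: Int_absorb1)
    ultimately have "total (?K (insert v S)) + card Y \<le> total (?K S)"
      unfolding total_def by (simp add: sum.distrib)
    moreover have "card (insert v S) = Suc (card S)"
      using vS S finite_subset[of S "{..<n}"] unfolding P_def by simp
    ultimately have "P (insert v S)"
      using S v Yd unfolding P_def by simp
    then show False using max[of "insert v S"] \<open>card (insert v S) = Suc (card S)\<close> by simp
  qed
  then show ?thesis using S unfolding P_def by (intro exI[of _ S]) auto
qed

text \<open>The ball is taken inside the set \<open>X\<close> of vertices with at least two colours,
  where degrees are at most \<open>2 * d\<close>. On a walk of length at most five between two
  vertices with bad lists, each vertex is within two steps of one end and so lies in
  \<open>X\<close>. The vertex two steps before the end therefore lies in the ball of radius three,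
  and guessing its colour makes the last list good.\<close>

lemma ex_ball_restriction:
  assumes L: "ac L" "\<And>v. v \<ge> n \<Longrightarrow> L v = {}" and d: "d \<ge> 1"
    and pr: "\<And>v c. c \<in> L v \<Longrightarrow> progress L v c < d"
    and diam: "\<And>u v. u < n \<Longrightarrow> v < n \<Longrightarrow>
      \<exists>k\<le>5. \<exists>p. p 0 = u \<and> p k = v \<and> (\<forall>i<k. E (p i) (p (Suc i)))"
  shows "\<exists>S\<subseteq>{..<n}. card S \<le> 27 * d ^ 3 \<and>
    (\<forall>K. ac K \<longrightarrow> K \<le> restr \<phi> S L \<longrightarrow> (\<forall>v. good (K v)))"
proof (cases "\<forall>v. good (L v)")
  case True
  have "good (K v)" if "K \<le> restr \<phi> {} L" for K v
    using good_subset[of "L v" "K v"] True that by (simp add: restr_def le_fun_def)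
  then show ?thesis by (intro exI[of _ "{}"]) auto
next
  case False
  then obtain u where bad: "\<not> good (L u)" by blast
  have u: "u < n" using bad L(2)[of u] by (metis good_empty not_le)
  define X where "X = {v. \<not> (\<exists>a. L v \<subseteq> {a})}"
  have X_far: "z \<in> X" if "x = z \<or> E z x \<or> (\<exists>y. E z y \<and> E y x)" "\<not> good (L x)" for x z
    using near_fixed_good[OF L(1) _ that(1)] that(2) unfolding X_def by blast
  have deg: "card {y. E x y \<and> y \<in> X} \<le> 2 * d" if x: "x \<in> X" for x
  proof -
    obtain c1 c2 where c: "c1 \<in> L x" "c2 \<in> L x" "c1 \<noteq> c2"
      using x unfolding X_def by blast
    let ?Y = "\<lambda>c. {y. E x y \<and> \<not> L y \<subseteq> Collect (adj5 c)}"
    \<comment> \<open>A list with two colours is not compatible with both \<open>c1\<close> and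
      \<open>c2\<close>, so each such neighbour counts towards the progress of one of them.\<close>
    have "{y. E x y \<and> y \<in> X} \<subseteq> ?Y c1 \<union> ?Y c2"
      unfolding X_def using adj5_unique[of c1 _ c2] c(3) by blast
    then have "card {y. E x y \<and> y \<in> X} \<le> card (?Y c1 \<union> ?Y c2)"
      by (intro card_mono finite_UnI finite_neighbours)
    also have "\<dots> \<le> progress L x c1 + progress L x c2" unfolding progress_def by (rule card_Un_le)
    finally show ?thesis using pr[OF c(1)] pr[OF c(2)] by simp
  qed
  \<comment> \<open>The balls around \<open>u\<close> in the subgraph induced by
    \<open>X\<close>.\<close>
  define Bs where "Bs i = ((\<lambda>B. B \<union> (\<Union>x\<in>B. {y. E x y \<and> y \<in> X})) ^^ i) {u}" for i
  have Bs0: "Bs 0 = {u}" and BsS: "Bs (Suc i) = Bs i \<union> (\<Union>x\<in>Bs i. {y. E x y \<and> y \<in> X})" for i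
    unfolding Bs_def by simp_all
  have Bs: "finite (Bs i) \<and> Bs i \<subseteq> X \<and> Bs i \<subseteq> {..<n} \<and> card (Bs i) \<le> (1 + 2 * d) ^ i" for i
  proof (induction i)
    case 0
    then show ?case using X_far[of u u] bad u by (simp add: Bs0)
  next
    case (Suc i)
    have fin: "finite (\<Union>x\<in>Bs i. {y. E x y \<and> y \<in> X})"
      using Suc finite_neighbours by (intro finite_UN_I) auto
    have "card (\<Union>x\<in>Bs i. {y. E x y \<and> y \<in> X}) \<le> (\<Sum>x\<in>Bs i. card {y. E x y \<and> y \<in> X})"
      using Suc by (intro card_UN_le) blast
    also have "\<dots> \<le> card (Bs i) * (2 * d)"
      using Suc deg by (intro sum_bounded_above[of _ _ "2 * d", simplified]) auto
    finally have "card (Bs (Suc i)) \<le> card (Bs i) + card (Bs i) * (2 * d)"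
      unfolding BsS using card_Un_le[of "Bs i"] by (metis (no_types, lifting) add_left_mono order_trans)
    also have "\<dots> = card (Bs i) * (1 + 2 * d)" by (simp add: algebra_simps)
    also have "\<dots> \<le> (1 + 2 * d) ^ i * (1 + 2 * d)" using Suc by (intro mult_right_mono) auto
    finally show ?case using Suc fin E_less' by (auto simp: BsS mult.commute)
  qed
  have Bs_mono: "Bs i \<subseteq> Bs j" if "i \<le> j" for i j
    by (rule lift_Suc_mono_le[OF _ that]) (auto simp: BsS)
  have "(1 + 2 * d) ^ 3 \<le> (3 * d) ^ 3" using d by (intro power_mono) auto
  then have card3: "card (Bs 3) \<le> 27 * d ^ 3" using Bs[of 3] by (simp add: power_mult_distrib)
  have "good (K x)" if K: "ac K" "K \<le> restr \<phi> (Bs 3) L" for K x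
  proof (rule ccontr)
    assume bx: "\<not> good (K x)"
    have "K x \<subseteq> L x" using K(2) restr_subset unfolding le_fun_def by fast
    then have badx: "\<not> good (L x)" using bx good_subset by blast
    then have x: "x < n" using L(2)[of x] by (metis good_empty not_le)
    obtain k p where k: "k \<le> 5" and p: "p 0 = u" "p k = x" "\<And>i. i < k \<Longrightarrow> E (p i) (p (Suc i))"
      using diam[OF u x] by blast
    have front: "p j \<in> X" if "j \<le> 2" "j \<le> k" for j
    proof (rule X_far[OF _ bad])
      have "j = 0 \<or> j = 1 \<or> j = 2" using that by auto
      then show "u = p j \<or> E (p j) u \<or> (\<exists>y. E (p j) y \<and> E y u)"
        using p(1) p(3)[of 0, THEN E_sym] p(3)[of 1, THEN E_sym] that by (elim disjE) (auto simp: numeral_2_eq_2)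
    qed
    have rear: "x = p j \<or> E (p j) x \<or> (\<exists>y. E (p j) y \<and> E y x)" if "k \<le> j + 2" "j \<le> k" for j
    proof -
      have "k = j \<or> k = Suc j \<or> k = Suc (Suc j)" using that by auto
      then show ?thesis using p(2) p(3)[of j] p(3)[of "Suc j"] by auto
    qed
    \<comment> \<open>The position two steps before the end; truncated subtraction makes it the
      start \<open>u\<close> if the walk has at most two steps.\<close>
    define i0 where "i0 = k - 2"
    have i0: "i0 \<le> 3" "k \<le> i0 + 2" "i0 \<le> k" using k unfolding i0_def by auto
    have pX: "p j \<in> X" if "j \<le> i0" for j
    proof (cases "j \<le> 2")
      case True
      then show ?thesis using front that i0 by auto
    next
      case False
      then have "k \<le> j + 2" "j \<le> k" using that i0 k by auto
      then show ?thesis using X_far[OF rear badx] by blast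
    qed
    have "j \<le> i0 \<longrightarrow> p j \<in> Bs j" for j
    proof (induction j)
      case 0
      then show ?case by (simp add: p Bs0)
    next
      case (Suc j)
      show ?case
      proof
        assume "Suc j \<le> i0"
        moreover from this have "E (p j) (p (Suc j))" using p(3) i0 by simp
        ultimately show "p (Suc j) \<in> Bs (Suc j)" using Suc pX by (auto simp: BsS)
      qed
    qed
    then have "p i0 \<in> Bs 3" using Bs_mono[OF i0(1)] by auto
    then have "restr \<phi> (Bs 3) L (p i0) \<subseteq> {\<phi> (p i0)}" by (simp add: restr_def)
    then have "K (p i0) \<subseteq> {\<phi> (p i0)}" using K(2) unfolding le_fun_def by blast
    then show False using near_fixed_good[OF K(1) _ rear[OF i0(2,3)]] bx by blast
  qed
  then show ?thesis using Bs[of 3] card3 by (intro exI[of _ "Bs 3"]) auto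
qed

text \<open>The guessing phase with an oracle: the colours on \<open>S1\<close> and
  \<open>S2\<close> are read off \<open>\<phi>\<close>. The digits passed to \<open>guess\<close>
  have to reproduce this.\<close>

definition guided :: "nat \<Rightarrow> (nat \<Rightarrow> nat) \<Rightarrow> nat set \<Rightarrow> nat set \<Rightarrow> (nat \<Rightarrow> nat set) \<Rightarrow> nat \<Rightarrow> nat set" where
  "guided d \<phi> S1 S2 L = gac (restr \<phi> S2 (gac (prune d (gac (restr \<phi> S1 L)))))"

text \<open>After the guesses on \<open>S1\<close> all colours of \<open>\<phi>\<close> have
  progress below \<open>d\<close>, so pruning keeps them; then every remaining colour has, and the
  ball argument provides \<open>S2\<close>. The bound on \<open>n\<close> turns
  \<open>card S1 * d \<le> 5 * n\<close> into \<open>card S1 \<le> 5 * d ^ 3\<close>.\<close>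

lemma ex_certificate:
  assumes \<phi>: "sol L \<phi>" and L: "\<And>v. L v \<subseteq> {..<5}" "\<And>v. v \<ge> n \<Longrightarrow> L v = {}"
    and d: "n \<le> d ^ 4"
    and diam: "\<And>u v. u < n \<Longrightarrow> v < n \<Longrightarrow>
      \<exists>k\<le>5. \<exists>p. p 0 = u \<and> p k = v \<and> (\<forall>i<k. E (p i) (p (Suc i)))"
  shows "\<exists>S1 S2. S1 \<subseteq> {..<n} \<and> S2 \<subseteq> {..<n} \<and> card S1 \<le> 27 * d ^ 3 \<and> card S2 \<le> 27 * d ^ 3 \<and>
    sol (guided d \<phi> S1 S2 L) \<phi> \<and> (\<forall>v. good (guided d \<phi> S1 S2 L v))"
proof (cases "n = 0")
  \<comment> \<open>For the empty graph \<open>d\<close> may be zero, while the two selection lemmas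
    require \<open>d \<ge> 1\<close>.\<close>
  case True
  then have "guided d \<phi> {} {} L v = {}" for v
  proof -
    have "guided d \<phi> {} {} L \<le> L"
      unfolding guided_def by (intro order_trans[OF gac_le] order_trans[OF restr_le] order_trans[OF prune_le] order_refl)
    from this[THEN le_funD, of v] show ?thesis using L(2)[of v] True by simp
  qed
  moreover have "sol (guided d \<phi> {} {} L) \<phi>" using \<phi> True unfolding sol_def by simp
  ultimately show ?thesis by (intro exI[of _ "{}"]) (simp add: good_empty)
next
  case False
  have d1: "d \<ge> 1" using False d by (cases d) auto
  obtain S1 where S1: "S1 \<subseteq> {..<n}" "card S1 * d \<le> 5 * n"
      "\<And>v. v < n \<Longrightarrow> progress (gac (restr \<phi> S1 L)) v (\<phi> v) < d"
    using ex_progress_free_restriction[OF \<phi> L(1) d1] by blast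
  define L1 where "L1 = gac (restr \<phi> S1 L)"
  define L2 where "L2 = gac (prune d L1)"
  have sol1: "sol L1 \<phi>" unfolding L1_def by (intro sol_gac sol_restr \<phi> S1)
  then have "sol (prune d L1) \<phi>" using S1(3) unfolding sol_def prune_def L1_def by simp
  then have sol2: "sol L2 \<phi>" unfolding L2_def by (rule sol_gac)
  have L2_le: "L2 \<le> L1" unfolding L2_def using gac_le prune_le order_trans by blast
  have pr2: "progress L2 v c < d" if "c \<in> L2 v" for v c
  proof -
    have "c \<in> prune d L1 v" using that gac_subset unfolding L2_def by blast
    then show ?thesis using progress_antimono[OF L2_le, of v c] by (simp add: prune_def)
  qed
  have L2_empty: "L2 v = {}" if "v \<ge> n" for v
    using L2_le[THEN le_funD, of v] gac_subset[of "restr \<phi> S1 L" v] restr_subset[of \<phi> S1 L v] L(2)[OF that]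
    unfolding L1_def by blast
  have acL2: "ac L2" unfolding L2_def by (rule ac_gac)
  obtain S2 where S2: "S2 \<subseteq> {..<n}" "card S2 \<le> 27 * d ^ 3"
      "\<And>K v. ac K \<Longrightarrow> K \<le> restr \<phi> S2 L2 \<Longrightarrow> good (K v)"
    using ex_ball_restriction[of L2 d \<phi>, OF acL2 L2_empty d1 pr2 diam] by blast
  have "d ^ 4 = d ^ 3 * d" by (simp add: eval_nat_numeral)
  then have "card S1 * d \<le> (5 * d ^ 3) * d" using S1(2) d by linarith
  then have "card S1 \<le> 5 * d ^ 3" using d1 by (simp only: mult_le_cancel2)
  then have "card S1 \<le> 27 * d ^ 3" by simp
  moreover have g: "guided d \<phi> S1 S2 L = gac (restr \<phi> S2 L2)"
    unfolding guided_def L2_def L1_def by simp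
  moreover have "sol (gac (restr \<phi> S2 L2)) \<phi>" by (intro sol_gac sol_restr sol2 S2)
  moreover have "good (gac (restr \<phi> S2 L2) v)" for v using S2(3)[OF ac_gac gac_le] .
  ultimately show ?thesis using S1(1) S2(1,2) by (intro exI[of _ S1] exI[of _ S2]) auto
qed

section \<open>Greedy completion of instances with good lists\<close>

definition trial :: "nat \<Rightarrow> nat \<Rightarrow> (nat \<Rightarrow> nat set) \<Rightarrow> nat \<Rightarrow> nat set" where
  "trial v c L = (let M = gac (L(v := L v \<inter> {c})) in if \<exists>y<n. M y = {} then L else M)"

fun greedy :: "nat \<Rightarrow> (nat \<Rightarrow> nat set) \<Rightarrow> nat \<Rightarrow> nat set" where
  "greedy 0 L = L"
| "greedy (Suc v) L = fold (trial v) [0..<5] (greedy v L)"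

lemma trial_le: "trial v c L \<le> L"
proof -
  have "L(v := L v \<inter> {c}) \<le> L" by (auto simp: le_fun_def)
  then have "gac (L(v := L v \<inter> {c})) \<le> L" by (rule order_trans[OF gac_le])
  then show ?thesis unfolding trial_def Let_def by simp
qed

lemma ac_trial: "ac L \<Longrightarrow> ac (trial v c L)"
  unfolding trial_def Let_def using ac_gac by simp

lemma fold_trial_le: "fold (trial v) cs L \<le> L"
proof (induction cs arbitrary: L)
  case (Cons c cs)
  show ?case using order_trans[OF Cons trial_le] by simp
qed simp

lemma ac_fold_trial: "ac L \<Longrightarrow> ac (fold (trial v) cs L)"
  by (induction cs arbitrary: L) (auto simp: ac_trial)

lemma greedy_le: "greedy v L \<le> L"
proof (induction v)
  case (Suc v)
  show ?case using order_trans[OF fold_trial_le Suc] by simp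
qed simp

lemma ac_greedy: "ac L \<Longrightarrow> ac (greedy v L)"
  by (induction v) (auto simp del: upt_Suc simp: ac_fold_trial)

definition solvable :: "(nat \<Rightarrow> nat set) \<Rightarrow> bool" where
  "solvable L \<longleftrightarrow> ac L \<and> (\<forall>v. good (L v)) \<and> (\<exists>\<phi>. sol L \<phi>)"

text \<open>An accepted trial has no empty list, so \<open>sol_gac_restriction\<close> yields a
  solution, possibly a new one; a rejected trial changes nothing.\<close>

lemma solvable_trial:
  assumes "solvable L"
  shows "solvable (trial v c L)"
proof -
  let ?M = "gac (L(v := L v \<inter> {c}))"
  have "good (trial v c L y)" for y
    using assms good_subset[of "L y" "trial v c L y"] trial_le[of v c L] unfolding solvable_def le_fun_def by blast
  moreover have "\<exists>\<psi>. sol ?M \<psi>" if "\<And>y. y < n \<Longrightarrow> ?M y \<noteq> {}"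
    using sol_gac_restriction[of L _ ?M v c] that assms unfolding solvable_def by blast
  ultimately show ?thesis
    using assms ac_trial unfolding solvable_def by (auto simp: trial_def Let_def)
qed

text \<open>After the colours below \<open>k\<close> have been tried at a vertex, its list is
  decided or every remaining solution uses a colour \<open>\<ge> k\<close> there. For
  \<open>k = 5\<close> the latter contradicts the existence of a solution.\<close>

lemma solvable_greedy:
  assumes L: "solvable L" "\<And>v. L v \<subseteq> {..<5}"
  shows "i \<le> n \<Longrightarrow> solvable (greedy i L) \<and> (\<forall>v<i. \<exists>c. greedy i L v = {c})"
proof (induction i)
  case (Suc v)
  let ?F = "\<lambda>k. fold (trial v) [0..<k] (greedy v L)"
  have F: "solvable (?F k) \<and> ((\<exists>c. ?F k v \<subseteq> {c}) \<or> (\<forall>\<phi>. sol (?F k) \<phi> \<longrightarrow> k \<le> \<phi> v))" for k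
  proof (induction k)
    case 0
    then show ?case using Suc by simp
  next
    case (Suc k)
    let ?L = "?F k"
    let ?M = "gac (?L(v := ?L v \<inter> {k}))"
    have FS: "?F (Suc k) = trial v k ?L" by simp
    have sv: "solvable (?F (Suc k))" unfolding FS using Suc solvable_trial by blast
    have sub: "?F (Suc k) v \<subseteq> ?L v" unfolding FS using trial_le[THEN le_funD] .
    show ?case
    proof (cases "\<exists>c. ?L v \<subseteq> {c}")
      case True
      then show ?thesis using sv sub by blast
    next
      case False
      then have ge: "\<And>\<phi>. sol ?L \<phi> \<Longrightarrow> k \<le> \<phi> v" using Suc by blast
      show ?thesis
      proof (cases "\<exists>y<n. ?M y = {}")
        case True
        then have eq: "?F (Suc k) = ?L" unfolding FS trial_def by simp
        \<comment> \<open>A rejected colour occurs in no solution: propagation would have kept that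
          solution and emptied no list.\<close>
        have "\<phi> v \<noteq> k" if "sol ?L \<phi>" for \<phi>
        proof
          assume "\<phi> v = k"
          then have "sol (?L(v := ?L v \<inter> {k})) \<phi>" using that unfolding sol_def by auto
          then show False using sol_gac True unfolding sol_def by blast
        qed
        then have "\<forall>\<phi>. sol (?F (Suc k)) \<phi> \<longrightarrow> Suc k \<le> \<phi> v" unfolding eq using ge by (metis Suc_leI le_neq_implies_less)
        then show ?thesis using sv by blast
      next
        case 2: False
        then have "?F (Suc k) = ?M" unfolding FS trial_def Let_def by (simp only: if_False)
        then have "?F (Suc k) v \<subseteq> {k}" using gac_subset[of "?L(v := ?L v \<inter> {k})" v] by auto
        then show ?thesis using sv by blast
      qed
    qed
  qed
  have G: "greedy (Suc v) L = ?F 5" by simp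
  obtain \<phi> where \<phi>: "sol (?F 5) \<phi>" using F[of 5] unfolding solvable_def by blast
  have le: "?F 5 \<le> greedy v L" by (rule fold_trial_le)
  then have "?F 5 \<le> L" using greedy_le order_trans by blast
  then have "?F 5 v \<subseteq> L v" by (rule le_funD)
  moreover have \<phi>v: "\<phi> v \<in> ?F 5 v" using \<phi> Suc.prems unfolding sol_def by simp
  ultimately have "\<phi> v < 5" using L(2)[of v] by blast
  then have "\<not> 5 \<le> \<phi> v" by simp
  then obtain c where "?F 5 v \<subseteq> {c}" using F[of 5] \<phi> by blast
  then have ex: "\<exists>c. ?F 5 v = {c}" using \<phi>v by blast
  \<comment> \<open>Earlier vertices stay decided: lists only shrink, and a solution keeps them
    nonempty.\<close>
  have "\<exists>c. ?F 5 y = {c}" if y: "y < v" for y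
  proof -
    obtain c where "greedy v L y = {c}" using Suc y by auto
    then have "?F 5 y \<subseteq> {c}" using le[THEN le_funD, of y] by simp
    moreover have "\<phi> y \<in> ?F 5 y" using \<phi> y Suc.prems unfolding sol_def by simp
    ultimately show ?thesis by blast
  qed
  then show ?case using F[of 5] ex unfolding G by (auto simp: less_Suc_eq simp del: upt_Suc)
qed (use L in simp)

lemma sol_of_singletons:
  assumes "ac L" "\<And>v. v < n \<Longrightarrow> \<exists>c. L v = {c}"
  shows "\<exists>\<phi>. sol L \<phi>"
proof -
  obtain \<phi> where \<phi>: "\<And>v. v < n \<Longrightarrow> L v = {\<phi> v}" using assms(2) by metis
  have "adj5 (\<phi> v) (\<phi> y)" if "E v y" for v y
    using acD[OF assms(1) that] \<phi>[OF E_less[OF that]] \<phi>[OF E_less'[OF that]] by simp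
  then show ?thesis using \<phi> unfolding sol_def by blast
qed

lemma sol_mono: "sol L \<phi> \<Longrightarrow> L \<le> L' \<Longrightarrow> sol L' \<phi>"
  unfolding sol_def le_fun_def by blast

section \<open>Computing the closure by rounds of deletion\<close>

definition revise :: "(nat \<Rightarrow> nat set) \<Rightarrow> nat \<Rightarrow> nat set" where
  "revise L v = {c \<in> L v. \<forall>y. E v y \<longrightarrow> (\<exists>c'\<in>L y. adj5 c c')}"

lemma revise_le: "revise L \<le> L"
  by (auto simp: revise_def le_fun_def)

lemma gac_le_revise: "gac L \<le> revise L"
proof (rule le_funI, rule subsetI)
  fix v c
  assume c: "c \<in> gac L v"
  have "\<exists>c'\<in>L y. adj5 c c'" if "E v y" for y
    using acD[OF ac_gac that c] gac_subset by blast
  then show "c \<in> revise L v" using c gac_subset unfolding revise_def by blast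
qed

lemma gac_revise: "gac (revise L) = gac L"
  by (rule order_antisym) (simp_all add: gac_mono revise_le gac_greatest ac_gac gac_le_revise)

lemma ac_iff_revise: "ac L \<longleftrightarrow> revise L = L"
proof
  assume "ac L"
  then have "L \<le> revise L" unfolding ac_def revise_def le_fun_def by blast
  then show "revise L = L" using revise_le order_antisym by blast
next
  assume "revise L = L"
  then have "c \<in> revise L v" if "c \<in> L v" for c v using that by simp
  then show "ac L" unfolding ac_def revise_def by blast
qed

lemma gac_ac: "ac L \<Longrightarrow> gac L = L"
  using gac_le gac_greatest order_antisym order_refl by metis

text \<open>A round that changes anything deletes one of at most \<open>5 * n\<close> list entries,
  so a fixed point is reached in time. No round changes the closure, and a fixed point is its own
  closure.\<close>

lemma revise_iterate:
  assumes L: "\<And>v. L v \<subseteq> {..<5}" "\<And>v. v \<ge> n \<Longrightarrow> L v = {}"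
  shows "(revise ^^ (5 * n + 1)) L = gac L"
proof -
  define total where "total K = (\<Sum>v<n. card (K v))" for K :: "nat \<Rightarrow> nat set"
  let ?R = "\<lambda>i. (revise ^^ i) L"
  have le: "?R i \<le> L" for i
    by (induction i) (auto intro: order_trans[OF revise_le])
  have "gac (?R i) = gac L \<and> (ac (?R i) \<or> total (?R i) + i \<le> 5 * n)" for i
  proof (induction i)
    case 0
    have "card (L v) \<le> 5" for v using card_mono[OF finite_lessThan L(1)] by simp
    then have "total L \<le> (\<Sum>v<n. 5)" unfolding total_def by (intro sum_mono)
    then show ?case by simp
  next
    case (Suc i)
    have "ac (?R (Suc i)) \<or> total (?R (Suc i)) + Suc i \<le> 5 * n"
    proof (cases "revise (?R i) = ?R i")
      case True
      then show ?thesis using ac_iff_revise by simp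
    next
      case False
      have sub: "revise (?R i) v \<subseteq> ?R i v" for v using revise_le[THEN le_funD] .
      have fin: "finite (?R i v)" for v
        using le[of i, THEN le_funD, of v] L(1)[of v] finite_subset[OF _ finite_lessThan[of 5]] by (meson order_trans)
      obtain v where "revise (?R i) v \<noteq> ?R i v" using False by blast
      then have v: "revise (?R i) v \<subset> ?R i v" using sub by blast
      then have "v < n" using le[of i, THEN le_funD, of v] L(2)[of v] by (cases "v < n") auto
      then have "total (revise (?R i)) < total (?R i)"
        unfolding total_def using psubset_card_mono[OF fin v] card_mono[OF fin sub]
        by (intro sum_strict_mono_ex1) auto
      moreover have "\<not> ac (?R i)" using False ac_iff_revise by blast
      ultimately show ?thesis using Suc by simp
    qed
    then show ?case using Suc gac_revise[of "?R i"] by simp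
  qed
  from this[of "5 * n + 1"] show ?thesis using gac_ac by fastforce
qed

end

section \<open>Coding sequences of guesses as numbers\<close>

lemma ex_digits:
  assumes "\<And>i. g i < (B::nat)"
  shows "\<exists>k<B ^ m. \<forall>i<m. k div B ^ i mod B = g i"
  using assms
proof (induction m arbitrary: g)
  case (Suc m)
  obtain k where k: "k < B ^ m" "\<And>i. i < m \<Longrightarrow> k div B ^ i mod B = g (Suc i)"
    using Suc.IH[of "\<lambda>i. g (Suc i)"] Suc.prems by blast
  have "g 0 + B * k < B + B * k" using Suc.prems[of 0] by simp
  also have "\<dots> = B * (k + 1)" by simp
  also have "\<dots> \<le> B * B ^ m" using k(1) by (intro mult_left_mono) auto
  finally have "g 0 + B * k < B ^ Suc m" by simp
  moreover have "(g 0 + B * k) div B ^ i mod B = g i" if "i < Suc m" for i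
  proof (cases i)
    case 0
    then show ?thesis using Suc.prems[of 0] by simp
  next
    case (Suc j)
    have "(g 0 + B * k) div B ^ i = (g 0 + B * k) div B div B ^ j" by (simp add: Suc div_mult2_eq)
    also have "(g 0 + B * k) div B = k" using Suc.prems[of 0] by simp
    finally show ?thesis using k(2)[of j] Suc that by simp
  qed
  ultimately show ?case by blast
qed simp

context lgraph
begin

text \<open>
  The digits of \<open>k\<close> to base \<open>B = 5 * n + 1\<close> encode guesses: \<open>5 * v + c\<close> colours \<open>v\<close> with \<open>c\<close>, and \<open>5 * n\<close>
  is void.
\<close>

definition digit_filter :: "nat \<Rightarrow> nat \<Rightarrow> nat \<Rightarrow> (nat \<Rightarrow> nat set) \<Rightarrow> nat \<Rightarrow> nat set" where
  "digit_filter B m k L v =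
     {c \<in> L v. \<forall>j<m. k div B ^ j mod B div 5 = v \<longrightarrow> k div B ^ j mod B mod 5 = c}"

lemma digit_filter_le: "digit_filter B m k L \<le> L"
  by (auto simp: digit_filter_def le_fun_def)

text \<open>An enumeration of \<open>S\<close> supplies the first digits and the void digit
  \<open>5 * n\<close> the others. The void digit refers to vertex \<open>n\<close>, whose list is
  empty by assumption.\<close>

lemma ex_digit_sequence:
  assumes S: "S \<subseteq> {..<n}" "card S \<le> m" and \<phi>: "\<And>v. v \<in> S \<Longrightarrow> \<phi> v < 5"
  shows "\<exists>g. (\<forall>i. g i < 5 * n + 1) \<and> (\<forall>B k. (\<forall>i<m. k div B ^ i mod B = g i) \<longrightarrow>
    (\<forall>L. (\<forall>v\<ge>n. L v = {}) \<longrightarrow> digit_filter B m k L = restr \<phi> S L))"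
proof -
  have "finite S" using S(1) finite_subset by blast
  then obtain xs where xs: "set xs = S" "length xs = card S"
    using finite_distinct_list distinct_card by metis
  define g where "g i = (if i < length xs then 5 * xs ! i + \<phi> (xs ! i) else 5 * n)" for i
  have xsi: "xs ! i < n" "\<phi> (xs ! i) < 5" "xs ! i \<in> S" if "i < length xs" for i
    using that xs S(1) \<phi> nth_mem[OF that] by auto
  have "g i < 5 * n + 1" for i
    using xsi[of i] by (auto simp: g_def)
  moreover have "digit_filter B m k L = restr \<phi> S L"
    if k: "\<forall>i<m. k div B ^ i mod B = g i" and L: "\<forall>v\<ge>n. L v = {}" for B k L
  proof
    fix v
    show "digit_filter B m k L v = restr \<phi> S L v"
    proof (cases "v < n")
      case True
      have g: "g i div 5 = v \<longleftrightarrow> i < length xs \<and> xs ! i = v" for i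
        using xsi(2)[of i] True by (auto simp: g_def)
      have g': "g i mod 5 = \<phi> v" if "i < length xs" "xs ! i = v" for i
        using xsi(2)[of i] that by (simp add: g_def)
      have "(\<forall>j<m. g j div 5 = v \<longrightarrow> g j mod 5 = c) \<longleftrightarrow> (v \<in> S \<longrightarrow> c = \<phi> v)" for c
      proof
        assume a: "\<forall>j<m. g j div 5 = v \<longrightarrow> g j mod 5 = c"
        show "v \<in> S \<longrightarrow> c = \<phi> v"
        proof
          assume "v \<in> S"
          then obtain i where i: "i < length xs" "xs ! i = v" using xs(1) by (metis in_set_conv_nth)
          moreover have "i < m" using i(1) xs(2) S(2) by simp
          ultimately show "c = \<phi> v" using a g[of i] g'[of i] by auto
        qed
      next
        assume a: "v \<in> S \<longrightarrow> c = \<phi> v"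
        show "\<forall>j<m. g j div 5 = v \<longrightarrow> g j mod 5 = c"
        proof (intro allI impI)
          fix j
          assume "g j div 5 = v"
          then have j: "j < length xs" "xs ! j = v" using g by auto
          then show "g j mod 5 = c" using g'[of j] a xsi(3)[of j] by simp
        qed
      qed
      then show ?thesis using k by (auto simp: digit_filter_def restr_def)
    next
      case False
      then have "L v = {}" using L by simp
      then show ?thesis by (auto simp: digit_filter_def restr_def)
    qed
  qed
  ultimately show ?thesis by blast
qed

text \<open>The \<open>m\<close> lowest digits of \<open>k\<close> hold the guesses made before
  pruning, the next \<open>m\<close> digits those made after it.\<close>

definition guess :: "nat \<Rightarrow> nat \<Rightarrow> (nat \<Rightarrow> nat set) \<Rightarrow> nat \<Rightarrow> nat \<Rightarrow> nat set" where
  "guess d m L k = greedy n (gac (digit_filter (5 * n + 1) m (k div (5 * n + 1) ^ m)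
     (gac (prune d (gac (digit_filter (5 * n + 1) m k L))))))"

text \<open>All phases only delete colours and the outcome is arc consistent, so singleton lists
  spell out a solution whatever was guessed.\<close>

lemma guess_sound:
  assumes "\<And>v. v < n \<Longrightarrow> card (guess d m L k v) = 1"
  shows "\<exists>\<phi>. sol L \<phi>"
proof -
  have "ac (guess d m L k)" unfolding guess_def by (intro ac_greedy ac_gac)
  moreover have "\<exists>c. guess d m L k v = {c}" if "v < n" for v
    using assms[OF that] by (simp add: card_1_singleton_iff)
  ultimately obtain \<phi> where \<phi>: "sol (guess d m L k) \<phi>" using sol_of_singletons by blast
  have "guess d m L k \<le> L"
    unfolding guess_def
    by (intro order_trans[OF greedy_le] order_trans[OF gac_le] order_trans[OF digit_filter_le]
      order_trans[OF prune_le] order_refl)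
  then show ?thesis using \<phi> sol_mono by blast
qed

text \<open>With the digits for \<open>S1\<close> followed by those for \<open>S2\<close>,
  \<open>guess\<close> becomes the greedy phase applied to \<open>guided\<close>.\<close>

lemma guess_complete:
  assumes \<phi>: "sol L \<phi>" and L: "\<And>v. L v \<subseteq> {..<5}" "\<And>v. v \<ge> n \<Longrightarrow> L v = {}"
    and d: "n \<le> d ^ 4"
    and diam: "\<And>u v. u < n \<Longrightarrow> v < n \<Longrightarrow>
      \<exists>k\<le>5. \<exists>p. p 0 = u \<and> p k = v \<and> (\<forall>i<k. E (p i) (p (Suc i)))"
    and m: "m = 27 * d ^ 3"
  shows "\<exists>k<(5 * n + 1) ^ (2 * m). \<forall>v<n. card (guess d m L k v) = 1"
proof -
  let ?B = "5 * n + 1"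
  obtain S1 S2 where S: "S1 \<subseteq> {..<n}" "S2 \<subseteq> {..<n}" "card S1 \<le> m" "card S2 \<le> m"
      and sg: "sol (guided d \<phi> S1 S2 L) \<phi>" "\<And>v. good (guided d \<phi> S1 S2 L v)"
    using ex_certificate[OF \<phi> L d diam] m by blast
  have \<phi>5: "\<phi> v < 5" if "v < n" for v using \<phi> L(1)[of v] that unfolding sol_def by blast
  have p1: "\<phi> v < 5" if "v \<in> S1" for v using \<phi>5 S(1) that by auto
  obtain g1 where g1: "\<forall>i. g1 i < ?B" "\<forall>B k. (\<forall>i<m. k div B ^ i mod B = g1 i) \<longrightarrow>
      (\<forall>K. (\<forall>v\<ge>n. K v = {}) \<longrightarrow> digit_filter B m k K = restr \<phi> S1 K)"
    using ex_digit_sequence[OF S(1,3), of \<phi>, OF p1] by blast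
  have p2: "\<phi> v < 5" if "v \<in> S2" for v using \<phi>5 S(2) that by auto
  obtain g2 where g2: "\<forall>i. g2 i < ?B" "\<forall>B k. (\<forall>i<m. k div B ^ i mod B = g2 i) \<longrightarrow>
      (\<forall>K. (\<forall>v\<ge>n. K v = {}) \<longrightarrow> digit_filter B m k K = restr \<phi> S2 K)"
    using ex_digit_sequence[OF S(2,4), of \<phi>, OF p2] by blast
  define g where "g i = (if i < m then g1 i else g2 (i - m))" for i
  have "g i < ?B" for i using g1(1) g2(1) by (simp add: g_def)
  then obtain k where k: "k < ?B ^ (2 * m)" "\<And>i. i < 2 * m \<Longrightarrow> k div ?B ^ i mod ?B = g i"
    using ex_digits[of g ?B "2 * m"] by blast
  have f1: "digit_filter ?B m k L = restr \<phi> S1 L"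
    using k(2) L(2) by (intro g1(2)[rule_format]) (simp_all add: g_def)
  define K where "K = gac (prune d (gac (restr \<phi> S1 L)))"
  have "K \<le> L" unfolding K_def
    by (intro order_trans[OF gac_le] order_trans[OF prune_le] order_trans[OF restr_le] order_refl)
  then have K: "K v \<subseteq> L v" for v by (rule le_funD)
  have f2: "digit_filter ?B m (k div ?B ^ m) K = restr \<phi> S2 K"
  proof (rule g2(2)[rule_format])
    fix i
    assume "i < m"
    then show "k div ?B ^ m div ?B ^ i mod ?B = g2 i"
      using k(2)[of "m + i"] by (simp add: g_def power_add div_mult2_eq)
  qed (use K L(2) in blast)
  have eq: "guess d m L k = greedy n (guided d \<phi> S1 S2 L)"
    unfolding guess_def guided_def f1 K_def[symmetric] f2 ..
  have "ac (guided d \<phi> S1 S2 L)" unfolding guided_def by (rule ac_gac)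
  then have "solvable (guided d \<phi> S1 S2 L)" using sg unfolding solvable_def by blast
  moreover have "guided d \<phi> S1 S2 L v \<subseteq> {..<5}" for v
  proof -
    have "guided d \<phi> S1 S2 L v \<subseteq> K v"
      unfolding guided_def K_def[symmetric] using gac_subset restr_subset by blast
    then show ?thesis using K L(1) by blast
  qed
  ultimately have "\<exists>c. guess d m L k v = {c}" if "v < n" for v
    using solvable_greedy[of "guided d \<phi> S1 S2 L" n] that unfolding eq by blast
  then have "card (guess d m L k v) = 1" if "v < n" for v
    using that by (simp add: card_1_singleton_iff)
  then show ?thesis using k(1) by blast
qed

end

section \<open>A loop language and its compilation\<close>

datatype aexp = Num nat | Reg nat | Arr nat aexp | Inp aexp | Sum aexp aexp | Dif aexp aexp

text \<open>\<open>Repeat\<close> reads its bound once, on entry, so every program terminates and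
  \<open>run\<close> can be a total function.\<close>

datatype com = Nop | SetReg nat aexp | SetArr nat aexp aexp | Then com com (infixr ";;" 60)
  | Cond aexp com com | Repeat nat com

type_synonym state = "(nat \<Rightarrow> nat) \<times> (nat \<Rightarrow> nat \<Rightarrow> nat)"

primrec ev :: "mem \<Rightarrow> aexp \<Rightarrow> state \<Rightarrow> nat" where
  "ev inp (Num c) s = c"
| "ev inp (Reg j) s = fst s j"
| "ev inp (Arr j e) s = snd s j (ev inp e s)"
| "ev inp (Inp e) s = inp (ev inp e s)"
| "ev inp (Sum e f) s = ev inp e s + ev inp f s"
| "ev inp (Dif e f) s = ev inp e s - ev inp f s"

definition set_reg :: "nat \<Rightarrow> nat \<Rightarrow> state \<Rightarrow> state" where
  "set_reg j x s = ((fst s)(j := x), snd s)"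

definition set_arr :: "nat \<Rightarrow> nat \<Rightarrow> nat \<Rightarrow> state \<Rightarrow> state" where
  "set_arr j i x s = (fst s, (snd s)(j := (snd s j)(i := x)))"

lemma set_reg_simps [simp]:
  "fst (set_reg j x s) = (fst s)(j := x)" "snd (set_reg j x s) = snd s"
  by (simp_all add: set_reg_def)

lemma set_arr_simps [simp]:
  "fst (set_arr j i x s) = fst s" "snd (set_arr j i x s) = (snd s)(j := (snd s j)(i := x))"
  by (simp_all add: set_arr_def)

primrec run :: "mem \<Rightarrow> com \<Rightarrow> state \<Rightarrow> state" where
  "run inp Nop s = s"
| "run inp (SetReg j e) s = set_reg j (ev inp e s) s"
| "run inp (SetArr j e f) s = set_arr j (ev inp e s) (ev inp f s) s"
| "run inp (c ;; d) s = run inp d (run inp c s)"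
| "run inp (Cond e c d) s = (if ev inp e s \<noteq> 0 then run inp c s else run inp d s)"
| "run inp (Repeat j c) s = (run inp c ^^ fst s j) s"

primrec wregs :: "com \<Rightarrow> nat set" where
  "wregs Nop = {}"
| "wregs (SetReg j e) = {j}"
| "wregs (SetArr j e f) = {}"
| "wregs (c ;; d) = wregs c \<union> wregs d"
| "wregs (Cond e c d) = wregs c \<union> wregs d"
| "wregs (Repeat j c) = wregs c"

primrec warrs :: "com \<Rightarrow> nat set" where
  "warrs Nop = {}"
| "warrs (SetReg j e) = {}"
| "warrs (SetArr j e f) = {j}"
| "warrs (c ;; d) = warrs c \<union> warrs d"
| "warrs (Cond e c d) = warrs c \<union> warrs d"
| "warrs (Repeat j c) = warrs c"

primrec loop_regs :: "com \<Rightarrow> nat set" where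
  "loop_regs Nop = {}"
| "loop_regs (SetReg j e) = {}"
| "loop_regs (SetArr j e f) = {}"
| "loop_regs (c ;; d) = loop_regs c \<union> loop_regs d"
| "loop_regs (Cond e c d) = loop_regs c \<union> loop_regs d"
| "loop_regs (Repeat j c) = insert j (loop_regs c)"

lemma run_wregs: "x \<notin> wregs c \<Longrightarrow> fst (run inp c s) x = fst s x"
proof (induction c arbitrary: s)
  case (Repeat j c)
  then have "fst ((run inp c ^^ i) s) x = fst s x" for i by (induction i) auto
  then show ?case by simp
qed auto

lemma run_warrs: "x \<notin> warrs c \<Longrightarrow> snd (run inp c s) x = snd s x"
proof (induction c arbitrary: s)
  case (Repeat j c)
  then have "snd ((run inp c ^^ i) s) x = snd s x" for i by (induction i) auto
  then show ?case by simp
qed auto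

text \<open>
  Cell 0 holds the frame pointer \<open>F\<close>; from there on follow 32 registers, 32 loop counters (one per
  nesting depth), and the four arrays, interleaved. Reads of the input are clipped to addresses
  below \<open>F\<close>; the cell \<open>F - 1\<close> is zero.
\<close>

primrec comp_exp :: "aexp \<Rightarrow> expr" where
  "comp_exp (Num c) = Const c"
| "comp_exp (Reg j) = Load (Add (Load (Const 0)) (Const j))"
| "comp_exp (Arr j e) = Load (Add (Load (Const 0)) (Add (Const (64 + j)) (Add (Add (comp_exp e) (comp_exp e)) (Add (comp_exp e) (comp_exp e)))))"
| "comp_exp (Inp e) = Load (Sub (comp_exp e) (Sub (comp_exp e) (Sub (Load (Const 0)) (Const 1))))"
| "comp_exp (Sum e f) = Add (comp_exp e) (comp_exp f)"
| "comp_exp (Dif e f) = Sub (comp_exp e) (comp_exp f)"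

definition reg_addr :: "nat \<Rightarrow> expr" where
  "reg_addr j = Add (Load (Const 0)) (Const j)"

primrec compile :: "nat \<Rightarrow> com \<Rightarrow> prog" where
  "compile k Nop = Skip"
| "compile k (SetReg j e) = Store (reg_addr j) (comp_exp e)"
| "compile k (SetArr j e f) =
    Store (Add (Load (Const 0)) (Add (Const (64 + j)) (Add (Add (comp_exp e) (comp_exp e)) (Add (comp_exp e) (comp_exp e))))) (comp_exp f)"
| "compile k (c ;; d) = Seq (compile k c) (compile k d)"
| "compile k (Cond e c d) = If (comp_exp e) (compile k c) (compile k d)"
| "compile k (Repeat j c) = Seq (Store (reg_addr (32 + k)) (Load (reg_addr j)))
    (While (Load (reg_addr (32 + k)))
      (Seq (compile (Suc k) c) (Store (reg_addr (32 + k)) (Sub (Load (reg_addr (32 + k))) (Const 1)))))"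

section \<open>Cost and correctness of compiled programs\<close>

primrec wf_exp :: "aexp \<Rightarrow> bool" where
  "wf_exp (Num c) \<longleftrightarrow> True"
| "wf_exp (Reg j) \<longleftrightarrow> j < 32"
| "wf_exp (Arr j e) \<longleftrightarrow> j < 4 \<and> wf_exp e"
| "wf_exp (Inp e) \<longleftrightarrow> wf_exp e"
| "wf_exp (Sum e f) \<longleftrightarrow> wf_exp e \<and> wf_exp f"
| "wf_exp (Dif e f) \<longleftrightarrow> wf_exp e \<and> wf_exp f"

primrec wf_com :: "nat \<Rightarrow> com \<Rightarrow> bool" where
  "wf_com k Nop \<longleftrightarrow> True"
| "wf_com k (SetReg j e) \<longleftrightarrow> j < 32 \<and> wf_exp e"
| "wf_com k (SetArr j e f) \<longleftrightarrow> j < 4 \<and> wf_exp e \<and> wf_exp f"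
| "wf_com k (c ;; d) \<longleftrightarrow> wf_com k c \<and> wf_com k d"
| "wf_com k (Cond e c d) \<longleftrightarrow> wf_exp e \<and> wf_com k c \<and> wf_com k d"
| "wf_com k (Repeat j c) \<longleftrightarrow> k < 32 \<and> j < 32 \<and> wf_com (Suc k) c"

text \<open>An upper bound if \<open>M\<close> bounds all loop registers. An iteration pays 18
  besides its body, 6 for the test and 12 for decrementing the counter; the 16 cover setting the
  counter and the last test.\<close>

primrec cost :: "com \<Rightarrow> nat \<Rightarrow> nat" where
  "cost Nop M = 1"
| "cost (SetReg j e) M = expr_cost (comp_exp e) + 5"
| "cost (SetArr j e f) M = 4 * expr_cost (comp_exp e) + expr_cost (comp_exp f) + 10"
| "cost (c ;; d) M = cost c M + cost d M"
| "cost (Cond e c d) M = expr_cost (comp_exp e) + 1 + cost c M + cost d M"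
| "cost (Repeat j c) M = 16 + M * (18 + cost c M)"

text \<open>A loop raises the degree by one; for compositions and branches the degrees are simply
  added.\<close>

lemma cost_polynomial: "\<exists>K D. \<forall>M. cost c M \<le> K * (M + 1) ^ D"
proof (induction c)
  case Nop
  show ?case by (intro exI[of _ 1] exI[of _ 0]) simp
next
  case (SetReg j e)
  show ?case by (intro exI[of _ "cost (SetReg j e) 0"] exI[of _ 0]) simp
next
  case (SetArr j e f)
  show ?case by (intro exI[of _ "cost (SetArr j e f) 0"] exI[of _ 0]) simp
next
  case (Then c d)
  then obtain K D K' D' where 1: "\<And>M. cost c M \<le> K * (M + 1) ^ D" "\<And>M. cost d M \<le> K' * (M + 1) ^ D'"
    by blast
  have "cost (c ;; d) M \<le> (K + K') * (M + 1) ^ (D + D')" for M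
  proof -
    have "K * (M + 1) ^ D \<le> K * (M + 1) ^ (D + D')" "K' * (M + 1) ^ D' \<le> K' * (M + 1) ^ (D + D')"
      by (intro mult_left_mono power_increasing; simp)+
    then have "cost c M + cost d M \<le> K * (M + 1) ^ (D + D') + K' * (M + 1) ^ (D + D')"
      using 1(1)[of M] 1(2)[of M] by linarith
    then show ?thesis by (simp only: cost.simps distrib_right)
  qed
  then show ?case by blast
next
  case (Cond e c d)
  then obtain K D K' D' where 1: "\<And>M. cost c M \<le> K * (M + 1) ^ D" "\<And>M. cost d M \<le> K' * (M + 1) ^ D'"
    by blast
  let ?X = "expr_cost (comp_exp e) + 1"
  have "cost (Cond e c d) M \<le> (?X + K + K') * (M + 1) ^ (D + D')" for M
  proof -
    have "K * (M + 1) ^ D \<le> K * (M + 1) ^ (D + D')" "K' * (M + 1) ^ D' \<le> K' * (M + 1) ^ (D + D')"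
      by (intro mult_left_mono power_increasing; simp)+
    moreover have "?X * 1 \<le> ?X * (M + 1) ^ (D + D')"
      by (intro mult_left_mono one_le_power) simp_all
    moreover have "?X * 1 = ?X" by simp
    ultimately have "?X + cost c M + cost d M \<le> ?X * (M + 1) ^ (D + D') + K * (M + 1) ^ (D + D') + K' * (M + 1) ^ (D + D')"
      using 1(1)[of M] 1(2)[of M] by linarith
    then show ?thesis by (simp only: cost.simps distrib_right)
  qed
  then show ?case by blast
next
  case (Repeat j c)
  then obtain K D where 1: "\<And>M. cost c M \<le> K * (M + 1) ^ D" by blast
  have "cost (Repeat j c) M \<le> (34 + K) * (M + 1) ^ (D + 1)" for M
  proof -
    have "cost c M \<le> K * (M + 1) ^ D" by (rule 1)
    moreover have p: "1 \<le> (M + 1) ^ D" "1 \<le> (M + 1) ^ (D + 1)" by (intro one_le_power, simp)+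
    ultimately have "18 + cost c M \<le> 18 * (M + 1) ^ D + K * (M + 1) ^ D" by linarith
    then have "18 + cost c M \<le> (18 + K) * (M + 1) ^ D" by (simp only: distrib_right)
    then have "M * (18 + cost c M) \<le> (M + 1) * ((18 + K) * (M + 1) ^ D)" by (intro mult_mono) auto
    also have "\<dots> = (18 + K) * (M + 1) ^ (D + 1)" by (simp add: algebra_simps)
    finally have "16 + M * (18 + cost c M) \<le> 16 * (M + 1) ^ (D + 1) + (18 + K) * (M + 1) ^ (D + 1)"
      using p(2) by linarith
    also have "\<dots> = (34 + K) * (M + 1) ^ (D + 1)" by (simp only: distrib_right[symmetric]) simp
    finally show ?thesis by simp
  qed
  then show ?case by blast
qed

locale frame =
  fixes inp :: mem and F :: nat
  assumes F: "F \<ge> 2" "inp 0 = F" and inp_zero: "\<And>i. i \<ge> F - 1 \<Longrightarrow> inp i = 0"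
begin

text \<open>The simulation relation. It leaves the cells of the loop counters, from
  \<open>F + 32\<close> to \<open>F + 63\<close>, unconstrained.\<close>

definition rel :: "mem \<Rightarrow> state \<Rightarrow> bool" where
  "rel m s \<longleftrightarrow> (\<forall>i<F. m i = inp i) \<and> (\<forall>j<32. m (F + j) = fst s j) \<and>
     (\<forall>j<4. \<forall>i. m (F + (64 + j) + ((i + i) + (i + i))) = snd s j i)"

lemma eval_comp_exp: "rel m s \<Longrightarrow> wf_exp e \<Longrightarrow> eval_expr (comp_exp e) m = ev inp e s"
proof (induction e)
  case (Inp e)
  let ?x = "ev inp e s"
  have m0: "m 0 = F" using Inp.prems F by (auto simp: rel_def)
  \<comment> \<open>The nested truncated subtraction clips the address to \<open>F - 1\<close>,
    where the input is zero as at all later addresses.\<close>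
  have eq: "?x - (?x - (F - 1)) = min ?x (F - 1)" by auto
  have "m (min ?x (F - 1)) = inp (min ?x (F - 1))" using Inp.prems F(1) unfolding rel_def by simp
  also have "\<dots> = inp ?x" using inp_zero[of ?x] inp_zero[of "F - 1"] by (cases "?x \<le> F - 1") (auto simp: min_def)
  finally show ?case using Inp by (simp add: m0 eq del: One_nat_def)
qed (use F in \<open>auto simp: rel_def add.assoc\<close>)

lemma rel_counter: "rel m s \<Longrightarrow> k < 32 \<Longrightarrow> rel (m(F + (32 + k) := x)) s"
  unfolding rel_def by auto

lemma rel_reg: "rel m s \<Longrightarrow> j < 32 \<Longrightarrow> rel (m(F + j := x)) (set_reg j x s)"
  unfolding rel_def by auto

text \<open>Addresses in different arrays differ modulo 4, so distinct entries never share a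
  cell.\<close>

lemma rel_arr:
  assumes "rel m s" "j < 4"
  shows "rel (m(F + (64 + j) + ((i + i) + (i + i)) := x)) (set_arr j i x s)"
proof -
  have "F + (64 + j') + ((i' + i') + (i' + i')) = F + (64 + j) + ((i + i) + (i + i)) \<longleftrightarrow> j' = j \<and> i' = i" if "j' < 4" for j' i'
    using that assms(2) by presburger
  then show ?thesis using assms unfolding rel_def by auto
qed

text \<open>The counters of enclosing loops, with index below \<open>k\<close>, must survive the
  body; this is the last conjunct. Loop bounds stay below \<open>M\<close> because no register
  serving as a bound is written.\<close>

lemma exec_compile:
  assumes "wf_com k c" "rel m s" "\<forall>j\<in>loop_regs c. fst s j \<le> M" "loop_regs c \<inter> wregs c = {}"
    "k \<le> 32"
  shows "\<exists>t m'. exec (compile k c) m t m' \<and> t \<le> cost c M \<and> rel m' (run inp c s) \<and>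
    (\<forall>i<k. m' (F + (32 + i)) = m (F + (32 + i)))"
  using assms
proof (induction c arbitrary: k m s)
  case Nop
  have "exec Skip m 1 m" by (rule exec.Skip)
  then show ?case using Nop by (intro exI[of _ 1] exI[of _ m]) simp
next
  case (SetReg j e)
  have m0: "m 0 = F" using SetReg.prems F by (auto simp: rel_def)
  have "eval_expr (comp_exp e) m = ev inp e s" using SetReg.prems by (simp add: eval_comp_exp)
  moreover have "eval_expr (reg_addr j) m = F + j" by (simp add: reg_addr_def m0)
  ultimately have "exec (compile k (SetReg j e)) m (expr_cost (reg_addr j) + expr_cost (comp_exp e) + 1)
      (m(F + j := ev inp e s))"
    using exec.Store[of "reg_addr j" "comp_exp e" m] by simp
  moreover have "rel (m(F + j := ev inp e s)) (run inp (SetReg j e) s)"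
    using rel_reg SetReg.prems by simp
  moreover have "expr_cost (reg_addr j) = 4" by (simp add: reg_addr_def)
  moreover have "\<forall>i<k. (m(F + j := ev inp e s)) (F + (32 + i)) = m (F + (32 + i))"
    using SetReg.prems by auto
  ultimately show ?case
    by (intro exI[of _ "expr_cost (comp_exp e) + 5"] exI[of _ "m(F + j := ev inp e s)"])
      (simp del: fun_upd_apply add: add.commute)
next
  case (SetArr j e f)
  let ?a = "Add (Load (Const 0)) (Add (Const (64 + j)) (Add (Add (comp_exp e) (comp_exp e)) (Add (comp_exp e) (comp_exp e))))"
  let ?m = "m(F + (64 + j) + ((ev inp e s + ev inp e s) + (ev inp e s + ev inp e s)) := ev inp f s)"
  have m0: "m 0 = F" using SetArr.prems F by (auto simp: rel_def)
  have "eval_expr (comp_exp f) m = ev inp f s" using SetArr.prems by (simp add: eval_comp_exp)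
  moreover have "eval_expr ?a m = F + (64 + j) + ((ev inp e s + ev inp e s) + (ev inp e s + ev inp e s))"
    using SetArr.prems by (simp add: eval_comp_exp m0 add.assoc)
  ultimately have "exec (compile k (SetArr j e f)) m (expr_cost ?a + expr_cost (comp_exp f) + 1) ?m"
    using exec.Store[of ?a "comp_exp f" m] by (simp only: compile.simps)
  moreover have "rel ?m (run inp (SetArr j e f) s)"
    using rel_arr SetArr.prems by simp
  moreover have "\<forall>i<k. ?m (F + (32 + i)) = m (F + (32 + i))" using SetArr.prems by auto
  moreover have "expr_cost ?a + expr_cost (comp_exp f) + 1 \<le> cost (SetArr j e f) M" by simp
  ultimately show ?case by blast
next
  case (Then c d)
  have dj: "loop_regs c \<inter> wregs c = {}" "loop_regs d \<inter> wregs d = {}" using Then.prems(4) by auto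
  obtain t m1 where 1: "exec (compile k c) m t m1" "t \<le> cost c M" "rel m1 (run inp c s)"
      "\<forall>i<k. m1 (F + (32 + i)) = m (F + (32 + i))"
    using Then.IH(1)[of k m s, OF _ Then.prems(2) _ dj(1) Then.prems(5)] Then.prems(1,3) by auto
  have "\<forall>j\<in>loop_regs d. fst (run inp c s) j \<le> M"
    using Then.prems(3,4) run_wregs[of _ c inp s] by (auto simp: disjoint_iff)
  then obtain t' m2 where 2: "exec (compile k d) m1 t' m2" "t' \<le> cost d M" "rel m2 (run inp d (run inp c s))"
      "\<forall>i<k. m2 (F + (32 + i)) = m1 (F + (32 + i))"
    using Then.IH(2)[of k m1 "run inp c s", OF _ 1(3) _ dj(2) Then.prems(5)] Then.prems(1) by auto
  show ?case using exec.Seq[OF 1(1) 2(1)] 1 2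
    by (intro exI[of _ "t + t'"] exI[of _ m2]) auto
next
  case (Cond e c d)
  have dj: "loop_regs c \<inter> wregs c = {}" "loop_regs d \<inter> wregs d = {}" using Cond.prems(4) by auto
  have e: "eval_expr (comp_exp e) m = ev inp e s" using Cond.prems by (simp add: eval_comp_exp)
  show ?case
  proof (cases "ev inp e s = 0")
    case True
    obtain t m1 where 1: "exec (compile k d) m t m1" "t \<le> cost d M" "rel m1 (run inp d s)"
      "\<forall>i<k. m1 (F + (32 + i)) = m (F + (32 + i))"
      using Cond.IH(2)[of k m s, OF _ Cond.prems(2) _ dj(2) Cond.prems(5)] Cond.prems(1,3) by auto
    show ?thesis using exec.IfFalse[OF _ 1(1), of "comp_exp e" "compile k c"] 1 e True
      by (intro exI[of _ "expr_cost (comp_exp e) + 1 + t"] exI[of _ m1]) auto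
  next
    case False
    obtain t m1 where 1: "exec (compile k c) m t m1" "t \<le> cost c M" "rel m1 (run inp c s)"
      "\<forall>i<k. m1 (F + (32 + i)) = m (F + (32 + i))"
      using Cond.IH(1)[of k m s, OF _ Cond.prems(2) _ dj(1) Cond.prems(5)] Cond.prems(1,3) by auto
    show ?thesis using exec.IfTrue[OF _ 1(1), of "comp_exp e" "compile k d"] 1 e False
      by (intro exI[of _ "expr_cost (comp_exp e) + 1 + t"] exI[of _ m1]) auto
  qed
next
  case (Repeat j c)
  let ?ctr = "reg_addr (32 + k)"
  let ?body = "Seq (compile (Suc k) c) (Store ?ctr (Sub (Load ?ctr) (Const 1)))"
  have k: "k < 32" "j < 32" "wf_com (Suc k) c" using Repeat.prems by auto
  \<comment> \<open>Here \<open>x\<close> is the number of remaining iterations, and the summand 6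
    pays for the final test.\<close>
  have loop: "\<exists>t m'. exec (While (Load ?ctr) ?body) m t m' \<and> t \<le> x * (18 + cost c M) + 6 \<and>
      rel m' ((run inp c ^^ x) s) \<and> (\<forall>i<k. m' (F + (32 + i)) = m (F + (32 + i)))"
    if "rel m s" "m (F + (32 + k)) = x" "\<forall>j\<in>loop_regs c. fst s j \<le> M" for x m s
    using that
  proof (induction x arbitrary: m s)
    case 0
    have m0: "m 0 = F" using 0 F by (auto simp: rel_def)
    have "exec (While (Load ?ctr) ?body) m (expr_cost (Load ?ctr) + 1) m"
      by (rule exec.WhileFalse) (use 0 in \<open>simp add: reg_addr_def m0\<close>)
    then show ?case using 0 by (intro exI[of _ "expr_cost (Load ?ctr) + 1"] exI[of _ m]) (simp add: reg_addr_def)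
  next
    case (Suc x)
    have m0: "m 0 = F" using Suc F by (auto simp: rel_def)
    obtain t m1 where 1: "exec (compile (Suc k) c) m t m1" "t \<le> cost c M" "rel m1 (run inp c s)"
      "\<forall>i<Suc k. m1 (F + (32 + i)) = m (F + (32 + i))"
      using Repeat.IH[OF k(3) Suc.prems(1)] Suc.prems Repeat.prems by auto
    have m10: "m1 0 = F" using 1(3) F by (auto simp: rel_def)
    define m2 where "m2 = m1(F + (32 + k) := x)"
    have "m1 (F + (32 + k)) = Suc x" using 1(4) Suc.prems(2) by auto
    then have "exec (Store ?ctr (Sub (Load ?ctr) (Const 1))) m1 12 m2"
      using exec.Store[of ?ctr "Sub (Load ?ctr) (Const 1)" m1] by (simp add: reg_addr_def m10 m2_def eval_nat_numeral)
    from exec.Seq[OF 1(1) this] have b: "exec ?body m (t + 12) m2" .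
    have r2: "rel m2 (run inp c s)" unfolding m2_def by (rule rel_counter[OF 1(3) k(1)])
    have "\<forall>j\<in>loop_regs c. fst (run inp c s) j \<le> M"
      using Suc.prems(3) Repeat.prems(4) run_wregs[of _ c inp s] by (auto simp: disjoint_iff)
    moreover have "m2 (F + (32 + k)) = x" by (simp add: m2_def)
    ultimately obtain t' m3 where 3: "exec (While (Load ?ctr) ?body) m2 t' m3"
      "t' \<le> x * (18 + cost c M) + 6" "rel m3 ((run inp c ^^ x) (run inp c s))"
      "\<forall>i<k. m3 (F + (32 + i)) = m2 (F + (32 + i))" using Suc.IH[OF r2] by blast
    have "eval_expr (Load ?ctr) m \<noteq> 0" using Suc.prems(2) by (simp add: reg_addr_def m0)
    from exec.WhileTrue[OF this b 3(1)]
    have "exec (While (Load ?ctr) ?body) m (expr_cost (Load ?ctr) + 1 + (t + 12) + t') m3" .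
    moreover have "expr_cost (Load ?ctr) = 5" by (simp add: reg_addr_def)
    moreover have "\<forall>i<k. m3 (F + (32 + i)) = m (F + (32 + i))" using 3(4) 1(4) by (simp add: m2_def)
    moreover have "rel m3 ((run inp c ^^ Suc x) s)" using 3(3) by (simp add: funpow_swap1)
    ultimately show ?case using 1(2) 3(2)
      by (intro exI[of _ "expr_cost (Load ?ctr) + 1 + (t + 12) + t'"] exI[of _ m3]) simp
  qed
  have m0: "m 0 = F" using Repeat.prems F by (auto simp: rel_def)
  define m1 where "m1 = m(F + (32 + k) := fst s j)"
  have "m (F + j) = fst s j" using Repeat.prems(2) k unfolding rel_def by auto
  then have s: "exec (Store ?ctr (Load (reg_addr j))) m 10 m1"
    using exec.Store[of ?ctr "Load (reg_addr j)" m] by (simp add: reg_addr_def m0 m1_def eval_nat_numeral)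
  have r1: "rel m1 s" unfolding m1_def using rel_counter Repeat.prems k by blast
  have m1j: "m1 (F + (32 + k)) = fst s j" by (simp add: m1_def)
  obtain t m2 where 2: "exec (While (Load ?ctr) ?body) m1 t m2" "t \<le> fst s j * (18 + cost c M) + 6"
      "rel m2 ((run inp c ^^ fst s j) s)" "\<forall>i<k. m2 (F + (32 + i)) = m1 (F + (32 + i))"
    using loop[OF r1, of "fst s j"] Repeat.prems(3) m1j by auto
  have "fst s j * (18 + cost c M) \<le> M * (18 + cost c M)"
    using Repeat.prems(3) by (intro mult_right_mono) auto
  then have "10 + t \<le> cost (Repeat j c) M" using 2(2) unfolding cost.simps by linarith
  then show ?case using exec.Seq[OF s 2(1)] 2(3,4)
    by (intro exI[of _ "10 + t"] exI[of _ m2]) (auto simp: m1_def)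
qed

end

section \<open>Counting loops, unrolled loops and their invariant rules\<close>

definition for_loop :: "nat \<Rightarrow> nat \<Rightarrow> com \<Rightarrow> com" where
  "for_loop i b c = SetReg i (Num 0) ;; Repeat b (c ;; SetReg i (Sum (Reg i) (Num 1)))"

text \<open>A loop unrolled at compile time, so that the index can occur in the syntax of the
  body.\<close>

primrec seqs :: "(nat \<Rightarrow> com) \<Rightarrow> nat \<Rightarrow> com" where
  "seqs f 0 = Nop"
| "seqs f (Suc k) = seqs f k ;; f k"

lemma regs_for_loop [simp]:
  "wregs (for_loop i b c) = insert i (wregs c)" "warrs (for_loop i b c) = warrs c"
  "loop_regs (for_loop i b c) = insert b (loop_regs c)"
  by (auto simp: for_loop_def)

lemma wf_for_loop [simp]:
  "wf_com k (for_loop i b c) \<longleftrightarrow> i < 32 \<and> k < 32 \<and> b < 32 \<and> wf_com (Suc k) c"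
  by (auto simp: for_loop_def)

lemma regs_seqs [simp]:
  "wregs (seqs f k) = (\<Union>c<k. wregs (f c))" "warrs (seqs f k) = (\<Union>c<k. warrs (f c))"
  "loop_regs (seqs f k) = (\<Union>c<k. loop_regs (f c))"
  by (induction k) (auto simp: less_Suc_eq)

lemma wf_seqs [simp]: "wf_com d (seqs f k) \<longleftrightarrow> (\<forall>c<k. wf_com d (f c))"
  by (induction k) (auto simp: less_Suc_eq)

text \<open>Everything the body does not write is known to be unchanged in each round, so an
  invariant need only mention what varies.\<close>

lemma repeat_rule:
  assumes "I 0 s"
    and "\<And>i t. i < fst s b \<Longrightarrow> (\<And>x. x \<notin> wregs c \<Longrightarrow> fst t x = fst s x) \<Longrightarrow>
      (\<And>x. x \<notin> warrs c \<Longrightarrow> snd t x = snd s x) \<Longrightarrow> I i t \<Longrightarrow> I (Suc i) (run inp c t)"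
  shows "I (fst s b) (run inp (Repeat b c) s)"
proof -
  have "i \<le> fst s b \<longrightarrow> I i ((run inp c ^^ i) s) \<and> (\<forall>x. x \<notin> wregs c \<longrightarrow> fst ((run inp c ^^ i) s) x = fst s x)
    \<and> (\<forall>x. x \<notin> warrs c \<longrightarrow> snd ((run inp c ^^ i) s) x = snd s x)" for i
  proof (induction i)
    case (Suc i)
    then show ?case using assms(2)[of i "(run inp c ^^ i) s"] by (simp add: run_wregs run_warrs)
  qed (simp add: assms(1))
  then show ?thesis by simp
qed

lemma for_rule:
  assumes "i \<notin> wregs c" "b \<noteq> i" "I 0 (set_reg i 0 s)"
    and "\<And>j t. j < fst s b \<Longrightarrow> fst t i = j \<Longrightarrow> (\<And>x. x \<notin> wregs c \<Longrightarrow> x \<noteq> i \<Longrightarrow> fst t x = fst s x) \<Longrightarrow>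
      (\<And>x. x \<notin> warrs c \<Longrightarrow> snd t x = snd s x) \<Longrightarrow> I j t \<Longrightarrow> I (Suc j) (set_reg i (Suc j) (run inp c t))"
  shows "I (fst s b) (run inp (for_loop i b c) s)"
proof -
  let ?s = "set_reg i 0 s"
  let ?I = "\<lambda>j t. fst t i = j \<and> I j t"
  have "?I (fst ?s b) (run inp (Repeat b (c ;; SetReg i (Sum (Reg i) (Num 1)))) ?s)"
  proof (rule repeat_rule)
    fix j t
    assume a: "j < fst ?s b" "\<And>x. x \<notin> wregs (c ;; SetReg i (Sum (Reg i) (Num 1))) \<Longrightarrow> fst t x = fst ?s x"
      "\<And>x. x \<notin> warrs (c ;; SetReg i (Sum (Reg i) (Num 1))) \<Longrightarrow> snd t x = snd ?s x" "?I j t"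
    have "I (Suc j) (set_reg i (Suc j) (run inp c t))"
      using a assms(2) by (intro assms(4)) auto
    moreover have "fst (run inp c t) i = j" using a(4) run_wregs[OF assms(1)] by simp
    ultimately show "?I (Suc j) (run inp (c ;; SetReg i (Sum (Reg i) (Num 1))) t)" by simp
  qed (use assms in simp)
  then show ?thesis using assms(2) by (simp add: for_loop_def)
qed

lemma seqs_rule:
  assumes "I 0 s"
    and "\<And>c t. c < k \<Longrightarrow> (\<And>x. x \<notin> wregs (seqs f k) \<Longrightarrow> fst t x = fst s x) \<Longrightarrow>
      (\<And>x. x \<notin> warrs (seqs f k) \<Longrightarrow> snd t x = snd s x) \<Longrightarrow> I c t \<Longrightarrow> I (Suc c) (run inp (f c) t)"
  shows "I k (run inp (seqs f k) s)"
proof -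
  have "i \<le> k \<longrightarrow> I i (run inp (seqs f i) s)" for i
  proof (induction i)
    case (Suc i)
    have "fst (run inp (seqs f i) s) x = fst s x" if "x \<notin> wregs (seqs f k)" "Suc i \<le> k" for x
      using that by (intro run_wregs) auto
    moreover have "snd (run inp (seqs f i) s) x = snd s x" if "x \<notin> warrs (seqs f k)" "Suc i \<le> k" for x
      using that by (intro run_warrs) auto
    ultimately show ?case using Suc assms(2)[of i "run inp (seqs f i) s"] by simp
  qed (simp add: assms(1))
  then show ?thesis by simp
qed

section \<open>The search program\<close>

text \<open>
  The colour \<open>c\<close> of vertex \<open>v\<close> is represented by entry \<open>5 * v + c\<close> of an array.
\<close>

abbreviation (input) "rN \<equiv> 0"
text \<open>Registers 1 to 4 are set up before the search: the threshold \<open>d\<close>, the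
  number \<open>m\<close> of guesses per round, the base \<open>5 * n + 1\<close> and the number of
  candidates.\<close>

abbreviation (input) "rD \<equiv> 1"
abbreviation (input) "rS \<equiv> 2"
abbreviation (input) "rB \<equiv> 3"
abbreviation (input) "rM \<equiv> 4"
abbreviation (input) "rAns \<equiv> 5"
abbreviation (input) "rK \<equiv> 6"
abbreviation (input) "rKK \<equiv> 7"
abbreviation (input) "rQ \<equiv> 8"
abbreviation (input) "rV \<equiv> 9"
abbreviation (input) "rY \<equiv> 10"
text \<open>\<open>rP\<close> holds the input address \<open>1 + v * n\<close> of row
  \<open>v\<close> of the adjacency matrix; \<open>rL\<close> holds the address
  \<open>1 + n * n\<close> of the first list bit.\<close>

abbreviation (input) "rP \<equiv> 11"
abbreviation (input) "rC \<equiv> 12"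
abbreviation (input) "rOk \<equiv> 13"
abbreviation (input) "rW \<equiv> 14"
abbreviation (input) "rL \<equiv> 15"

section \<open>The building blocks of the search\<close>

definition lit :: "nat \<Rightarrow> nat \<Rightarrow> aexp" where
  "lit i c = Sum (Num c) (Sum (Reg i) (Sum (Reg i) (Sum (Reg i) (Sum (Reg i) (Reg i)))))"

definition incr :: "nat \<Rightarrow> com" where
  "incr j = SetReg j (Sum (Reg j) (Num 1))"

definition del :: "nat \<Rightarrow> nat \<Rightarrow> com" where
  "del i c = SetArr 0 (lit i c) (Num 0)"

definition vloop :: "(nat \<Rightarrow> com) \<Rightarrow> com" where
  "vloop f = SetReg rP (Num 1) ;; for_loop rV rN (seqs f 5 ;; SetReg rP (Sum (Reg rP) (Reg rN)))"

definition copy :: "nat \<Rightarrow> nat \<Rightarrow> com" where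
  "copy i j = vloop (\<lambda>c. SetArr i (lit rV c) (Arr j (lit rV c)))"

text \<open>Array 1 keeps a copy, so that all deletions of a pass are decided on the same lists, as
  in \<open>revise\<close> and \<open>prune\<close>. A test \<open>Dif (Sum a (Num 1)) b\<close>
  succeeds iff \<open>b \<le> a\<close>.\<close>

definition filter_com :: "(nat \<Rightarrow> aexp) \<Rightarrow> aexp \<Rightarrow> com" where
  "filter_com g thr = copy 1 0 ;; vloop (\<lambda>c. SetReg rC (Num 0) ;;
     for_loop rY rN (Cond (Inp (Sum (Reg rP) (Reg rY))) (Cond (g c) (incr rC) Nop) Nop) ;;
     Cond (Dif (Sum (Reg rC) (Num 1)) thr) (del rV c) Nop)"

text \<open>The counted expression is nonzero iff neither neighbour of \<open>c\<close> is in the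
  list of \<open>rY\<close>; one such vertex suffices for deletion.\<close>

definition ac_com :: com where
  "ac_com = Repeat rB (filter_com (\<lambda>c. Dif (Num 1)
     (Sum (Arr 1 (lit rY ((c + 1) mod 5))) (Arr 1 (lit rY ((c + 4) mod 5))))) (Num 1))"

definition prune_com :: com where
  "prune_com = filter_com (\<lambda>c. Sum (Arr 1 (lit rY c))
     (Sum (Arr 1 (lit rY ((c + 2) mod 5))) (Arr 1 (lit rY ((c + 3) mod 5))))) (Reg rD)"

text \<open>The bound \<open>b = 5\<close> only detects empty lists, while \<open>b = 1\<close> asks
  for a fully decided instance.\<close>

definition check_com :: "nat \<Rightarrow> com" where
  "check_com b = SetReg rOk (Num 1) ;; for_loop rV rN (SetReg rC (Num 0) ;;
     seqs (\<lambda>c. Cond (Arr 0 (lit rV c)) (incr rC) Nop) 5 ;;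
     Cond (Reg rC) (Cond (Dif (Reg rC) (Num b)) (SetReg rOk (Num 0)) Nop) (SetReg rOk (Num 0)))"

definition trial_com :: "nat \<Rightarrow> com" where
  "trial_com c = copy 2 0 ;; seqs (\<lambda>c'. if c' = c then Nop else del rW c') 5 ;; ac_com ;; check_com 5 ;;
     Cond (Reg rOk) Nop (copy 0 2)"

definition greedy_com :: com where
  "greedy_com = for_loop rW rN (seqs trial_com 5)"

text \<open>Division by repeated subtraction, in \<open>rM\<close> rounds because the dividend is
  below \<open>rM\<close>. The quotient stays in \<open>rKK\<close>, so a second run continues with
  the next digits.\<close>

definition digits_com :: com where
  "digits_com = Repeat rS (SetReg rQ (Num 0) ;;
     Repeat rM (Cond (Dif (Sum (Reg rKK) (Num 1)) (Reg rB)) (SetReg rKK (Dif (Reg rKK) (Reg rB)) ;; incr rQ) Nop) ;;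
     vloop (\<lambda>c. Cond (Sum (Dif (lit rV c) (Reg rKK)) (Dif (Reg rKK) (lit rV c)))
       (Cond (Dif (Sum (Reg rKK) (Num 1)) (lit rV 0)) (Cond (Dif (lit rV 5) (Reg rKK)) (del rV c) Nop) Nop) Nop) ;;
     SetReg rKK (Reg rQ))"

definition init_com :: com where
  "init_com = vloop (\<lambda>c. SetArr 0 (lit rV c) (Inp (Sum (Reg rL) (lit rV c))))"

definition guess_com :: com where
  "guess_com = SetReg rKK (Reg rK) ;; init_com ;; digits_com ;; ac_com ;; prune_com ;; ac_com ;;
     digits_com ;; ac_com ;; greedy_com ;; check_com 1"

definition try_com :: com where
  "try_com = guess_com ;; Cond (Reg rOk) (SetReg rAns (Num 1)) Nop"

definition search_com :: com where
  "search_com = SetReg rAns (Num 0) ;; for_loop rK rM try_com"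

lemma colours_nonempty [simp]: "{..<5::nat} \<noteq> {}"
  by (simp add: lessThan_empty_iff)

lemma ev_lit [simp]: "ev inp (lit i c) s = 5 * fst s i + c"
  by (simp add: lit_def)

lemma run_incr [simp]: "run inp (incr j) s = set_reg j (Suc (fst s j)) s"
  by (simp add: incr_def)

lemma regs_incr [simp]: "wregs (incr j) = {j}" "warrs (incr j) = {}" "loop_regs (incr j) = {}"
  by (simp_all add: incr_def)

lemma regs_del [simp]: "wregs (del i c) = {}" "warrs (del i c) = {0}" "loop_regs (del i c) = {}"
  by (simp_all add: del_def)

lemma regs_vloop [simp]:
  "wregs (vloop f) = {rV, rP} \<union> (\<Union>c<5. wregs (f c))" "warrs (vloop f) = (\<Union>c<5. warrs (f c))"
  "loop_regs (vloop f) = insert rN (\<Union>c<5. loop_regs (f c))"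
  by (auto simp: vloop_def)

lemma regs_copy [simp]: "wregs (copy i j) = {rV, rP}" "warrs (copy i j) = {i}" "loop_regs (copy i j) = {rN}"
  by (auto simp: copy_def)

lemma regs_filter [simp]:
  "wregs (filter_com g thr) = {rV, rY, rP, rC}" "warrs (filter_com g thr) = {0, 1}"
  "loop_regs (filter_com g thr) = {rN}"
  by (auto simp: filter_com_def)

lemma regs_ac [simp]: "wregs ac_com = {rV, rY, rP, rC}" "warrs ac_com = {0, 1}" "loop_regs ac_com = {rN, rB}"
  by (auto simp: ac_com_def)

lemma regs_prune [simp]: "wregs prune_com = {rV, rY, rP, rC}" "warrs prune_com = {0, 1}" "loop_regs prune_com = {rN}"
  by (auto simp: prune_com_def)

lemma regs_check [simp]: "wregs (check_com b) = {rV, rC, rOk}" "warrs (check_com b) = {}" "loop_regs (check_com b) = {rN}"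
  by (auto simp: check_com_def)

lemma regs_trial [simp]:
  "wregs (trial_com c) = {rV, rY, rP, rC, rOk}" "warrs (trial_com c) = {0, 1, 2}" "loop_regs (trial_com c) = {rN, rB}"
  by (auto simp: trial_com_def split: if_splits)

lemma regs_greedy [simp]:
  "wregs greedy_com = {rV, rY, rP, rC, rOk, rW}" "warrs greedy_com = {0, 1, 2}" "loop_regs greedy_com = {rN, rB}"
  by (auto simp: greedy_com_def)

lemma regs_digits [simp]:
  "wregs digits_com = {rKK, rQ, rV, rP}" "warrs digits_com = {0}" "loop_regs digits_com = {rN, rS, rM}"
  by (auto simp: digits_com_def)

lemma regs_init [simp]: "wregs init_com = {rV, rP}" "warrs init_com = {0}" "loop_regs init_com = {rN}"
  by (auto simp: init_com_def)

lemma regs_guess [simp]: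
  "wregs guess_com = {rKK, rQ, rV, rY, rP, rC, rOk, rW}" "loop_regs guess_com = {rN, rS, rB, rM}"
  by (auto simp: guess_com_def)

lemma regs_try [simp]:
  "wregs try_com = {rAns, rKK, rQ, rV, rY, rP, rC, rOk, rW}" "loop_regs try_com = {rN, rS, rB, rM}"
  by (auto simp: try_com_def)

lemma regs_search: "wregs search_com = {rAns, rK, rKK, rQ, rV, rY, rP, rC, rOk, rW}"
  "loop_regs search_com = {rN, rS, rB, rM}"
  by (auto simp: search_com_def)

lemma wf_search: "wf_com 0 search_com"
  by (simp add: search_com_def try_com_def guess_com_def init_com_def digits_com_def greedy_com_def trial_com_def
    check_com_def ac_com_def prune_com_def filter_com_def copy_def vloop_def del_def incr_def lit_def)

section \<open>Correctness of the search program\<close>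

locale instance_env = lgraph +
  fixes inp :: mem and L0 :: "nat \<Rightarrow> nat set"
  assumes inp_adj: "\<And>v y. v < n \<Longrightarrow> y < n \<Longrightarrow> inp (1 + v * n + y) \<noteq> 0 \<longleftrightarrow> E v y"
    and inp_list: "\<And>v c. v < n \<Longrightarrow> c < 5 \<Longrightarrow> inp (1 + n * n + (5 * v + c)) \<noteq> 0 \<longleftrightarrow> c \<in> L0 v"
    and L0: "\<And>v. L0 v \<subseteq> {..<5}" "\<And>v. v \<ge> n \<Longrightarrow> L0 v = {}"
begin

definition lists :: "nat \<Rightarrow> state \<Rightarrow> nat \<Rightarrow> nat set" where
  "lists j s v = {c. v < n \<and> c < 5 \<and> snd s j (5 * v + c) \<noteq> 0}"

lemma lists_set_reg [simp]: "lists j (set_reg i x s) = lists j s"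
  by (simp add: lists_def fun_eq_iff)

lemma lists_cong: "snd s j = snd t j \<Longrightarrow> lists j s = lists j t"
  by (simp add: lists_def fun_eq_iff)

lemma lists_less: "lists j s v \<subseteq> {..<5}"
  by (auto simp: lists_def)

lemma lists_empty: "v \<ge> n \<Longrightarrow> lists j s v = {}"
  by (auto simp: lists_def)

lemma entry_eq_iff: "c < 5 \<Longrightarrow> c' < 5 \<Longrightarrow> 5 * v + c = 5 * v' + c' \<longleftrightarrow> v = v' \<and> c = (c'::nat)"
  by presburger

lemma mem_lists: "v < n \<Longrightarrow> c < 5 \<Longrightarrow> c \<in> lists j s v \<longleftrightarrow> snd s j (5 * v + c) \<noteq> 0"
  by (simp add: lists_def)

lemma lists_set_arr:
  assumes "v < n" "c < 5"
  shows "lists j (set_arr j (5 * v + c) x s) =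
    (lists j s)(v := if x \<noteq> 0 then insert c (lists j s v) else lists j s v - {c})"
  using assms by (auto simp: lists_def fun_eq_iff entry_eq_iff)

lemma lists_del:
  assumes "fst s i = v" "v < n" "c < 5"
  shows "lists 0 (run inp (del i c) s) = (lists 0 s)(v := lists 0 s v - {c})"
  using lists_set_arr[OF assms(2,3), of 0 0 s] assms(1) by (simp add: del_def)

text \<open>Entries are visited in lexicographic order and each visit decides only its own entry, so
  \<open>f c\<close> may rely on finding the original value there.\<close>

lemma vloop_rule:
  assumes n: "fst s rN = n" and f: "\<And>c. c < 5 \<Longrightarrow> {rN, rV, rP} \<inter> wregs (f c) = {}"
    and step: "\<And>v c t. v < n \<Longrightarrow> c < 5 \<Longrightarrow> fst t rV = v \<Longrightarrow> fst t rP = 1 + v * n \<Longrightarrow>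
      (\<And>x. x \<notin> wregs (vloop f) \<Longrightarrow> fst t x = fst s x) \<Longrightarrow>
      (\<And>x. x \<notin> warrs (vloop f) \<Longrightarrow> snd t x = snd s x) \<Longrightarrow>
      (c \<in> lists j t v \<longleftrightarrow> c \<in> lists j s v) \<Longrightarrow>
      lists j (run inp (f c) t) = (lists j t)(v := if Q v c then insert c (lists j t v) else lists j t v - {c})"
  shows "lists j (run inp (vloop f) s) = (\<lambda>v. {c. v < n \<and> c < 5 \<and> Q v c})"
proof -
  let ?s = "set_reg rP 1 s"
  let ?c = "seqs f 5 ;; SetReg rP (Sum (Reg rP) (Reg rN))"
  \<comment> \<open>The lists once all entries before \<open>(v, c)\<close> have been
    decided.\<close>
  define X where "X v c = (\<lambda>v'. {c'. v' < n \<and> c' < 5 \<and>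
      (if v' < v \<or> v' = v \<and> c' < c then Q v' c' else c' \<in> lists j s v')})" for v c
  let ?I = "\<lambda>v t. fst t rP = 1 + v * n \<and> lists j t = X v 0"
  have "?I (fst ?s rN) (run inp (for_loop rV rN ?c) ?s)"
  proof (rule for_rule)
    show "rV \<notin> wregs ?c" using f by auto
    show "?I 0 (set_reg rV 0 ?s)"
      by (auto simp: X_def fun_eq_iff lists_def)
  next
    fix v t
    assume v: "v < fst ?s rN" "fst t rV = v"
      and fr: "\<And>x. x \<notin> wregs ?c \<Longrightarrow> x \<noteq> rV \<Longrightarrow> fst t x = fst ?s x"
      and fa: "\<And>x. x \<notin> warrs ?c \<Longrightarrow> snd t x = snd ?s x"
      and I: "?I v t"
    have vn: "v < n" using v n by simp
    have "lists j (run inp (seqs f 5) t) = X v 5"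
    proof (rule seqs_rule[where I = "\<lambda>c t. lists j t = X v c"])
      show "lists j t = X v 0" using I by simp
    next
      fix c u
      assume c: "c < 5" and fr': "\<And>x. x \<notin> wregs (seqs f 5) \<Longrightarrow> fst u x = fst t x"
        and fa': "\<And>x. x \<notin> warrs (seqs f 5) \<Longrightarrow> snd u x = snd t x" and u: "lists j u = X v c"
      have "fst u rV = v" using fr'[of rV] f v by auto
      moreover have "fst u rP = 1 + v * n" using fr'[of rP] f I by auto
      moreover have "fst u x = fst s x" if "x \<notin> wregs (vloop f)" for x
        using that fr'[of x] fr[of x] by auto
      moreover have "snd u x = snd s x" if "x \<notin> warrs (vloop f)" for x
        using that fa'[of x] fa[of x] by auto
      moreover have "c \<in> lists j u v \<longleftrightarrow> c \<in> lists j s v"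
        unfolding u using vn c by (simp add: X_def)
      ultimately have "lists j (run inp (f c) u) =
          (lists j u)(v := if Q v c then insert c (lists j u v) else lists j u v - {c})"
        using step[OF vn c] by blast
      also have "\<dots> = X v (Suc c)"
        unfolding u X_def using vn c by (auto simp: fun_eq_iff less_Suc_eq)
      finally show "lists j (run inp (f c) u) = X v (Suc c)" .
    qed
    also have "X v 5 = X (Suc v) 0"
      unfolding X_def by (auto simp: fun_eq_iff less_Suc_eq)
    finally have "lists j (run inp (seqs f 5) t) = X (Suc v) 0" .
    moreover have "fst (run inp (seqs f 5) t) rP = 1 + v * n" "fst (run inp (seqs f 5) t) rN = n"
      using run_wregs[of _ "seqs f 5" inp t] f fr[of rN] I n by auto
    ultimately show "?I (Suc v) (set_reg rV (Suc v) (run inp ?c t))" by simp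
  qed simp
  then have "lists j (run inp (vloop f) s) = X n 0" using n by (simp add: vloop_def)
  then show ?thesis by (auto simp: X_def fun_eq_iff)
qed

lemma lists_copy:
  assumes n: "fst s rN = n" and ij: "i \<noteq> j"
  shows "lists i (run inp (copy i j) s) = lists j s"
proof -
  have "lists i (run inp (copy i j) s) = (\<lambda>v. {c. v < n \<and> c < 5 \<and> c \<in> lists j s v})"
    unfolding copy_def
  proof (rule vloop_rule[OF n])
    fix v c :: nat and t :: state
    assume a: "v < n" "c < 5" "fst t rV = v"
      and fa: "\<And>x. x \<notin> warrs (vloop (\<lambda>c. SetArr i (lit 9 c) (Arr j (lit 9 c)))) \<Longrightarrow> snd t x = snd s x"
    have "snd t j = snd s j" using fa[of j] ij by auto
    then show "lists i (run inp (SetArr i (lit 9 c) (Arr j (lit 9 c))) t) =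
      (lists i t)(v := if c \<in> lists j s v then insert c (lists i t v) else lists i t v - {c})"
      using a by (simp add: lists_set_arr mem_lists)
  qed simp
  also have "\<dots> = lists j s" by (auto simp: lists_def fun_eq_iff)
  finally show ?thesis .
qed

lemma lists_filter:
  assumes n: "fst s rN = n"
    and g: "\<And>c t y. c < 5 \<Longrightarrow> y < n \<Longrightarrow> fst t rY = y \<Longrightarrow> ev inp (g c) t \<noteq> 0 \<longleftrightarrow> G (lists 1 t) y c"
    and thr: "\<And>t. fst t rD = fst s rD \<Longrightarrow> ev inp thr t = th"
  shows "lists 0 (run inp (filter_com g thr) s) =
    (\<lambda>v. {c \<in> lists 0 s v. card {y. E v y \<and> G (lists 0 s) y c} < th})"
proof -
  define s1 where "s1 = run inp (copy 1 0) s"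
  have n1: "fst s1 rN = n" and d1: "fst s1 rD = fst s rD" unfolding s1_def by (simp_all add: run_wregs n)
  have l1: "lists 1 s1 = lists 0 s" unfolding s1_def by (simp add: lists_copy n)
  have l0: "lists 0 s1 = lists 0 s" unfolding s1_def by (rule lists_cong) (simp add: run_warrs)
  define Y where "Y v c = {y. E v y \<and> G (lists 0 s) y c}" for v c
  let ?body = "\<lambda>c. Cond (Inp (Sum (Reg rP) (Reg rY))) (Cond (g c) (incr rC) Nop) Nop"
  let ?f = "\<lambda>c. SetReg rC (Num 0) ;; for_loop rY rN (?body c) ;; Cond (Dif (Sum (Reg rC) (Num 1)) thr) (del rV c) Nop"
  have "lists 0 (run inp (vloop ?f) s1) = (\<lambda>v. {c. v < n \<and> c < 5 \<and> c \<in> lists 0 s v \<and> card (Y v c) < th})"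
  proof (rule vloop_rule[OF n1])
    fix v c :: nat and t :: state
    assume a: "v < n" "c < 5" "fst t rV = v" "fst t rP = 1 + v * n"
      and fr: "\<And>x. x \<notin> wregs (vloop ?f) \<Longrightarrow> fst t x = fst s1 x"
      and fa: "\<And>x. x \<notin> warrs (vloop ?f) \<Longrightarrow> snd t x = snd s1 x"
      and mem: "c \<in> lists 0 t v \<longleftrightarrow> c \<in> lists 0 s1 v"
    define t1 where "t1 = set_reg rC 0 t"
    define t2 where "t2 = run inp (for_loop rY rN (?body c)) t1"
    have tn: "fst t1 rN = n" "fst t rD = fst s rD" using fr[of rN] fr[of rD] n1 d1 by (simp_all add: t1_def)
    have "snd t 1 = snd s1 1" by (rule fa) simp
    then have t1l: "lists 1 t = lists 0 s" using l1 lists_cong by metis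
    have "fst t2 rC = card {y\<in>Y v c. y < fst t1 rN}"
      unfolding t2_def
    proof (rule for_rule[where I = "\<lambda>j u. fst u rC = card {y\<in>Y v c. y < j}"])
      fix j u
      assume u: "j < fst t1 rN" "fst u rY = j" "\<And>x. x \<notin> wregs (?body c) \<Longrightarrow> x \<noteq> rY \<Longrightarrow> fst u x = fst t1 x"
        "\<And>x. x \<notin> warrs (?body c) \<Longrightarrow> snd u x = snd t1 x" "fst u rC = card {y\<in>Y v c. y < j}"
      have j: "j < n" using u(1) tn by simp
      have "fst u rP = 1 + v * n" using u(3)[of rP] a by (simp add: t1_def)
      then have inp: "inp (fst u rP + j) \<noteq> 0 \<longleftrightarrow> E v j" using inp_adj[OF a(1) j] by simp
      have "lists 1 u = lists 0 s" using t1l u(4)[of 1] lists_cong[of u 1 t] by (simp add: t1_def)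
      then have gg: "ev inp (g c) u \<noteq> 0 \<longleftrightarrow> G (lists 0 s) j c" using g[OF a(2) j u(2)] by simp
      have fin: "finite {y\<in>Y v c. y < j}" by simp
      have "{y\<in>Y v c. y < Suc j} = (if E v j \<and> G (lists 0 s) j c then insert j {y\<in>Y v c. y < j} else {y\<in>Y v c. y < j})"
        unfolding Y_def by (auto simp: less_Suc_eq)
      then have "card {y\<in>Y v c. y < Suc j} = card {y\<in>Y v c. y < j} + of_bool (E v j \<and> G (lists 0 s) j c)"
        using fin by simp
      then show "fst (set_reg rY (Suc j) (run inp (?body c) u)) rC = card {y\<in>Y v c. y < Suc j}"
        using inp gg u(2,5) by auto
    qed (simp_all add: t1_def)
    moreover have "{y\<in>Y v c. y < fst t1 rN} = Y v c" using tn E_less' by (auto simp: Y_def)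
    ultimately have cnt: "fst t2 rC = card (Y v c)" by simp
    have t2: "lists 0 t2 = lists 0 t" "fst t2 rV = v" "fst t2 rD = fst s rD"
      using a tn lists_cong[of t2 0 t] unfolding t2_def t1_def by (simp_all add: run_wregs run_warrs)
    have "run inp (?f c) t = (if th \<le> card (Y v c) then run inp (del rV c) t2 else t2)"
      using cnt thr[OF t2(3)] by (auto simp: t2_def t1_def)
    then have "lists 0 (run inp (?f c) t) = (lists 0 t)(v := if card (Y v c) < th then lists 0 t v else lists 0 t v - {c})"
      using lists_del[OF t2(2) a(1,2)] t2(1) by auto
    then show "lists 0 (run inp (?f c) t) = (lists 0 t)(v := if c \<in> lists 0 s v \<and> card (Y v c) < th
        then insert c (lists 0 t v) else lists 0 t v - {c})"
      using mem l0 by (auto simp: fun_eq_iff)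
  qed simp
  moreover have "run inp (filter_com g thr) s = run inp (vloop ?f) s1" by (simp add: filter_com_def s1_def)
  ultimately show ?thesis by (auto simp: fun_eq_iff Y_def lists_def)
qed

lemma support_iff: "c < 5 \<Longrightarrow> (\<exists>c'\<in>L. adj5 c c') \<longleftrightarrow> (c + 1) mod 5 \<in> L \<or> (c + 4) mod 5 \<in> L"
  unfolding adj5_iff by blast

text \<open>The colours not adjacent to \<open>c\<close> are those of \<open>tri c\<close>.\<close>

lemma not_subset_adj5_iff:
  assumes "c < 5" "L \<subseteq> {..<5}"
  shows "\<not> L \<subseteq> Collect (adj5 c) \<longleftrightarrow> c \<in> L \<or> (c + 2) mod 5 \<in> L \<or> (c + 3) mod 5 \<in> L"
proof -
  have "\<forall>c\<in>{0,1,2,3,4}. \<forall>x\<in>{0,1,2,3,4}. \<not> adj5 c x \<longleftrightarrow> x = c \<or> x = (c + 2) mod 5 \<or> x = (c + 3) mod 5"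
    by (simp add: adj5_iff)
  moreover have "x \<in> {0,1,2,3,4}" if "x < 5" for x :: nat using that by auto
  ultimately have "\<not> adj5 c x \<longleftrightarrow> x = c \<or> x = (c + 2) mod 5 \<or> x = (c + 3) mod 5" if "x < 5" for x
    using that assms(1) by blast
  then show ?thesis using assms(2) by blast
qed

lemma lists_ac:
  assumes n: "fst s rN = n" and b: "fst s rB = 5 * n + 1"
  shows "lists 0 (run inp ac_com s) = gac (lists 0 s)"
proof -
  let ?g = "\<lambda>c. Dif (Num 1) (Sum (Arr 1 (lit rY ((c + 1) mod 5))) (Arr 1 (lit rY ((c + 4) mod 5))))"
  have "lists 0 (run inp ac_com s) = (revise ^^ fst s rB) (lists 0 s)"
    unfolding ac_com_def
  proof (rule repeat_rule[where I = "\<lambda>i t. lists 0 t = (revise ^^ i) (lists 0 s)"])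
    fix i t
    assume fr: "\<And>x. x \<notin> wregs (filter_com ?g (Num 1)) \<Longrightarrow> fst t x = fst s x"
      and I: "lists 0 t = (revise ^^ i) (lists 0 s)"
    have tn: "fst t rN = n" using fr[of rN] n by simp
    have "lists 0 (run inp (filter_com ?g (Num 1)) t) =
        (\<lambda>v. {c \<in> lists 0 t v. card {y. E v y \<and> \<not> (\<exists>c'\<in>lists 0 t y. adj5 c c')} < 1})"
    proof (rule lists_filter[OF tn])
      fix c y :: nat and u :: state
      assume a: "c < 5" "y < n" "fst u rY = y"
      show "ev inp (?g c) u \<noteq> 0 \<longleftrightarrow> \<not> (\<exists>c'\<in>lists 1 u y. adj5 c c')"
        unfolding support_iff[OF a(1)] using a by (auto simp: mem_lists)
    qed simp
    also have "\<dots> = revise (lists 0 t)"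
      using finite_neighbours by (auto simp: revise_def fun_eq_iff)
    finally show "lists 0 (run inp (filter_com ?g (Num 1)) t) = (revise ^^ Suc i) (lists 0 s)"
      by (simp add: I)
  qed simp
  also have "\<dots> = gac (lists 0 s)"
    unfolding b by (rule revise_iterate[OF lists_less lists_empty])
  finally show ?thesis .
qed

lemma lists_prune:
  assumes n: "fst s rN = n"
  shows "lists 0 (run inp prune_com s) = prune (fst s rD) (lists 0 s)"
proof -
  have "lists 0 (run inp prune_com s) =
      (\<lambda>v. {c \<in> lists 0 s v. card {y. E v y \<and> \<not> lists 0 s y \<subseteq> Collect (adj5 c)} < fst s rD})"
    unfolding prune_com_def
  proof (rule lists_filter[OF n])
    fix c y :: nat and u :: state
    assume a: "c < 5" "y < n" "fst u rY = y"
    show "ev inp (Sum (Arr 1 (lit rY c)) (Sum (Arr 1 (lit rY ((c + 2) mod 5))) (Arr 1 (lit rY ((c + 3) mod 5))))) u \<noteq> 0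
      \<longleftrightarrow> \<not> lists 1 u y \<subseteq> Collect (adj5 c)"
      unfolding not_subset_adj5_iff[OF a(1) lists_less] using a by (simp add: mem_lists)
  qed simp
  then show ?thesis by (simp add: prune_def progress_def fun_eq_iff)
qed

lemma check_ok:
  assumes n: "fst s rN = n"
  shows "fst (run inp (check_com b) s) rOk = of_bool (\<forall>v<n. 1 \<le> card (lists 0 s v) \<and> card (lists 0 s v) \<le> b)"
proof -
  let ?cnt = "seqs (\<lambda>c. Cond (Arr 0 (lit rV c)) (incr rC) Nop) 5"
  let ?fin = "Cond (Reg rC) (Cond (Dif (Reg rC) (Num b)) (SetReg rOk (Num 0)) Nop) (SetReg rOk (Num 0))"
  let ?c = "SetReg rC (Num 0) ;; ?cnt ;; ?fin"
  let ?P = "\<lambda>v. 1 \<le> card (lists 0 s v) \<and> card (lists 0 s v) \<le> b"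
  let ?s = "set_reg rOk 1 s"
  have "fst (run inp (for_loop rV rN ?c) ?s) rOk = of_bool (\<forall>v<fst ?s rN. ?P v)"
  proof (rule for_rule[where I = "\<lambda>j t. fst t rOk = of_bool (\<forall>v<j. ?P v)"])
    fix v :: nat and t :: state
    assume v: "v < fst ?s rN" "fst t rV = v" and fa: "\<And>x. x \<notin> warrs ?c \<Longrightarrow> snd t x = snd ?s x"
      and I: "fst t rOk = of_bool (\<forall>w<v. ?P w)"
    have vn: "v < n" using v n by simp
    let ?t = "set_reg rC 0 t"
    have t0: "snd t 0 = snd s 0" using fa[of 0] by simp
    have "fst (run inp ?cnt ?t) rC = card {c \<in> lists 0 s v. c < 5}"
    proof (rule seqs_rule[where I = "\<lambda>k u. fst u rC = card {c \<in> lists 0 s v. c < k}"])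
      fix c :: nat and u :: state
      assume c: "c < 5" and fr: "\<And>x. x \<notin> wregs ?cnt \<Longrightarrow> fst u x = fst ?t x"
        and fa: "\<And>x. x \<notin> warrs ?cnt \<Longrightarrow> snd u x = snd ?t x"
        and u: "fst u rC = card {c' \<in> lists 0 s v. c' < c}"
      have uv: "fst u rV = v" using fr[of rV] v by simp
      have u0: "snd u 0 = snd s 0" using fa[of 0] t0 by simp
      have "snd u 0 (5 * v + c) \<noteq> 0 \<longleftrightarrow> c \<in> lists 0 s v" using vn c u0 by (simp add: mem_lists)
      moreover have "{c' \<in> lists 0 s v. c' < Suc c} =
          (if c \<in> lists 0 s v then insert c {c' \<in> lists 0 s v. c' < c} else {c' \<in> lists 0 s v. c' < c})"
        by (auto simp: less_Suc_eq)
      ultimately show "fst (run inp (Cond (Arr 0 (lit rV c)) (incr rC) Nop) u) rC = card {c' \<in> lists 0 s v. c' < Suc c}"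
        using u uv by auto
    qed simp
    moreover have "{c \<in> lists 0 s v. c < 5} = lists 0 s v" using lists_less by blast
    moreover have "fst (run inp ?cnt ?t) rOk = fst t rOk" by (simp add: run_wregs)
    ultimately have "fst (run inp ?c t) rOk = (if ?P v then fst t rOk else 0)"
      by auto
    then have "fst (run inp ?c t) rOk = of_bool ((\<forall>w<v. ?P w) \<and> ?P v)" using I by (simp del: run.simps)
    also have "(\<forall>w<v. ?P w) \<and> ?P v \<longleftrightarrow> (\<forall>w<Suc v. ?P w)" by (auto simp: less_Suc_eq)
    finally show "fst (set_reg rV (Suc v) (run inp ?c t)) rOk = of_bool (\<forall>w<Suc v. ?P w)"
      by (simp del: run.simps)
  qed simp_all
  then show ?thesis using n by (simp add: check_com_def)
qed

lemma lists_trial: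
  assumes n: "fst s rN = n" and b: "fst s rB = 5 * n + 1" and w: "fst s rW = w" "w < n" and c: "c < 5"
  shows "lists 0 (run inp (trial_com c) s) = trial w c (lists 0 s)"
proof -
  let ?r = "seqs (\<lambda>c'. if c' = c then Nop else del rW c') 5"
  let ?L = "lists 0 s"
  let ?M = "gac (?L(w := ?L w \<inter> {c}))"
  define s1 where "s1 = run inp (copy 2 0) s"
  define s2 where "s2 = run inp ?r s1"
  define s3 where "s3 = run inp ac_com s2"
  define s4 where "s4 = run inp (check_com 5) s3"
  have s1: "lists 2 s1 = ?L" "lists 0 s1 = ?L" "fst s1 rN = n" "fst s1 rB = 5 * n + 1" "fst s1 rW = w"
    unfolding s1_def using n b w lists_copy[OF n, of 2 0] lists_cong[of "run inp (copy 2 0) s" 0 s]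
    by (simp_all add: run_wregs run_warrs)
  have wr: "wregs ?r = {}" "warrs ?r \<subseteq> {0}" by (auto split: if_splits)
  have "lists 0 s2 = (\<lambda>v. {c' \<in> ?L v. v = w \<and> c' < 5 \<longrightarrow> c' = c})"
    unfolding s2_def
  proof (rule seqs_rule[where I = "\<lambda>k t. lists 0 t = (\<lambda>v. {c' \<in> ?L v. v = w \<and> c' < k \<longrightarrow> c' = c})"])
    fix k :: nat and t :: state
    assume k: "k < 5" and fr: "\<And>x. x \<notin> wregs ?r \<Longrightarrow> fst t x = fst s1 x"
      and I: "lists 0 t = (\<lambda>v. {c' \<in> ?L v. v = w \<and> c' < k \<longrightarrow> c' = c})"
    have "fst t rW = w" using fr[of rW] wr s1 by auto
    from lists_del[OF this w(2) k] show "lists 0 (run inp (if k = c then Nop else del rW k) t) =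
        (\<lambda>v. {c' \<in> ?L v. v = w \<and> c' < Suc k \<longrightarrow> c' = c})"
      by (auto simp: I fun_eq_iff less_Suc_eq)
  qed (simp add: s1)
  also have "\<dots> = ?L(w := ?L w \<inter> {c})" using lists_less by (fastforce simp: fun_eq_iff)
  finally have l2: "lists 0 s2 = ?L(w := ?L w \<inter> {c})" .
  have s2: "fst s2 rN = n" "fst s2 rB = 5 * n + 1" "snd s2 2 = snd s1 2"
    unfolding s2_def using wr s1 run_wregs[of _ ?r inp s1] run_warrs[of 2 ?r inp s1] by auto
  have l3: "lists 0 s3 = ?M" unfolding s3_def l2[symmetric] by (rule lists_ac[OF s2(1,2)])
  have s3: "fst s3 rN = n" "snd s3 2 = snd s1 2"
    unfolding s3_def using s2 by (simp_all add: run_wregs run_warrs)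
  have s4: "fst s4 rN = n" "snd s4 2 = snd s1 2" "snd s4 0 = snd s3 0"
    unfolding s4_def using s3 by (simp_all add: run_wregs run_warrs)
  \<comment> \<open>No list exceeds five colours, so the check reports exactly whether some list is
    empty.\<close>
  have "card (?M v) \<le> 5" for v using card_mono[OF finite_lessThan lists_less[of 0 s3 v]] l3 by simp
  moreover have "1 \<le> card (?M v) \<longleftrightarrow> ?M v \<noteq> {}" for v
    using finite_subset[OF lists_less[of 0 s3 v]] l3 by (simp add: card_gt_0_iff Suc_le_eq)
  ultimately have ok: "fst s4 rOk = of_bool (\<forall>v<n. ?M v \<noteq> {})"
    unfolding s4_def check_ok[OF s3(1)] l3 by simp
  have "lists 0 (run inp (copy 0 2) s4) = ?L"
    using lists_copy[OF s4(1), of 0 2] lists_cong[OF s4(2)] s1(1) by simp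
  moreover have "lists 0 s4 = ?M" using l3 lists_cong[OF s4(3)] by simp
  moreover have "run inp (trial_com c) s = run inp (Cond (Reg rOk) Nop (copy 0 2)) s4"
    by (simp add: trial_com_def s4_def s3_def s2_def s1_def)
  ultimately show ?thesis using ok by (auto simp: trial_def Let_def)
qed

lemma lists_greedy:
  assumes n: "fst s rN = n" and b: "fst s rB = 5 * n + 1"
  shows "lists 0 (run inp greedy_com s) = greedy n (lists 0 s)"
proof -
  have "lists 0 (run inp greedy_com s) = greedy (fst s rN) (lists 0 s)"
    unfolding greedy_com_def
  proof (rule for_rule[where I = "\<lambda>j t. lists 0 t = greedy j (lists 0 s)"])
    fix v :: nat and t :: state
    assume v: "v < fst s rN" "fst t rW = v"
      and fr: "\<And>x. x \<notin> wregs (seqs trial_com 5) \<Longrightarrow> x \<noteq> rW \<Longrightarrow> fst t x = fst s x"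
      and I: "lists 0 t = greedy v (lists 0 s)"
    have t: "fst t rN = n" "fst t rB = 5 * n + 1" "v < n" using fr[of rN] fr[of rB] n b v by simp_all
    have "lists 0 (run inp (seqs trial_com 5) t) = fold (trial v) [0..<5] (lists 0 t)"
    proof (rule seqs_rule[where I = "\<lambda>k u. lists 0 u = fold (trial v) [0..<k] (lists 0 t)"])
      fix c :: nat and u :: state
      assume c: "c < 5" and fr: "\<And>x. x \<notin> wregs (seqs trial_com 5) \<Longrightarrow> fst u x = fst t x"
        and I: "lists 0 u = fold (trial v) [0..<c] (lists 0 t)"
      have "fst u rN = n" "fst u rB = 5 * n + 1" "fst u rW = v" using fr[of rN] fr[of rB] fr[of rW] t v by simp_all
      from lists_trial[OF this t(3) c] show "lists 0 (run inp (trial_com c) u) = fold (trial v) [0..<Suc c] (lists 0 t)"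
        by (simp add: I)
    qed simp
    then show "lists 0 (set_reg rW (Suc v) (run inp (seqs trial_com 5) t)) = greedy (Suc v) (lists 0 s)"
      by (simp only: lists_set_reg greedy.simps I)
  qed simp_all
  then show ?thesis using n by simp
qed

lemma lists_init:
  assumes n: "fst s rN = n" and l: "fst s rL = 1 + n * n"
  shows "lists 0 (run inp init_com s) = L0"
proof -
  have "lists 0 (run inp init_com s) = (\<lambda>v. {c. v < n \<and> c < 5 \<and> c \<in> L0 v})"
    unfolding init_com_def
  proof (rule vloop_rule[OF n])
    fix v c :: nat and t :: state
    assume a: "v < n" "c < 5" "fst t rV = v"
      and fr: "\<And>x. x \<notin> wregs (vloop (\<lambda>c. SetArr 0 (lit 9 c) (Inp (Sum (Reg 15) (lit 9 c))))) \<Longrightarrow> fst t x = fst s x"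
    have "fst t rL = 1 + n * n" using fr[of rL] l by simp
    then show "lists 0 (run inp (SetArr 0 (lit 9 c) (Inp (Sum (Reg 15) (lit 9 c)))) t) =
      (lists 0 t)(v := if c \<in> L0 v then insert c (lists 0 t v) else lists 0 t v - {c})"
      using a inp_list[OF a(1,2)] by (simp add: lists_set_arr)
  qed simp
  also have "\<dots> = L0"
  proof
    fix v
    show "{c. v < n \<and> c < 5 \<and> c \<in> L0 v} = L0 v" using L0(1)[of v] L0(2)[of v] by (cases "v < n") auto
  qed
  finally show ?thesis .
qed

lemma digit_entry_iff:
  "c < 5 \<Longrightarrow> g div 5 = v \<and> g mod 5 \<noteq> c \<longleftrightarrow> g \<noteq> 5 * v + c \<and> 5 * v \<le> g \<and> g < 5 * v + (5::nat)"
proof -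
  assume c: "c < 5"
  define q r where "q = g div 5" and "r = g mod 5"
  have g: "g = 5 * q + r" "r < 5" unfolding q_def r_def by simp_all
  show ?thesis unfolding q_def[symmetric] r_def[symmetric] using c g by auto
qed

text \<open>Each round subtracts unless the remainder is already below the base. Otherwise the
  quotient would reach \<open>fst s rM\<close>, which exceeds the dividend.\<close>

lemma run_divide:
  assumes B: "fst s rB \<ge> 1" and M: "fst s rKK < fst s rM" and Q: "fst s rQ = 0"
  defines "t \<equiv> run inp (Repeat rM (Cond (Dif (Sum (Reg rKK) (Num 1)) (Reg rB))
    (SetReg rKK (Dif (Reg rKK) (Reg rB)) ;; incr rQ) Nop)) s"
  shows "fst t rKK = fst s rKK mod fst s rB" "fst t rQ = fst s rKK div fst s rB"
proof -
  let ?x = "fst s rKK" and ?B = "fst s rB"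
  let ?c = "Cond (Dif (Sum (Reg rKK) (Num 1)) (Reg rB)) (SetReg rKK (Dif (Reg rKK) (Reg rB)) ;; incr rQ) Nop"
  let ?I = "\<lambda>i t. fst t rKK + ?B * fst t rQ = ?x \<and> (fst t rKK < ?B \<or> fst t rQ = i)"
  have I: "?I (fst s rM) t"
    unfolding t_def
  proof (rule repeat_rule)
    show "?I 0 s" using Q by simp
  next
    fix i :: nat and u :: state
    assume fr: "\<And>x. x \<notin> wregs ?c \<Longrightarrow> fst u x = fst s x" and I: "?I i u"
    have uB: "fst u rB = ?B" using fr[of rB] by simp
    show "?I (Suc i) (run inp ?c u)"
    proof (cases "?B \<le> fst u rKK")
      case True
      then have "fst (run inp ?c u) rKK = fst u rKK - ?B" "fst (run inp ?c u) rQ = Suc (fst u rQ)"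
        using uB by simp_all
      moreover have "fst u rKK - ?B + ?B * Suc (fst u rQ) = fst u rKK + ?B * fst u rQ" using True by simp
      ultimately show ?thesis using I True by (auto simp del: run.simps)
    next
      case False
      then have "run inp ?c u = u" using uB by simp
      then show ?thesis using I False by simp
    qed
  qed
  have "fst t rKK < ?B"
  proof (rule ccontr)
    assume "\<not> ?thesis"
    then have "?B * fst s rM \<le> ?x" using I by auto
    moreover have "1 * fst s rM \<le> ?B * fst s rM" using B by (intro mult_right_mono) auto
    ultimately show False using M by simp
  qed
  then have "(fst t rKK + ?B * fst t rQ) mod ?B = fst t rKK" "(fst t rKK + ?B * fst t rQ) div ?B = fst t rQ"
    by simp_all
  moreover have "fst t rKK + ?B * fst t rQ = ?x" using I by simp
  ultimately show "fst t rKK = ?x mod ?B" "fst t rQ = ?x div ?B" by simp_all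
qed

lemma digits_run:
  assumes n: "fst s rN = n" and B: "fst s rB = B" "B \<ge> 1" and k: "fst s rKK = k" "k < fst s rM"
    and m: "fst s rS = m"
  shows "lists 0 (run inp digits_com s) = digit_filter B m k (lists 0 s) \<and>
    fst (run inp digits_com s) rKK = k div B ^ m"
proof -
  let ?div = "Repeat rM (Cond (Dif (Sum (Reg rKK) (Num 1)) (Reg rB)) (SetReg rKK (Dif (Reg rKK) (Reg rB)) ;; incr rQ) Nop)"
  let ?f = "\<lambda>c. Cond (Sum (Dif (lit rV c) (Reg rKK)) (Dif (Reg rKK) (lit rV c)))
       (Cond (Dif (Sum (Reg rKK) (Num 1)) (lit rV 0)) (Cond (Dif (lit rV 5) (Reg rKK)) (del rV c) Nop) Nop) Nop"
  let ?c = "SetReg rQ (Num 0) ;; ?div ;; vloop ?f ;; SetReg rKK (Reg rQ)"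
  let ?I = "\<lambda>i t. lists 0 t = digit_filter B i k (lists 0 s) \<and> fst t rKK = k div B ^ i"
  have "?I (fst s rS) (run inp (Repeat rS ?c) s)"
  proof (rule repeat_rule[where I = ?I])
    show "?I 0 s" using k by (simp add: digit_filter_def fun_eq_iff)
  next
    fix i :: nat and t :: state
    assume fr: "\<And>x. x \<notin> wregs ?c \<Longrightarrow> fst t x = fst s x" and I: "?I i t"
    let ?x = "k div B ^ i"
    define t1 where "t1 = run inp ?div (set_reg rQ 0 t)"
    define t2 where "t2 = run inp (vloop ?f) t1"
    have tr: "fst t rN = n" "fst t rB = B" "fst t rM = fst s rM"
      using fr[of rN] fr[of rB] fr[of rM] n B by simp_all
    have "?x \<le> k" by simp
    then have "?x < fst s rM" using k(2) by linarith
    then have t1: "fst t1 rKK = ?x mod B" "fst t1 rQ = ?x div B"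
      using run_divide[of "set_reg rQ 0 t"] I tr B(2) unfolding t1_def by simp_all
    have t1n: "fst t1 rN = n" unfolding t1_def using tr by (subst run_wregs) simp_all
    have t1l: "lists 0 t1 = lists 0 t"
    proof -
      have "snd t1 0 = snd t 0" unfolding t1_def by (subst run_warrs) simp_all
      then show ?thesis by (rule lists_cong)
    qed
    let ?g = "?x mod B"
    have "lists 0 t2 = (\<lambda>v. {c. v < n \<and> c < 5 \<and> c \<in> lists 0 t v \<and> (?g div 5 = v \<longrightarrow> ?g mod 5 = c)})"
      unfolding t2_def
    proof (rule vloop_rule[OF t1n])
      fix v c :: nat and u :: state
      assume a: "v < n" "c < 5" "fst u rV = v"
        and fr: "\<And>x. x \<notin> wregs (vloop ?f) \<Longrightarrow> fst u x = fst t1 x"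
        and mem: "c \<in> lists 0 u v \<longleftrightarrow> c \<in> lists 0 t1 v"
      have u: "fst u rKK = ?g" using fr[of rKK] t1 by simp
      have g: "?g div 5 = v \<and> ?g mod 5 \<noteq> c \<longleftrightarrow> ?g \<noteq> 5 * v + c \<and> 5 * v \<le> ?g \<and> ?g < 5 * v + 5"
        using a(2) by (rule digit_entry_iff)
      have "run inp (?f c) u = (if ?g \<noteq> 5 * v + c \<and> 5 * v \<le> ?g \<and> ?g < 5 * v + 5 then run inp (del rV c) u else u)"
        using u a by auto
      then have "run inp (?f c) u = (if ?g div 5 = v \<and> ?g mod 5 \<noteq> c then run inp (del rV c) u else u)"
        unfolding g .
      then show "lists 0 (run inp (?f c) u) = (lists 0 u)(v := if c \<in> lists 0 t v \<and> (?g div 5 = v \<longrightarrow> ?g mod 5 = c)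
          then insert c (lists 0 u v) else lists 0 u v - {c})"
        using lists_del[OF a(3,1,2)] mem unfolding t1l by (auto simp: fun_eq_iff)
    qed simp
    also have "\<dots> = digit_filter B (Suc i) k (lists 0 s)"
    proof
      fix v
      show "{c. v < n \<and> c < 5 \<and> c \<in> lists 0 t v \<and> (?g div 5 = v \<longrightarrow> ?g mod 5 = c)} = digit_filter B (Suc i) k (lists 0 s) v"
        using I lists_less[of 0 t v] lists_empty[of v 0 t]
        by (cases "v < n") (auto simp: digit_filter_def less_Suc_eq)
    qed
    finally have "lists 0 t2 = digit_filter B (Suc i) k (lists 0 s)" .
    moreover have "fst t2 rQ = ?x div B" unfolding t2_def using t1 by (simp add: run_wregs)
    then have "fst t2 rQ = k div B ^ Suc i" by (simp add: div_mult2_eq[symmetric] mult.commute)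
    moreover have "run inp ?c t = set_reg rKK (fst t2 rQ) t2" by (simp add: t2_def t1_def)
    ultimately show "?I (Suc i) (run inp ?c t)" by simp
  qed
  then show ?thesis using m by (simp add: digits_com_def)
qed

lemma guess_run:
  assumes n: "fst s rN = n" and B: "fst s rB = 5 * n + 1" and k: "fst s rK = k" "k < fst s rM"
    and m: "fst s rS = m" and d: "fst s rD = d" and l: "fst s rL = 1 + n * n"
  shows "fst (run inp guess_com s) rOk = of_bool (\<forall>v<n. card (guess d m L0 k v) = 1)"
proof -
  define s0 where "s0 = set_reg rKK k s"
  define s1 where "s1 = run inp init_com s0"
  define s2 where "s2 = run inp digits_com s1"
  define s3 where "s3 = run inp ac_com s2"
  define s4 where "s4 = run inp prune_com s3"
  define s5 where "s5 = run inp ac_com s4"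
  define s6 where "s6 = run inp digits_com s5"
  define s7 where "s7 = run inp ac_com s6"
  define s8 where "s8 = run inp greedy_com s7"
  note defs = s0_def s1_def s2_def s3_def s4_def s5_def s6_def s7_def s8_def
  let ?B = "5 * n + 1"
  have N: "fst s0 rN = n" "fst s1 rN = n" "fst s2 rN = n" "fst s3 rN = n" "fst s4 rN = n" "fst s5 rN = n"
      "fst s6 rN = n" "fst s7 rN = n" "fst s8 rN = n"
    unfolding defs using n by (simp_all add: run_wregs)
  have BB: "fst s1 rB = ?B" "fst s2 rB = ?B" "fst s4 rB = ?B" "fst s5 rB = ?B" "fst s6 rB = ?B" "fst s7 rB = ?B"
    unfolding defs using B by (simp_all add: run_wregs)
  have R: "fst s0 rL = 1 + n * n" "fst s1 rKK = k" "fst s1 rM = fst s rM" "fst s1 rS = m" "fst s3 rD = d"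
      "fst s5 rM = fst s rM" "fst s5 rS = m"
    unfolding defs using l m d by (simp_all add: run_wregs)
  have l1: "lists 0 s1 = L0" unfolding s1_def using lists_init N(1) R(1) by simp
  have s2: "lists 0 s2 = digit_filter ?B m k L0" "fst s2 rKK = k div ?B ^ m"
    using digits_run[OF N(2) BB(1) _ R(2) _ R(4)] k(2) R(3) l1 unfolding s2_def by simp_all
  have "lists 0 s3 = gac (digit_filter ?B m k L0)"
    unfolding s3_def lists_ac[OF N(3) BB(2)] s2(1) ..
  moreover have "lists 0 s4 = prune d (lists 0 s3)"
    unfolding s4_def lists_prune[OF N(4)] R(5) ..
  moreover have "lists 0 s5 = gac (lists 0 s4)"
    unfolding s5_def lists_ac[OF N(5) BB(3)] ..
  ultimately have l5: "lists 0 s5 = gac (prune d (gac (digit_filter ?B m k L0)))" by simp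
  \<comment> \<open>The first run of \<open>digits_com\<close> left the high digits in
    \<open>rKK\<close>, and no program in between writes to it.\<close>
  have "fst s5 rKK = k div ?B ^ m"
    using s2(2) unfolding s5_def s4_def s3_def by (simp add: run_wregs)
  moreover have "k div ?B ^ m < fst s rM" using k(2) by (meson div_le_dividend le_less_trans)
  ultimately have "lists 0 s6 = digit_filter ?B m (k div ?B ^ m) (lists 0 s5)"
    using digits_run[OF N(6) BB(4) _ _ _ R(7)] R(6) unfolding s6_def by simp
  moreover have "lists 0 s7 = gac (lists 0 s6)"
    unfolding s7_def lists_ac[OF N(7) BB(5)] ..
  moreover have "lists 0 s8 = greedy n (lists 0 s7)"
    unfolding s8_def lists_greedy[OF N(8) BB(6)] ..
  ultimately have "lists 0 s8 = guess d m L0 k" by (simp add: guess_def l5)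
  moreover have one: "1 \<le> x \<and> x \<le> 1 \<longleftrightarrow> x = 1" for x :: nat by auto
  ultimately have "fst (run inp (check_com 1) s8) rOk = of_bool (\<forall>v<n. card (guess d m L0 k v) = 1)"
    unfolding check_ok[OF N(9)] one by simp
  moreover have "run inp guess_com s = run inp (check_com 1) s8" using k by (simp add: guess_com_def defs)
  ultimately show ?thesis by simp
qed

lemma search_run:
  assumes n: "fst s rN = n" and B: "fst s rB = 5 * n + 1"
    and m: "fst s rS = m" and d: "fst s rD = d" and l: "fst s rL = 1 + n * n"
  shows "fst (run inp search_com s) rAns = of_bool (\<exists>k<fst s rM. \<forall>v<n. card (guess d m L0 k v) = 1)"
proof -
  let ?s = "set_reg rAns 0 s"
  let ?P = "\<lambda>k. \<forall>v<n. card (guess d m L0 k v) = 1"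
  have "fst (run inp (for_loop rK rM try_com) ?s) rAns = of_bool (\<exists>k<fst ?s rM. ?P k)"
  proof (rule for_rule[where I = "\<lambda>j t. fst t rAns = of_bool (\<exists>k<j. ?P k)"])
    fix k :: nat and t :: state
    assume k: "k < fst ?s rM" "fst t rK = k"
      and fr: "\<And>x. x \<notin> wregs try_com \<Longrightarrow> x \<noteq> rK \<Longrightarrow> fst t x = fst ?s x"
      and I: "fst t rAns = of_bool (\<exists>j<k. ?P j)"
    have "fst t rN = n" "fst t rB = 5 * n + 1" "fst t rS = m" "fst t rD = d" "fst t rL = 1 + n * n" "fst t rM = fst s rM"
      using fr[of rN] fr[of rB] fr[of rS] fr[of rD] fr[of rL] fr[of rM] n B m d l by simp_all
    then have "fst (run inp guess_com t) rOk = of_bool (?P k)"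
      using k by (intro guess_run) simp_all
    then have "fst (run inp try_com t) rAns = (if ?P k then 1 else fst t rAns)"
      by (auto simp: try_com_def run_wregs)
    also have "\<dots> = of_bool (\<exists>j<Suc k. ?P j)" using I by (auto simp: less_Suc_eq)
    finally show "fst (set_reg rK (Suc k) (run inp try_com t)) rAns = of_bool (\<exists>j<Suc k. ?P j)" by simp
  qed simp_all
  then show ?thesis by (simp add: search_com_def)
qed

end

section \<open>The complete machine program\<close>

definition root4 :: "nat \<Rightarrow> nat" where
  "root4 n = (LEAST d. n \<le> d ^ 4)"

lemma root4_eqI: "n \<le> x ^ 4 \<Longrightarrow> x = 0 \<or> (x - 1) ^ 4 < n \<Longrightarrow> root4 n = x"
  unfolding root4_def
proof (rule Least_equality)
  fix y
  assume a: "n \<le> x ^ 4" "x = 0 \<or> (x - 1) ^ 4 < n" "n \<le> y ^ 4"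
  show "x \<le> y"
  proof (rule ccontr)
    assume "\<not> x \<le> y"
    then have "y \<le> x - 1" "x \<noteq> 0" by auto
    then have "y ^ 4 \<le> (x - 1) ^ 4" "(x - 1) ^ 4 < n" using a(2) by (auto intro: power_mono)
    then show False using a(3) by linarith
  qed
qed

lemma le_power4: "n \<le> n ^ 4" for n :: nat
  by (cases "n = 0") (auto intro: self_le_power)

lemma le_root4_power: "n \<le> root4 n ^ 4"
  unfolding root4_def by (rule LeastI) (rule le_power4)

primrec times :: "nat \<Rightarrow> aexp \<Rightarrow> aexp" where
  "times 0 e = Num 0"
| "times (Suc k) e = Sum e (times k e)"

lemma ev_times [simp]: "ev inp (times k e) s = k * ev inp e s"
  by (induction k) simp_all

lemma wf_times [simp]: "wf_exp e \<Longrightarrow> wf_exp (times k e)"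
  by (induction k) simp_all

text \<open>Registers 16 to 18 hold the square, cube and fourth power of the register \<open>rD\<close>.\<close>

definition step_com :: com where
  "step_com = SetReg rL (Sum (Reg rL) (Reg rN)) ;; Cond (Dif (Reg rN) (Reg 18))
     (SetReg 18 (Sum (Reg 18) (Sum (times 4 (Reg 17)) (Sum (times 6 (Reg 16)) (Sum (times 4 (Reg rD)) (Num 1))))) ;;
      SetReg 17 (Sum (Reg 17) (Sum (times 3 (Reg 16)) (Sum (times 3 (Reg rD)) (Num 1)))) ;;
      SetReg 16 (Sum (Reg 16) (Sum (times 2 (Reg rD)) (Num 1))) ;;
      incr rD) Nop"

definition setup1_com :: com where
  "setup1_com = SetReg rD (Num 0) ;; SetReg 16 (Num 0) ;; SetReg 17 (Num 0) ;; SetReg 18 (Num 0) ;;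
     SetReg rL (Num 1) ;; Repeat rN step_com ;;
     SetReg rS (times 27 (Reg 17)) ;; SetReg rB (Sum (times 5 (Reg rN)) (Num 1))"

definition mult_com :: com where
  "mult_com = SetReg 19 (Num 0) ;; Repeat rB (SetReg 19 (Sum (Reg 19) (Reg rM))) ;; SetReg rM (Reg 19)"

text \<open>Two multiplications per guess, because a candidate codes two rounds of \<open>rS\<close>
  guesses.\<close>

definition setup2_com :: com where
  "setup2_com = SetReg rM (Num 1) ;; Repeat rS (mult_com ;; mult_com)"

lemma regs_step [simp]: "wregs step_com = {rL, rD, 16, 17, 18}" "loop_regs step_com = {}"
  by (auto simp: step_com_def)

lemma regs_setup1: "wregs setup1_com = {rL, rD, rS, rB, 16, 17, 18}" "loop_regs setup1_com = {rN}"
  by (auto simp: setup1_com_def)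

lemma regs_mult [simp]: "wregs mult_com = {19, rM}" "loop_regs mult_com = {rB}"
  by (auto simp: mult_com_def)

lemma regs_setup2: "wregs setup2_com = {19, rM}" "loop_regs setup2_com = {rS, rB}"
  by (auto simp: setup2_com_def)

lemma wf_setup1: "wf_com 0 setup1_com"
  by (simp add: setup1_com_def step_com_def incr_def)

lemma wf_setup2: "wf_com 0 setup2_com"
  by (simp add: setup2_com_def mult_com_def)

text \<open>Binomial expansion updates the powers of \<open>rD\<close> by additions only. Since
  \<open>n \<le> n ^ 4\<close>, at most \<open>n\<close> rounds are needed to reach the root, and
  the same loop sums up \<open>n * n\<close> in \<open>rL\<close>.\<close>

lemma setup1_run:
  fixes inp :: mem
  assumes n: "fst s rN = n"
  defines "t \<equiv> run inp setup1_com s"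
  shows "fst t rD = root4 n" "fst t rS = 27 * root4 n ^ 3" "fst t rB = 5 * n + 1" "fst t rL = 1 + n * n"
proof -
  define s1 where "s1 = set_reg rL 1 (set_reg 18 0 (set_reg 17 0 (set_reg 16 0 (set_reg rD 0 s))))"
  define s2 where "s2 = run inp (Repeat rN step_com) s1"
  let ?I = "\<lambda>i t. fst t 16 = fst t rD ^ 2 \<and> fst t 17 = fst t rD ^ 3 \<and> fst t 18 = fst t rD ^ 4 \<and>
    (fst t rD = i \<or> n \<le> fst t rD ^ 4) \<and> (fst t rD = 0 \<or> (fst t rD - 1) ^ 4 < n) \<and> fst t rL = 1 + i * n"
  have I: "?I (fst s1 rN) s2"
    unfolding s2_def
  proof (rule repeat_rule)
    show "?I 0 s1" by (simp add: s1_def)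
  next
    fix i :: nat and t :: state
    assume fr: "\<And>x. x \<notin> wregs step_com \<Longrightarrow> fst t x = fst s1 x" and I: "?I i t"
    have tn: "fst t rN = n" using fr[of rN] n by (simp add: s1_def)
    have L: "fst (run inp step_com t) rL = 1 + Suc i * n" using I tn by (simp add: step_com_def)
    show "?I (Suc i) (run inp step_com t)"
    proof (cases "n \<le> fst t rD ^ 4")
      case True
      then have "run inp step_com t = set_reg rL (fst t rL + n) t" using tn I by (simp add: step_com_def)
      then show ?thesis using I True by simp
    next
      case False
      define x where "x = fst t rD"
      have "fst (run inp step_com t) rD = Suc x" "fst (run inp step_com t) 16 = x ^ 2 + (2 * x + 1)"
        "fst (run inp step_com t) 17 = x ^ 3 + (3 * x ^ 2 + (3 * x + 1))"
        "fst (run inp step_com t) 18 = x ^ 4 + (4 * x ^ 3 + (6 * x ^ 2 + (4 * x + 1)))"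
        using I False tn by (simp_all add: step_com_def x_def)
      moreover have "x ^ 2 + (2 * x + 1) = Suc x ^ 2" "x ^ 3 + (3 * x ^ 2 + (3 * x + 1)) = Suc x ^ 3"
        "x ^ 4 + (4 * x ^ 3 + (6 * x ^ 2 + (4 * x + 1))) = Suc x ^ 4"
        by (simp_all add: eval_nat_numeral algebra_simps)
      moreover have "x = i" "x ^ 4 < n" using I False unfolding x_def by auto
      ultimately show ?thesis using L by simp
    qed
  qed
  have s1n: "fst s1 rN = n" using n by (simp add: s1_def)
  have "n \<le> fst s2 rD ^ 4" using I s1n le_power4[of n] by auto
  then have d: "root4 n = fst s2 rD" using I by (intro root4_eqI) auto
  have s2n: "fst s2 rN = n" unfolding s2_def using s1n by (subst run_wregs) simp_all
  have t: "t = set_reg rB (5 * fst s2 rN + 1) (set_reg rS (27 * fst s2 17) s2)"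
    unfolding t_def s2_def s1_def by (simp add: setup1_com_def)
  show "fst t rD = root4 n" "fst t rS = 27 * root4 n ^ 3" "fst t rB = 5 * n + 1" "fst t rL = 1 + n * n"
    unfolding t d using I s2n s1n by simp_all
qed

lemma mult_run: "fst (run inp mult_com s) rM = fst s rB * fst s rM"
proof -
  let ?s = "set_reg 19 0 s" and ?c = "SetReg 19 (Sum (Reg 19) (Reg rM))"
  have "fst (run inp (Repeat rB ?c) ?s) 19 = fst ?s rB * fst s rM"
  proof (rule repeat_rule[where I = "\<lambda>i t. fst t 19 = i * fst s rM"])
    fix i :: nat and t :: state
    assume fr: "\<And>x. x \<notin> wregs ?c \<Longrightarrow> fst t x = fst ?s x" and I: "fst t 19 = i * fst s rM"
    have "fst t rM = fst s rM" using fr[of rM] by simp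
    then show "fst (run inp ?c t) 19 = Suc i * fst s rM" using I by simp
  qed simp
  then show ?thesis by (simp add: mult_com_def)
qed

lemma setup2_run: "fst (run inp setup2_com s) rM = fst s rB ^ (2 * fst s rS)"
proof -
  let ?s = "set_reg rM 1 s"
  have "fst (run inp (Repeat rS (mult_com ;; mult_com)) ?s) rM = fst s rB ^ (2 * fst ?s rS)"
  proof (rule repeat_rule[where I = "\<lambda>i t. fst t rM = fst s rB ^ (2 * i)"])
    fix i :: nat and t :: state
    assume fr: "\<And>x. x \<notin> wregs (mult_com ;; mult_com) \<Longrightarrow> fst t x = fst ?s x" and I: "fst t rM = fst s rB ^ (2 * i)"
    have "fst t rB = fst s rB" using fr[of rB] by simp
    then show "fst (run inp (mult_com ;; mult_com) t) rM = fst s rB ^ (2 * Suc i)"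
      using I by (simp add: mult_run run_wregs)
  qed simp
  then show ?thesis by (simp add: setup2_com_def)
qed

text \<open>
  The size of the input is not linear in \<open>n\<close>, so before anything can be stored the address of a free
  region must be found using the cells 0 and 1 only: cell 1 (the diagonal entry of vertex 0, hence zero)
  accumulates \<open>2 + n\<^sup>2 + 8 * n\<close> while cell 0 counts down, and \<open>n\<close> is recovered from the sum.
\<close>

definition sum_loop :: prog where
  "sum_loop = While (Load (Const 0))
    (Seq (Store (Const 1) (Add (Load (Const 1)) (Add (Load (Const 0)) (Add (Load (Const 0)) (Const 7)))))
         (Store (Const 0) (Sub (Load (Const 0)) (Const 1))))"

definition root_loop :: prog where
  "root_loop = While (Sub (Sub (Load (Const 0)) (Const 2)) (Load (reg_addr 19)))
    (Seq (Store (reg_addr 0) (Add (Load (reg_addr 0)) (Const 1)))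
         (Store (reg_addr 19) (Add (Load (reg_addr 19)) (Add (Load (reg_addr 0)) (Add (Load (reg_addr 0)) (Const 7))))))"

definition prelude :: prog where
  "prelude = Seq (Store (Const 1) (Const 2)) (Seq sum_loop
     (Seq (Store (Const 0) (Load (Const 1))) (Seq (Store (Const 1) (Const 0)) root_loop)))"

section \<open>Execution of the prelude\<close>

lemma exec_cong: "exec p m t m' \<Longrightarrow> t' = t \<Longrightarrow> m'' = m' \<Longrightarrow> exec p m t' m''"
  by simp

text \<open>The increments \<open>2 * j + 7\<close> for \<open>j\<close> from 1 to \<open>x\<close>
  add up to \<open>x * x + 8 * x\<close>.\<close>

lemma exec_sum_loop:
  "m 0 = x \<Longrightarrow> exec sum_loop m (21 * x + 3) (m(0 := 0, 1 := m 1 + (x * x + 8 * x)))"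
proof (induction x arbitrary: m)
  case 0
  show ?case unfolding sum_loop_def
    by (rule exec_cong[OF exec.WhileFalse]) (use 0 in \<open>auto simp: fun_eq_iff\<close>)
next
  case (Suc x)
  let ?a = "Store (Const 1) (Add (Load (Const 1)) (Add (Load (Const 0)) (Add (Load (Const 0)) (Const 7))))"
  let ?b = "Store (Const 0) (Sub (Load (Const 0)) (Const 1))"
  let ?m1 = "m(1 := m 1 + (Suc x + (Suc x + 7)))"
  let ?m2 = "?m1(0 := x)"
  have a: "exec ?a m 12 ?m1"
    by (rule exec_cong[OF exec.Store]) (simp_all add: Suc.prems)
  have b: "exec ?b ?m1 6 ?m2"
    by (rule exec_cong[OF exec.Store]) (simp_all add: Suc.prems)
  have "exec sum_loop ?m2 (21 * x + 3) (?m2(0 := 0, 1 := ?m2 1 + (x * x + 8 * x)))"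
    by (rule Suc.IH) simp
  moreover have "?m2(0 := 0, 1 := ?m2 1 + (x * x + 8 * x)) = m(0 := 0, 1 := m 1 + (Suc x * Suc x + 8 * Suc x))"
    by (auto simp: fun_eq_iff)
  ultimately have c: "exec sum_loop ?m2 (21 * x + 3) (m(0 := 0, 1 := m 1 + (Suc x * Suc x + 8 * Suc x)))" by simp
  have "eval_expr (Load (Const 0)) m \<noteq> 0" using Suc.prems by simp
  from exec.WhileTrue[OF this exec.Seq[OF a b], folded sum_loop_def, OF c]
  show ?case by (rule exec_cong) (auto simp: fun_eq_iff)
qed

text \<open>The function \<open>i * i + 8 * i\<close>, kept in register 19, is strictly increasing,
  so the loop stops exactly when register 0 reaches \<open>n\<close>.\<close>

lemma exec_root_loop:
  assumes "m 0 = F" "F = 2 + (n * n + 8 * n)" "m F = i" "m (F + 19) = i * i + 8 * i" "i + x = n"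
  shows "exec root_loop m (47 * x + 11) (m(F := n, F + 19 := n * n + 8 * n))"
  using assms(1,3-)
proof (induction x arbitrary: i m)
  case 0
  let ?e = "Sub (Sub (Load (Const 0)) (Const 2)) (Load (reg_addr 19))"
  have "m(F := n, F + 19 := n * n + 8 * n) = m" using 0 by (auto simp: fun_eq_iff)
  moreover have "eval_expr ?e m = 0" using 0 assms(2) by (simp add: reg_addr_def)
  moreover have "47 * 0 + 11 = expr_cost ?e + 1" by (simp add: reg_addr_def)
  ultimately show ?case unfolding root_loop_def
    using exec_cong[OF exec.WhileFalse[of ?e m]] by metis
next
  case (Suc x)
  let ?e = "Sub (Sub (Load (Const 0)) (Const 2)) (Load (reg_addr 19))"
  let ?a = "Store (reg_addr 0) (Add (Load (reg_addr 0)) (Const 1))"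
  let ?f = "Add (Load (reg_addr 19)) (Add (Load (reg_addr 0)) (Add (Load (reg_addr 0)) (Const 7)))"
  let ?b = "Store (reg_addr 19) ?f"
  let ?m1 = "m(F := Suc i)"
  let ?m2 = "?m1(F + 19 := Suc i * Suc i + 8 * Suc i)"
  have F: "F \<ge> 2" using assms(2) by simp
  have a: "exec ?a m 12 ?m1"
    by (rule exec_cong[OF exec.Store]) (simp_all add: reg_addr_def Suc.prems)
  have m1: "?m1 0 = F" "?m1 F = Suc i" "?m1 (F + 19) = i * i + 8 * i" using Suc.prems F by auto
  have "eval_expr ?f ?m1 = Suc i * Suc i + 8 * Suc i" using m1 by (simp add: reg_addr_def del: fun_upd_apply)
  moreover have "eval_expr (reg_addr 19) ?m1 = F + 19" using m1 by (simp add: reg_addr_def del: fun_upd_apply)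
  moreover have "expr_cost (reg_addr 19) + expr_cost ?f + 1 = 24" by (simp add: reg_addr_def)
  ultimately have b: "exec ?b ?m1 24 ?m2" using exec.Store[of "reg_addr 19" ?f ?m1] by (simp only:)
  have "exec root_loop ?m2 (47 * x + 11) (?m2(F := n, F + 19 := n * n + 8 * n))"
    by (rule Suc.IH) (use Suc.prems F in auto)
  moreover have "?m2(F := n, F + 19 := n * n + 8 * n) = m(F := n, F + 19 := n * n + 8 * n)" by (auto simp: fun_eq_iff)
  ultimately have c: "exec root_loop ?m2 (47 * x + 11) (m(F := n, F + 19 := n * n + 8 * n))" by simp
  have "i < n" using Suc.prems by simp
  then have "i * i + 8 * i < n * n + 8 * n" by (intro add_less_le_mono mult_strict_mono) auto
  then have "eval_expr ?e m \<noteq> 0" using Suc.prems assms(2) by (simp add: reg_addr_def)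
  from exec.WhileTrue[OF this exec.Seq[OF a b], folded root_loop_def, OF c]
  show ?case by (rule exec_cong) (simp_all add: reg_addr_def del: fun_upd_apply)
qed

lemma exec_prelude:
  assumes "m 0 = n" "m 1 = 0" "\<And>i. i > n * n + 8 * n \<Longrightarrow> m i = 0"
  defines "F \<equiv> 2 + (n * n + 8 * n)"
  shows "exec prelude m (68 * n + 24) (m(0 := F, F := n, F + 19 := n * n + 8 * n))"
proof -
  let ?m1 = "m(1 := 2)"
  let ?m2 = "?m1(0 := 0, 1 := ?m1 1 + (n * n + 8 * n))"
  let ?m3 = "m(0 := F, 1 := F)"
  let ?m4 = "m(0 := F)"
  have 1: "exec (Store (Const 1) (Const 2)) m 3 ?m1"
    by (rule exec_cong[OF exec.Store]) simp_all
  have 2: "exec sum_loop ?m1 (21 * n + 3) ?m2" by (rule exec_sum_loop) (use assms(1) in simp)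
  have "?m2(0 := eval_expr (Load (Const 1)) ?m2) = ?m3" by (auto simp: F_def fun_eq_iff)
  then have 3: "exec (Store (Const 0) (Load (Const 1))) ?m2 4 ?m3"
    by (intro exec_cong[OF exec.Store]) (simp_all del: fun_upd_apply)
  have "?m3(1 := 0) = ?m4" using assms(2) by (auto simp: fun_eq_iff)
  then have 4: "exec (Store (Const 1) (Const 0)) ?m3 3 ?m4"
    by (intro exec_cong[OF exec.Store]) (simp_all del: fun_upd_apply)
  have 5: "exec root_loop ?m4 (47 * n + 11) (?m4(F := n, F + 19 := n * n + 8 * n))"
    by (rule exec_root_loop[where i = 0]) (use assms(3) in \<open>auto simp: F_def\<close>)
  from exec.Seq[OF 1 exec.Seq[OF 2 exec.Seq[OF 3 exec.Seq[OF 4 5]]]]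
  show ?thesis unfolding prelude_def by (rule exec_cong) (simp_all del: fun_upd_apply)
qed

section \<open>The assembled solver and its time bound\<close>

definition solver :: prog where
  "solver = Seq prelude (Seq (compile 0 setup1_com) (Seq (compile 0 setup2_com) (Seq (compile 0 search_com)
     (Store (Const 0) (Load (reg_addr rAns))))))"

text \<open>A sum that dominates every register used as a loop bound, including the number of
  candidates.\<close>

definition loop_bound :: "nat \<Rightarrow> nat" where
  "loop_bound n = (5 * n + 1) + 27 * root4 n ^ 3 + (5 * n + 1) ^ (2 * (27 * root4 n ^ 3))"

definition time_bound :: "nat \<Rightarrow> nat" where
  "time_bound n = 100 * (loop_bound n + 1) + cost setup1_com (loop_bound n) + cost setup2_com (loop_bound n)
     + cost search_com (loop_bound n)"

lemma (in instance_env) solver_run: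
  assumes m: "m 0 = n" "m 1 = 0" "\<And>i. i > n * n + 5 * n \<Longrightarrow> m i = 0"
    and inp: "inp = m(0 := 2 + (n * n + 8 * n))"
  shows "\<exists>t m'. exec solver m t m' \<and> t \<le> time_bound n \<and>
    m' 0 = of_bool (\<exists>k<(5 * n + 1) ^ (2 * (27 * root4 n ^ 3)). \<forall>v<n. card (guess (root4 n) (27 * root4 n ^ 3) L0 k v) = 1)"
proof -
  define F where "F = 2 + (n * n + 8 * n)"
  let ?M = "loop_bound n"
  \<comment> \<open>No input bit lies beyond cell \<open>n * n + 5 * n\<close>, so all cells from
    \<open>F - 1\<close> on are zero.\<close>
  interpret frame inp F
    by standard (use m(3) in \<open>auto simp: inp F_def\<close>)
  define m0 where "m0 = m(0 := F, F := n, F + 19 := n * n + 8 * n)"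
  \<comment> \<open>Register 19 still holds the value left by the prelude; \<open>mult_com\<close>
    resets it before use.\<close>
  define s0 :: state where "s0 = ((\<lambda>_. 0)(0 := n, 19 := n * n + 8 * n), \<lambda>_ _. 0)"
  have e0: "exec prelude m (68 * n + 24) m0"
    unfolding m0_def F_def by (rule exec_prelude) (use m in auto)
  have r0: "rel m0 s0" unfolding rel_def m0_def s0_def using m(3) by (auto simp: inp F_def)
  define s1 where "s1 = run inp setup1_com s0"
  define s2 where "s2 = run inp setup2_com s1"
  define s3 where "s3 = run inp search_com s2"
  have n0: "fst s0 rN = n" by (simp add: s0_def)
  note s1 = setup1_run[OF n0, of inp, folded s1_def]
  have n1: "fst s1 rN = n" unfolding s1_def using n0 by (simp add: run_wregs regs_setup1)
  have s2: "fst s2 rN = n" "fst s2 rD = root4 n" "fst s2 rS = 27 * root4 n ^ 3" "fst s2 rB = 5 * n + 1"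
      "fst s2 rL = 1 + n * n"
    unfolding s2_def using n1 s1 by (simp_all add: run_wregs regs_setup2)
  have s2M: "fst s2 rM = (5 * n + 1) ^ (2 * (27 * root4 n ^ 3))"
    unfolding s2_def setup2_run s1 ..
  have nM: "n \<le> ?M" "5 * n + 1 \<le> ?M" "27 * root4 n ^ 3 \<le> ?M" "(5 * n + 1) ^ (2 * (27 * root4 n ^ 3)) \<le> ?M"
    unfolding loop_bound_def by simp_all
  obtain t1 m1 where 1: "exec (compile 0 setup1_com) m0 t1 m1" "t1 \<le> cost setup1_com ?M" "rel m1 s1"
    using exec_compile[OF wf_setup1 r0, of ?M] n0 nM unfolding s1_def by (auto simp: regs_setup1)
  obtain t2 m2 where 2: "exec (compile 0 setup2_com) m1 t2 m2" "t2 \<le> cost setup2_com ?M" "rel m2 s2"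
    using exec_compile[OF wf_setup2 1(3), of ?M] s1 nM unfolding s2_def by (auto simp: regs_setup2)
  obtain t3 m3 where 3: "exec (compile 0 search_com) m2 t3 m3" "t3 \<le> cost search_com ?M" "rel m3 s3"
    using exec_compile[OF wf_search 2(3), of ?M] s2 s2M nM unfolding s3_def by (auto simp: regs_search)
  have "m3 0 = F" using 3(3) F(2) F(1) unfolding rel_def by auto
  moreover have "m3 (F + 5) = fst s3 rAns" using 3(3) unfolding rel_def by simp
  ultimately have 4: "exec (Store (Const 0) (Load (reg_addr rAns))) m3 7 (m3(0 := fst s3 rAns))"
    by (intro exec_cong[OF exec.Store]) (simp_all add: reg_addr_def)
  have "68 * n + 24 + (t1 + (t2 + (t3 + 7))) \<le> time_bound n"
  proof -
    have "68 * n + 31 \<le> 100 * (?M + 1)" using nM(1) by simp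
    then show ?thesis unfolding time_bound_def using 1(2) 2(2) 3(2) by linarith
  qed
  moreover have "fst s3 rAns = of_bool (\<exists>k<(5 * n + 1) ^ (2 * (27 * root4 n ^ 3)).
      \<forall>v<n. card (guess (root4 n) (27 * root4 n ^ 3) L0 k v) = 1)"
    unfolding s3_def using search_run[OF s2(1,4,3,2,5)] unfolding s2M .
  moreover have "exec solver m (68 * n + 24 + (t1 + (t2 + (t3 + 7)))) (m3(0 := fst s3 rAns))"
    unfolding solver_def by (rule exec.Seq[OF e0 exec.Seq[OF 1(1) exec.Seq[OF 2(1) exec.Seq[OF 3(1) 4]]]])
  ultimately show ?thesis by (intro exI conjI) (assumption, assumption, simp)
qed

section \<open>Running time\<close>

text \<open>Minimality of a nonzero integer root gives \<open>(root4 n - 1) ^ 4 < n\<close>.\<close>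

lemma root4_le: "real (root4 n) \<le> real n powr (1 / 4) + 1"
proof (cases "root4 n = 0")
  case False
  define r where "r = root4 n - 1"
  have r: "root4 n = Suc r" using False by (simp add: r_def)
  have "\<not> n \<le> r ^ 4" using not_less_Least[of r "\<lambda>d. n \<le> d ^ 4"] r unfolding root4_def by simp
  then have lt: "r ^ 4 < n" by simp
  have "real r \<le> real n powr (1 / 4)"
  proof (rule ccontr)
    assume "\<not> ?thesis"
    then have "(real n powr (1 / 4)) ^ 4 \<le> real r ^ 4" by (intro power_mono) auto
    moreover have "(real n powr (1 / 4)) ^ 4 = real n" using lt by (subst powr_power) auto
    ultimately have "real n \<le> real (r ^ 4)" by simp
    then show False using lt by linarith
  qed
  then show ?thesis by (simp add: r)
qed simp

text \<open>With base \<open>a \<ge> 2\<close> and exponent \<open>e\<close>, each summand is at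
  most \<open>a ^ e\<close>, because \<open>e < 2 ^ e\<close>.\<close>

lemma loop_bound_le:
  assumes "n \<ge> 1"
  shows "loop_bound n + 1 \<le> 4 * (5 * n + 1) ^ (2 * (27 * root4 n ^ 3))"
proof -
  define a e where "a = 5 * n + 1" and "e = 2 * (27 * root4 n ^ 3)"
  have "root4 n \<noteq> 0" using le_root4_power[of n] assms by (cases "root4 n") auto
  then have e: "e \<ge> 1" unfolding e_def by simp
  have a: "a \<ge> 2" using assms by (simp add: a_def)
  have "a \<le> a ^ e" using a e by (intro self_le_power) auto
  moreover have "27 * root4 n ^ 3 \<le> e" by (simp add: e_def)
  moreover have "e < 2 ^ e" by (rule less_exp)
  moreover have "(2::nat) ^ e \<le> a ^ e" using a by (intro power_mono) auto
  moreover have "1 \<le> a ^ e" using a by simp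
  moreover have "loop_bound n = a + 27 * root4 n ^ 3 + a ^ e" by (simp add: loop_bound_def a_def e_def)
  ultimately have "loop_bound n + 1 \<le> 4 * a ^ e" by linarith
  then show ?thesis by (simp add: a_def e_def)
qed

lemma time_bound_polynomial: "\<exists>K D. \<forall>n. time_bound n \<le> K * (loop_bound n + 1) ^ D"
proof -
  obtain K D where KD: "\<And>M. cost (setup1_com ;; setup2_com ;; search_com) M \<le> K * (M + 1) ^ D"
    using cost_polynomial by blast
  have "time_bound n \<le> (100 + K) * (loop_bound n + 1) ^ (D + 1)" for n
  proof -
    define M where "M = loop_bound n + 1"
    have "M \<le> M ^ (D + 1)" unfolding M_def by (rule self_le_power) auto
    then have "100 * M \<le> 100 * M ^ (D + 1)" by (rule mult_left_mono) simp
    moreover have "K * M ^ D \<le> K * M ^ (D + 1)" unfolding M_def by (intro mult_left_mono power_increasing) auto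
    moreover have "time_bound n = 100 * M + cost (setup1_com ;; setup2_com ;; search_com) (loop_bound n)"
      by (simp add: time_bound_def M_def)
    moreover have "cost (setup1_com ;; setup2_com ;; search_com) (loop_bound n) \<le> K * M ^ D"
      unfolding M_def by (rule KD)
    ultimately have "time_bound n \<le> 100 * M ^ (D + 1) + K * M ^ (D + 1)"
      using add_mono order_trans by metis
    then show ?thesis unfolding M_def by (simp only: distrib_right)
  qed
  then show ?thesis by blast
qed

text \<open>The logarithm of the number of candidates is at most \<open>h n\<close>, of order
  \<open>n powr (3 / 4) * ln n\<close> and thus negligible against \<open>g n\<close>. This gap
  absorbs the polynomial degree \<open>D\<close> in the exponent, leaving the constant
  \<open>K * 4 ^ D\<close>.\<close>

lemma time_bound_bigo:
  "(\<lambda>n. real (time_bound n)) \<in> O(\<lambda>n. exp ((real n * ln (real n)) powr (4 / 5)))"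
proof -
  define h where "h n = 54 * (real n powr (1 / 4) + 1) ^ 3 * ln (5 * real n + 1)" for n :: nat
  define g where "g n = (real n * ln (real n)) powr (4 / 5)" for n :: nat
  obtain K D where KD: "\<And>n. time_bound n \<le> K * (loop_bound n + 1) ^ D"
    using time_bound_polynomial by blast
  have "h \<in> o(g)" unfolding h_def g_def by real_asymp
  \<comment> \<open>Dividing by \<open>D + 1\<close> rather than \<open>D\<close> covers
    \<open>D = 0\<close>.\<close>
  then have "eventually (\<lambda>n. norm (h n) \<le> 1 / (real D + 1) * norm (g n)) at_top"
    by (rule landau_o.smallD) simp
  then have "eventually (\<lambda>n. norm (real (time_bound n)) \<le> (real K * 4 ^ D) * norm (exp (g n))) at_top"
    using eventually_ge_at_top[of 1]
  proof eventually_elim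
    case (elim n)
    define r where "r = root4 n"
    have pos: "0 \<le> g n" "0 \<le> h n" unfolding g_def h_def by simp_all
    have "real D * h n \<le> (real D + 1) * h n" using pos by (intro mult_right_mono) auto
    also have "\<dots> \<le> g n" using elim(1) pos by (simp add: field_simps)
    finally have Dh: "real D * h n \<le> g n" .
    have "real (2 * (27 * r ^ 3)) * ln (real (5 * n + 1)) = 54 * real r ^ 3 * ln (5 * real n + 1)"
      by (simp add: add.commute)
    also have "\<dots> \<le> h n"
      unfolding h_def r_def using root4_le[of n] by (intro mult_right_mono mult_left_mono power_mono) auto
    finally have le: "real (2 * (27 * r ^ 3)) * ln (real (5 * n + 1)) \<le> h n" .
    have "real (5 * n + 1) ^ (2 * (27 * r ^ 3)) = exp (real (2 * (27 * r ^ 3)) * ln (real (5 * n + 1)))"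
      by (subst exp_of_nat_mult) simp
    also have "\<dots> \<le> exp (h n)" using le by simp
    finally have p: "real (5 * n + 1) ^ (2 * (27 * r ^ 3)) \<le> exp (h n)" .
    have "real (loop_bound n + 1) \<le> real (4 * (5 * n + 1) ^ (2 * (27 * r ^ 3)))"
      using loop_bound_le[OF elim(2)] unfolding r_def by (rule of_nat_mono)
    also have "\<dots> \<le> 4 * exp (h n)" using p by simp
    finally have lb: "real (loop_bound n + 1) \<le> 4 * exp (h n)" .
    have "real (time_bound n) \<le> real (K * (loop_bound n + 1) ^ D)" using KD[of n] by (rule of_nat_mono)
    also have "\<dots> = real K * real (loop_bound n + 1) ^ D" by simp
    also have "\<dots> \<le> real K * (4 * exp (h n)) ^ D" using lb by (intro mult_left_mono power_mono) auto
    also have "\<dots> = real K * 4 ^ D * exp (real D * h n)"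
      by (simp add: power_mult_distrib exp_of_nat_mult)
    also have "\<dots> \<le> real K * 4 ^ D * exp (g n)" using Dh by (intro mult_left_mono) auto
    finally show ?case by simp
  qed
  then show ?thesis unfolding g_def by (rule bigoI)
qed

section \<open>Correctness\<close>

text \<open>An infimum of walk lengths below 6 yields a walk of length below 6, hence at most
  5.\<close>

lemma short_walk_of_diameter:
  assumes G: "pair_graph G" and diam: "diameter G \<le> 5" and uv: "u \<in> pverts G" "v \<in> pverts G"
  shows "\<exists>k\<le>5. \<exists>p. p 0 = u \<and> p k = v \<and> (\<forall>i<k. (p i, p (Suc i)) \<in> parcs G)"
proof -
  interpret pair_graph G by (rule G)
  have "graph_dist G u v \<le> (SUP v\<in>pverts G. graph_dist G u v)" using uv by (intro SUP_upper)
  also have "\<dots> \<le> diameter G" unfolding diameter_def using uv by (intro SUP_upper)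
  also have "\<dots> < 6" using diam by (rule le_less_trans) simp
  finally have "(INF p\<in>{p. awalk u p v}. ereal (awalk_cost (\<lambda>_. 1) p)) < 6"
    unfolding graph_dist_def \<mu>_def .
  then obtain w where w: "awalk u w v" "ereal (awalk_cost (\<lambda>_. 1) w) < 6"
    unfolding INF_less_iff by auto
  have "awalk_cost (\<lambda>_. 1) w = real (length w)" by (induction w) simp_all
  then have len: "length w \<le> 5" using w(2) by simp
  have "\<exists>p. p 0 = u \<and> p (length w) = v \<and> (\<forall>i<length w. (p i, p (Suc i)) \<in> parcs G)"
    using w(1)
  proof (induction w arbitrary: u)
    case Nil
    then show ?case by (intro exI[of _ "\<lambda>_. u"]) (auto simp: awalk_Nil_iff)
  next
    case (Cons e w)
    then have e: "e \<in> parcs G" "u = fst e" "awalk (snd e) w v" by (auto simp: awalk_Cons_iff)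
    obtain p where p: "p 0 = snd e" "p (length w) = v" "\<And>i. i < length w \<Longrightarrow> (p i, p (Suc i)) \<in> parcs G"
      using Cons.IH[OF e(3)] by blast
    let ?q = "\<lambda>i. case i of 0 \<Rightarrow> u | Suc j \<Rightarrow> p j"
    have "(?q i, ?q (Suc i)) \<in> parcs G" if "i < length (e # w)" for i
      using that e(1,2) p(1,3) by (cases i) auto
    then show ?case using p(2) by (intro exI[of _ ?q]) auto
  qed
  then show ?thesis using len by blast
qed

text \<open>Some candidate succeeds iff a solution exists, by \<open>guess_sound\<close> and
  \<open>guess_complete\<close>. The lists \<open>L0\<close> are cut off outside the vertex set,
  where \<open>L\<close> is arbitrary.\<close>

lemma solver_correct:
  assumes V: "pverts G = {..<n}" and inst: "lhom_instance (cycle_graph 5) G L" and diam: "diameter G \<le> 5"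
  shows "solves_lhom_within solver (cycle_graph 5) G L (time_bound n)"
proof -
  define m where "m = lhom_input (cycle_graph 5) G L"
  \<comment> \<open>The memory as the loop programs see it: cell 0 now holds the frame pointer
    instead of \<open>n\<close>.\<close>
  define inp where "inp = m(0 := 2 + (n * n + 8 * n))"
  define E where "E v y \<longleftrightarrow> (v, y) \<in> parcs G" for v y
  define L0 where "L0 v = (if v < n then L v else {})" for v
  have G: "pair_graph G" and Lsub: "\<And>v. v < n \<Longrightarrow> L v \<subseteq> {..<5}"
    using inst V unfolding lhom_instance_def by (auto simp: cycle_graph_def)
  interpret pair_graph G by (rule G)
  have m_eq: "m i = (if i = 0 then n else if i \<le> n * n then of_bool (((i - 1) div n, (i - 1) mod n) \<in> parcs G)
     else if i \<le> n * n + n * 5 then of_bool ((i - n * n - 1) mod 5 \<in> L ((i - n * n - 1) div 5)) else 0)" for i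
    unfolding m_def lhom_input_def by (simp add: V cycle_graph_def Let_def)
  have E_less: "v < n" "y < n" if "E v y" for v y
    using that V unfolding E_def by (auto dest: in_arcsD1 in_arcsD2)
  interpret instance_env n E inp L0
  proof
    fix v y
    assume "E v y"
    then show "E y v" unfolding E_def by (simp add: arcs_symmetric)
  next
    fix v y
    assume "E v y"
    then show "v < n" by (rule E_less)
  next
    fix v y
    assume vy: "v < n" "y < n"
    have "v * n + y < v * n + n" using vy by simp
    also have "\<dots> = Suc v * n" by simp
    also have "\<dots> \<le> n * n" using vy by (intro mult_right_mono) auto
    finally have "1 + v * n + y \<le> n * n" by simp
    moreover have "(v * n + y) div n = v" "(v * n + y) mod n = y" using vy by simp_all
    ultimately show "inp (1 + v * n + y) \<noteq> 0 \<longleftrightarrow> E v y" by (simp add: inp_def m_eq E_def)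
  next
    fix v c :: nat
    assume vc: "v < n" "c < 5"
    have "5 * v + c < n * 5" using vc by linarith
    moreover have "(5 * v + c) div 5 = v" "(5 * v + c) mod 5 = c" using vc by simp_all
    ultimately show "inp (1 + n * n + (5 * v + c)) \<noteq> 0 \<longleftrightarrow> c \<in> L0 v"
      using vc by (simp add: inp_def m_eq L0_def)
  next
    fix v
    show "L0 v \<subseteq> {..<5}" using Lsub by (simp add: L0_def)
  next
    fix v
    assume "n \<le> v"
    then show "L0 v = {}" by (simp add: L0_def)
  qed
  have "m 1 = 0"
  proof (cases "n = 0")
    case False
    have "(0, 0) \<notin> parcs G" using no_loops by (metis fst_conv snd_conv)
    then show ?thesis using False by (simp add: m_eq)
  qed (simp add: m_eq)
  moreover have "m 0 = n" by (simp add: m_eq)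
  moreover have "m i = 0" if "i > n * n + 5 * n" for i using that by (simp add: m_eq)
  ultimately obtain t m' where run: "exec solver m t m'" "t \<le> time_bound n"
    "m' 0 = of_bool (\<exists>k<(5 * n + 1) ^ (2 * (27 * root4 n ^ 3)). \<forall>v<n. card (guess (root4 n) (27 * root4 n ^ 3) L0 k v) = 1)"
    using solver_run[of m] inp_def by blast
  have walk: "\<exists>k\<le>5. \<exists>p. p 0 = u \<and> p k = v \<and> (\<forall>i<k. E (p i) (p (Suc i)))" if "u < n" "v < n" for u v
    unfolding E_def by (rule short_walk_of_diameter[OF G diam]) (use that V in auto)
  have sol_iff: "sol L0 \<phi> \<longleftrightarrow> list_hom (cycle_graph 5) G L \<phi>" for \<phi>
    unfolding sol_def list_hom_def V by (auto simp: L0_def E_def adj5_def)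
  have "(\<exists>k<(5 * n + 1) ^ (2 * (27 * root4 n ^ 3)). \<forall>v<n. card (guess (root4 n) (27 * root4 n ^ 3) L0 k v) = 1)
      \<longleftrightarrow> (\<exists>\<phi>. sol L0 \<phi>)"
    using guess_sound guess_complete[of L0, OF _ L0 le_root4_power walk refl] by blast
  then have "m' 0 = of_bool (\<exists>\<phi>. list_hom (cycle_graph 5) G L \<phi>)"
    unfolding run(3) by (simp only: sol_iff)
  then show ?thesis
    unfolding solves_lhom_within_def m_def[symmetric] using run(1,2) by blast
qed

theorem theorem6:
  shows "\<exists>(p :: prog) (T :: nat \<Rightarrow> nat).
    (\<lambda>n. real (T n)) \<in> O(\<lambda>n. exp ((real n * ln (real n)) powr (4 / 5))) \<and>
    (\<forall>(n :: nat) (G :: nat pair_pre_digraph) (L :: nat \<Rightarrow> nat set).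
      pverts G = {..<n} \<longrightarrow> lhom_instance (cycle_graph 5) G L \<longrightarrow> diameter G \<le> 5 \<longrightarrow>
      solves_lhom_within p (cycle_graph 5) G L (T n))"
  using time_bound_bigo solver_correct by blast

end
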